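(* Let $d\in\{3,4\}$ and let $\sigma=\sigma_d$, where $\sigma_3=\frac76$ and $\sigma_4=\frac32-\delta$ for an arbitrary fixed $\delta\in(0,\frac12)$. There exists $\epsilon>0$ such that, whenever $V:\mathbb{Z}^d\to\mathbb{C}$ satisfies $\|V\|_{\ell^\sigma(\mathbb{Z}^d)}\le\epsilon$, the eigenvalue problem $$\sqrt{1-\Delta}\,\psi+V\psi=\lambda\psi,\qquad \psi\in\ell^2(\mathbb{Z}^d),$$ has no nontrivial solution (that is, for every $\lambda\in\mathbb{C}$ the only solution $\psi\in\ell^2(\mathbb{Z}^d)$ is $\psi=0$).
   Context: $\Delta$ is the discrete Laplacian on $\mathbb{Z}^d$, $\Delta\psi(x)=\sum_{|x-y|=1}\psi(y)-2d\,\psi(x)$, and $\sqrt{1-\Delta}$ is the operator on $\ell^2(\mathbb{Z}^d)$ given by the Fourier multiplier $\omega(\xi)=\sqrt{1+\sum_{j=1}^d2(1-\cos\xi_j)}$. $V\psi$ denotes pointwise multiplication. *)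

theory Defs
  imports "HOL-Analysis.Analysis"
begin

definition ell :: "real \<Rightarrow> ('a \<Rightarrow> complex) set" where
  "ell p = {f. (\<lambda>x. norm (f x) powr p) summable_on UNIV}"

definition ell_norm :: "real \<Rightarrow> ('a \<Rightarrow> complex) \<Rightarrow> real" where
  "ell_norm p f = (\<Sum>\<^sub>\<infinity>x. norm (f x) powr p) powr (1 / p)"

text \<open>The lattice of dimension \<open>d\<close> is \<open>int ^ 'd\<close> with \<open>d = CARD('d)\<close>, and its dual torus is
  represented by the fundamental domain \<open>[-pi, pi]^d\<close> with (unnormalised) Lebesgue measure.\<close>

definition torus :: "(real ^ 'd::finite) measure" where
  "torus = restrict_space lborel (cbox (\<chi> j. - pi) (\<chi> j. pi))"

definition pairing :: "int ^ 'd::finite \<Rightarrow> real ^ 'd \<Rightarrow> real" where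
  "pairing x \<xi> = (\<Sum>j\<in>UNIV. of_int (x $ j) * \<xi> $ j)"

definition square_integrable :: "(real ^ 'd::finite \<Rightarrow> complex) \<Rightarrow> bool" where
  "square_integrable f \<longleftrightarrow>
     f \<in> borel_measurable torus \<and> integrable torus (\<lambda>\<xi>. (norm (f \<xi>))\<^sup>2)"

text \<open>The Fourier transform on square-summable functions: the Fourier series
  \<open>\<Sum>x. \<psi>(x) e^(-i x\<cdot>\<xi>)\<close>, summed unconditionally in \<open>L^2\<close> of the torus.
  The \<open>L^2\<close>-sum exists for every \<open>\<psi>\<close> in \<open>ell 2\<close> (Riesz-Fischer) and is unique up to null sets,
  so the choice of a representative below affects no integral.\<close>

definition is_fourier_transform ::
    "(int ^ 'd::finite \<Rightarrow> complex) \<Rightarrow> (real ^ 'd \<Rightarrow> complex) \<Rightarrow> bool" where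
  "is_fourier_transform \<psi> f \<longleftrightarrow> square_integrable f \<and>
     ((\<lambda>A. LINT \<xi>|torus. (norm (f \<xi> - (\<Sum>x\<in>A. \<psi> x * cis (- pairing x \<xi>))))\<^sup>2) \<longlongrightarrow> 0)
       (finite_subsets_at_top UNIV)"

definition fourier :: "(int ^ 'd::finite \<Rightarrow> complex) \<Rightarrow> real ^ 'd \<Rightarrow> complex" where
  "fourier \<psi> = (SOME f. is_fourier_transform \<psi> f)"

definition inverse_fourier :: "(real ^ 'd::finite \<Rightarrow> complex) \<Rightarrow> int ^ 'd \<Rightarrow> complex" where
  "inverse_fourier f x =
     (LINT \<xi>|torus. f \<xi> * cis (pairing x \<xi>)) / of_real ((2 * pi) ^ CARD('d))"

definition fourier_multiplier ::
    "(real ^ 'd::finite \<Rightarrow> real) \<Rightarrow> (int ^ 'd \<Rightarrow> complex) \<Rightarrow> int ^ 'd \<Rightarrow> complex" where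
  "fourier_multiplier m \<psi> = inverse_fourier (\<lambda>\<xi>. of_real (m \<xi>) * fourier \<psi> \<xi>)"

definition symbol_omega :: "real ^ 'd::finite \<Rightarrow> real" where
  "symbol_omega \<xi> = sqrt (1 + (\<Sum>j\<in>UNIV. 2 * (1 - cos (\<xi> $ j))))"

text \<open>The operator \<open>sqrt (1 - \<Delta>)\<close>, where \<open>\<Delta>\<close> is the discrete Laplacian.
  It is meaningful on \<open>ell 2\<close> only.\<close>

definition sqrt_one_minus_laplacian ::
    "(int ^ 'd::finite \<Rightarrow> complex) \<Rightarrow> int ^ 'd \<Rightarrow> complex" where
  "sqrt_one_minus_laplacian = fourier_multiplier symbol_omega"

text \<open>Used for \<open>d = 3\<close>, where \<open>\<delta>\<close> plays no role, and for \<open>d = 4\<close>.\<close>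

definition sigma_exponent :: "nat \<Rightarrow> real \<Rightarrow> real" where
  "sigma_exponent d \<delta> = (if d = 3 then 7 / 6 else 3 / 2 - \<delta>)"

end

theory Submission
  imports Defs
begin

text \<open>
  Let \<open>N\<close> be the adjacency operator of the lattice. Applying \<open>sqrt (1 - \<Delta>) + \<mu>\<close> to the eigenvalue
  equation gives \<open>(N - w) \<psi> = (sqrt (1 - \<Delta>) + \<mu>) (V \<psi>)\<close> with \<open>w = 1 + 2 d - \<mu>^2\<close>, and after complex
  conjugation \<open>Im w \<le> 0\<close>. Since \<open>exp (i t N / 2) \<psi>\<close> tends to \<open>0\<close> pointwise, Duhamel's formula
  expresses \<open>\<psi>\<close> as the integral over \<open>t > 0\<close> of \<open>exp (i t (N - w) / 2)\<close> applied to the right-hand side.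

  The kernel of \<open>exp (i t N / 2)\<close> is, up to a phase, a product of \<open>d\<close> Bessel functions \<open>J_n(t)\<close>. As
  \<open>J_n^4\<close> has integral \<open>O(log T / T)\<close> over \<open>[T, 2 T]\<close> uniformly in \<open>n\<close>, the kernel integrated over this
  window is \<open>O(T^(1 - d/2) log T)\<close> uniformly in space, while on \<open>l^2\<close> the window contributes at most \<open>T\<close>.
  Splitting \<open>|V|^(1/2)\<close> at height \<open>T^(-\<kappa>/2)\<close> combines the two bounds, and for \<open>2 (\<sigma> - 1) < d/2 - 1\<close> a
  suitable \<open>\<kappa> > 2\<close> makes the dyadic windows summable. So \<open>|V|^(1/2) \<psi>\<close> is bounded in \<open>l^2\<close> by a small
  multiple of itself and vanishes.
\<close>

section \<open>Bessel functions of integer order\<close>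

text \<open>The obstacle is the turning point \<open>t = |n|\<close>: there \<open>J_n(t)\<close> is
  only of size \<open>t^(-1/3)\<close>, so pointwise the kernel decays no faster than
  \<open>t^(-d/3)\<close>, which for \<open>d = 3\<close> is not even integrable. That peak lasts
  only a time of order \<open>t^(1/3)\<close>. In the fourth power it contributes
  \<open>O(1/T)\<close>, the oscillating part \<open>1/(t^2 - n^2)\<close> adds the logarithm, and
  on average each factor behaves like \<open>t^(-1/2)\<close>. Uniformity in \<open>n\<close> comes
  from an energy argument on Bessel's equation. All operators are power series in \<open>N\<close>
  with coefficients absolutely summable on the spectral interval. The series of
  \<open>sqrt (1 - \<Delta>)\<close> is one, as its radius of convergence \<open>1 + 2 d\<close>
  exceeds \<open>2 d\<close>. One number, \<open>coeff_norm\<close>, then controls the action on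
  bounded functions, the \<open>l^2\<close> bound and the time-integrated kernel. For
  \<open>sqrt (1 - \<Delta>) + \<mu>\<close> it grows with \<open>|\<mu>|\<close>, so large
  \<open>\<mu>\<close> are excluded separately by a supremum bound. The two parts of a window are of
  size \<open>T^(1 - d/2 + \<kappa> (\<sigma> - 1))\<close>, up to the logarithm, and
  \<open>T^(1 - \<kappa>/2)\<close>; hence the conditions on \<open>\<kappa>\<close> and
  \<open>\<sigma>\<close>.\<close>

definition bessel :: "int \<Rightarrow> real \<Rightarrow> real" where
  "bessel n t = integral {0..pi} (\<lambda>\<theta>. cos (of_int n * \<theta> - t * sin \<theta>)) / pi"

lemma bessel_integrand_integrable:
  "(\<lambda>\<theta>. cos (a * \<theta> - t * sin \<theta>)) integrable_on {0..pi}"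
  by (intro integrable_continuous_interval continuous_intros)

lemma bessel_phase_shift:
  fixes \<theta> t :: real
  shows "of_int (n - 1) * \<theta> - t * sin \<theta> = (of_int n * \<theta> - t * sin \<theta>) - \<theta>"
    and "of_int (n + 1) * \<theta> - t * sin \<theta> = (of_int n * \<theta> - t * sin \<theta>) + \<theta>"
  by (simp_all add: algebra_simps)

lemma cos_shift_sum:
  fixes \<theta> t :: real
  shows "cos (of_int (n - 1) * \<theta> - t * sin \<theta>) + cos (of_int (n + 1) * \<theta> - t * sin \<theta>)
    = 2 * (cos \<theta> * cos (of_int n * \<theta> - t * sin \<theta>))"
  unfolding bessel_phase_shift cos_add[of "_ - _"] cos_diff[of "_ - _"] by simp

lemma cos_shift_diff:
  fixes \<theta> t :: real
  shows "cos (of_int (n - 1) * \<theta> - t * sin \<theta>) - cos (of_int (n + 1) * \<theta> - t * sin \<theta>)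
    = 2 * (sin \<theta> * sin (of_int n * \<theta> - t * sin \<theta>))"
  unfolding bessel_phase_shift cos_add[of "_ - _"] cos_diff[of "_ - _"] by simp

lemma bessel_has_derivative:
  "(bessel n has_real_derivative (bessel (n - 1) t - bessel (n + 1) t) / 2) (at t)"
proof -
  have "((\<lambda>t. integral (cbox 0 pi) (\<lambda>\<theta>. cos (of_int n * \<theta> - t * sin \<theta>))) has_field_derivative
      integral (cbox 0 pi) (\<lambda>\<theta>. sin \<theta> * sin (of_int n * \<theta> - t * sin \<theta>))) (at t within UNIV)"
    by (rule leibniz_rule_field_derivative)
      (auto intro!: derivative_eq_intros integrable_continuous_interval continuous_intros
        simp: split_beta)
  moreover have "integral {0..pi} (\<lambda>\<theta>. sin \<theta> * sin (of_int n * \<theta> - t * sin \<theta>))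
      = pi * ((bessel (n - 1) t - bessel (n + 1) t) / 2)"
  proof -
    have "integral {0..pi} (\<lambda>\<theta>. sin \<theta> * sin (of_int n * \<theta> - t * sin \<theta>))
      = integral {0..pi} (\<lambda>\<theta>. (cos (of_int (n - 1) * \<theta> - t * sin \<theta>)
            - cos (of_int (n + 1) * \<theta> - t * sin \<theta>)) / 2)"
      by (intro integral_cong) (simp add: cos_shift_diff del: of_int_diff of_int_add)
    also have "\<dots> = (integral {0..pi} (\<lambda>\<theta>. cos (of_int (n - 1) * \<theta> - t * sin \<theta>))
       - integral {0..pi} (\<lambda>\<theta>. cos (of_int (n + 1) * \<theta> - t * sin \<theta>))) / 2"
      by (subst integral_diff[symmetric]) (auto intro: bessel_integrand_integrable simp del: of_int_diff of_int_add)
    finally show ?thesis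
      unfolding bessel_def diff_divide_distrib[symmetric] by simp
  qed
  moreover have "bessel n = (\<lambda>t. integral (cbox 0 pi) (\<lambda>\<theta>. cos (of_int n * \<theta> - t * sin \<theta>)) / pi)"
    by (simp add: bessel_def fun_eq_iff)
  ultimately show ?thesis
    using DERIV_cdivide[of _ _ t UNIV pi] by fastforce
qed

lemma continuous_on_bessel [continuous_intros]:
  "continuous_on A f \<Longrightarrow> continuous_on A (\<lambda>t. bessel n (f t))"
  using continuous_on_compose2[of UNIV "bessel n" A f] bessel_has_derivative
  by (metis DERIV_isCont continuous_at_imp_continuous_on subset_UNIV)

text \<open>The integrand \<open>(n - t cos \<theta>) cos (n \<theta> - t sin \<theta>)\<close> is
  the derivative of \<open>sin (n \<theta> - t sin \<theta>)\<close>, which vanishes at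
  \<open>0\<close> and, \<open>n\<close> being an integer, at \<open>pi\<close>. Product-to-sum
  turns the vanishing integral into the recurrence.\<close>

lemma bessel_recurrence: "t * (bessel (n - 1) t + bessel (n + 1) t) = 2 * of_int n * bessel n t"
proof -
  let ?I = "\<lambda>m. integral {0..pi} (\<lambda>\<theta>. cos (of_int m * \<theta> - t * sin \<theta>))"
  have "((\<lambda>\<theta>. (of_int n - t * cos \<theta>) * cos (of_int n * \<theta> - t * sin \<theta>)) has_integral
      sin (of_int n * pi - t * sin pi) - sin (of_int n * 0 - t * sin 0)) {0..pi}"
    by (intro fundamental_theorem_of_calculus)
      (auto intro!: derivative_eq_intros simp flip: has_real_derivative_iff_has_vector_derivative)
  moreover have "sin (of_int n * pi) = (0::real)"
    by (simp add: mult.commute sin_zero_iff_int2)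
  ultimately have "integral {0..pi} (\<lambda>\<theta>. (of_int n - t * cos \<theta>) * cos (of_int n * \<theta> - t * sin \<theta>)) = 0"
    by (simp add: integral_unique)
  moreover have "integral {0..pi} (\<lambda>\<theta>. (of_int n - t * cos \<theta>) * cos (of_int n * \<theta> - t * sin \<theta>))
     = integral {0..pi} (\<lambda>\<theta>. of_int n * cos (of_int n * \<theta> - t * sin \<theta>) -
         (t/2) * (cos (of_int (n-1) * \<theta> - t * sin \<theta>) + cos (of_int (n+1) * \<theta> - t * sin \<theta>)))"
    by (intro integral_cong) (simp only: cos_shift_sum, simp add: algebra_simps)
  moreover have "\<dots> = of_int n * ?I n - (t/2) * (?I (n-1) + ?I (n+1))"
    by (subst integral_diff integral_add integral_mult_right;
        (intro integrable_on_mult_right integrable_add bessel_integrand_integrable)?)+ simp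
  ultimately have "of_int n * ?I n = (t/2) * (?I (n-1) + ?I (n+1))" by simp
  then show ?thesis by (simp add: bessel_def field_simps del: of_int_diff of_int_add)
qed

lemma abs_bessel_le_1: "\<bar>bessel n t\<bar> \<le> 1"
proof -
  have "norm (integral {0..pi} (\<lambda>\<theta>. cos (of_int n * \<theta> - t * sin \<theta>))) \<le> 1 * (pi - 0)"
    by (rule integral_bound) (auto intro!: continuous_intros)
  then show ?thesis by (simp add: bessel_def)
qed

lemma bessel_0: "bessel n 0 = (if n = 0 then 1 else 0)"
proof (cases "n = 0")
  case False
  have "((\<lambda>\<theta>. cos (of_int n * \<theta>)) has_integral
      sin (of_int n * pi) / of_int n - sin (of_int n * 0) / of_int n) {0..pi}"
    using False by (intro fundamental_theorem_of_calculus)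
      (auto intro!: derivative_eq_intros simp flip: has_real_derivative_iff_has_vector_derivative)
  moreover have "sin (of_int n * pi) = (0::real)"
    by (simp add: mult.commute sin_zero_iff_int2)
  ultimately show ?thesis using False by (simp add: bessel_def integral_unique)
qed (simp add: bessel_def)

text \<open>\<open>bessel_D n t\<close> is \<open>t * bessel' n t\<close>, and by Bessel's equation \<open>bessel_H\<close> has derivative \<open>2 t J^2\<close>.\<close>

definition bessel_D :: "int \<Rightarrow> real \<Rightarrow> real" where
  "bessel_D n t = t * bessel (n - 1) t - of_int n * bessel n t"

definition bessel_H :: "int \<Rightarrow> real \<Rightarrow> real" where
  "bessel_H n t = (bessel_D n t)\<^sup>2 + (t\<^sup>2 - (of_int n)\<^sup>2) * (bessel n t)\<^sup>2"

lemma bessel_DERIV_D: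
  assumes "t \<noteq> 0" shows "(bessel n has_real_derivative bessel_D n t / t) (at t)"
proof -
  have "(bessel (n - 1) t - bessel (n + 1) t) / 2 = bessel_D n t / t"
    using bessel_recurrence[of t n] assms by (simp add: bessel_D_def field_simps)
  then show ?thesis using bessel_has_derivative[of n t] by simp
qed

text \<open>Bessel's equation in first-order form: with \<open>J' = D / t\<close>, the pair
  \<open>(J, D)\<close> satisfies a system from which the energy identities below follow by
  algebra.\<close>

lemma bessel_D_DERIV:
  assumes "t \<noteq> 0"
  shows "(bessel_D n has_real_derivative ((of_int n)\<^sup>2 / t - t) * bessel n t) (at t)"
proof -
  have r1: "t * bessel (n + 1) t = 2 * of_int n * bessel n t - t * bessel (n - 1) t"
    using bessel_recurrence[of t n] by (simp add: algebra_simps)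
  have r2: "t * bessel (n - 2) t = 2 * (of_int n - 1) * bessel (n-1) t - t * bessel n t"
    using bessel_recurrence[of t "n-1"] by (simp add: algebra_simps)
  have "(bessel_D n has_real_derivative
     (bessel (n - 1) t + (t * bessel (n - 2) t - t * bessel n t) / 2) - of_int n * (bessel_D n t / t)) (at t)"
    unfolding bessel_D_def[abs_def]
    by (rule derivative_eq_intros refl bessel_DERIV_D[OF assms, unfolded bessel_D_def] bessel_has_derivative)+
       (use assms in \<open>simp add: field_simps\<close>)
  moreover have "(bessel (n - 1) t + (t * bessel (n - 2) t - t * bessel n t) / 2) - of_int n * (bessel_D n t / t)
     = ((of_int n)\<^sup>2 / t - t) * bessel n t"
    unfolding r2 bessel_D_def using assms by (simp add: field_simps power2_eq_square)
  ultimately show ?thesis by simp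
qed

lemma bessel_H_DERIV:
  assumes "t \<noteq> 0"
  shows "(bessel_H n has_real_derivative 2 * t * (bessel n t)\<^sup>2) (at t)"
  unfolding bessel_H_def[abs_def]
  by (rule derivative_eq_intros refl bessel_D_DERIV bessel_DERIV_D assms)+
     (use assms in \<open>simp add: field_simps power2_eq_square\<close>)

lemma bessel_P_DERIV:
  assumes "t \<noteq> 0"
  shows "((\<lambda>t. bessel n t * bessel_D n t) has_real_derivative
     ((bessel_D n t)\<^sup>2 + ((of_int n)\<^sup>2 - t\<^sup>2) * (bessel n t)\<^sup>2) / t) (at t)"
  by (rule derivative_eq_intros refl bessel_D_DERIV bessel_DERIV_D assms)+
     (use assms in \<open>simp add: field_simps power2_eq_square\<close>)

lemma continuous_on_bessel_D [continuous_intros]: "continuous_on A (bessel_D n)"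
  unfolding bessel_D_def[abs_def] by (intro continuous_intros)

lemma continuous_on_bessel_H [continuous_intros]: "continuous_on A (bessel_H n)"
  unfolding bessel_H_def[abs_def] by (intro continuous_intros)

lemma bessel_D_0: "bessel_D n 0 = 0"
  by (simp add: bessel_D_def bessel_0)

lemma bessel_H_0: "bessel_H n 0 = 0"
  by (simp add: bessel_H_def bessel_D_0 bessel_0)

lemma bessel_H_mono:
  assumes "0 \<le> s" "s \<le> t" shows "bessel_H n s \<le> bessel_H n t"
proof (cases "s = t")
  case False
  show ?thesis
    by (rule DERIV_nonneg_imp_increasing_open[OF assms(2)])
       (use assms in \<open>auto intro!: exI bessel_H_DERIV continuous_intros\<close>)
qed simp

lemma bessel_H_nonneg: "0 \<le> t \<Longrightarrow> 0 \<le> bessel_H n t"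
  using bessel_H_mono[of 0 t n] by (simp add: bessel_H_0)

text \<open>The energy \<open>bessel_H\<close> is of size \<open>sqrt (t^2 - n^2)\<close>. Adding \<open>bessel_k * J * D\<close> to the quotient \<open>bessel_h\<close> removes
  the oscillating part of its derivative: what remains is \<open>bessel_k' * J * D\<close>, which Gronwall's argument
  absorbs wherever \<open>bessel_k \<le> 1\<close>.\<close>

definition bessel_k :: "int \<Rightarrow> real \<Rightarrow> real" where
  "bessel_k n t = t\<^sup>2 / sqrt (t\<^sup>2 - (of_int n)\<^sup>2) ^ 3"

definition bessel_k' :: "int \<Rightarrow> real \<Rightarrow> real" where
  "bessel_k' n t = - (t * (t\<^sup>2 + 2 * (of_int n)\<^sup>2)) / sqrt (t\<^sup>2 - (of_int n)\<^sup>2) ^ 5"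

definition bessel_h :: "int \<Rightarrow> real \<Rightarrow> real" where
  "bessel_h n t = bessel_H n t / sqrt (t\<^sup>2 - (of_int n)\<^sup>2)"

definition bessel_g :: "int \<Rightarrow> real \<Rightarrow> real" where
  "bessel_g n t = bessel_h n t + bessel_k n t * (bessel n t * bessel_D n t)"

context
  fixes n :: int and t r :: real
  assumes t: "\<bar>of_int n\<bar> < t"
  defines "r \<equiv> sqrt (t\<^sup>2 - (of_int n)\<^sup>2)"
begin

lemma bessel_t_pos: "0 < t" using t by linarith

lemma bessel_sq_less: "(of_int n)\<^sup>2 < t\<^sup>2"
  using t by (metis abs_le_square_iff abs_of_pos linorder_not_le bessel_t_pos)

lemma bessel_r_pos: "0 < r" using bessel_sq_less by (simp add: r_def)

lemma bessel_r_square: "r\<^sup>2 = t\<^sup>2 - (of_int n)\<^sup>2" using bessel_sq_less by (simp add: r_def)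

lemma bessel_r_DERIV: "((\<lambda>t. sqrt (t\<^sup>2 - (of_int n)\<^sup>2)) has_real_derivative t / r) (at t)"
  using bessel_sq_less unfolding r_def
  by (auto intro!: derivative_eq_intros simp: field_simps)

lemma bessel_k_DERIV: "(bessel_k n has_real_derivative bessel_k' n t) (at t)"
proof -
  have *: "t\<^sup>2 + 2 * (of_int n)\<^sup>2 = 3 * t\<^sup>2 - 2 * r\<^sup>2" unfolding bessel_r_square by simp
  have "(bessel_k n has_real_derivative (2 * t * r ^ 3 - t\<^sup>2 * (3 * r\<^sup>2 * (t / r))) / (r ^ 3 * r ^ 3)) (at t)"
    unfolding bessel_k_def[abs_def]
    by (rule derivative_eq_intros refl bessel_r_DERIV)+ (use bessel_r_pos in \<open>auto simp: r_def[symmetric]\<close>)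
  moreover have "(2 * t * r ^ 3 - t\<^sup>2 * (3 * r\<^sup>2 * (t / r))) / (r ^ 3 * r ^ 3) = bessel_k' n t"
    unfolding bessel_k'_def r_def[symmetric] * using bessel_r_pos bessel_t_pos
    by (simp add: field_simps power2_eq_square power3_eq_cube) (simp add: eval_nat_numeral algebra_simps)
  ultimately show ?thesis by simp
qed

lemma bessel_k'_nonpos: "bessel_k' n t \<le> 0"
  unfolding bessel_k'_def r_def[symmetric] using bessel_r_pos bessel_t_pos
  by (intro divide_nonpos_pos) (auto intro: mult_nonneg_nonneg)

lemma bessel_H_eq_r: "bessel_H n t = (bessel_D n t)\<^sup>2 + r\<^sup>2 * (bessel n t)\<^sup>2"
  by (simp add: bessel_H_def bessel_r_square)

lemma bessel_P_le: "\<bar>bessel n t * bessel_D n t\<bar> \<le> bessel_h n t / 2"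
proof -
  have "0 \<le> (\<bar>bessel_D n t\<bar> - r * \<bar>bessel n t\<bar>)\<^sup>2" by simp
  then have "2 * r * \<bar>bessel n t * bessel_D n t\<bar> \<le> bessel_H n t"
    by (simp add: bessel_H_eq_r power2_eq_square algebra_simps abs_mult)
  then show ?thesis using bessel_r_pos by (simp add: bessel_h_def r_def[symmetric] field_simps)
qed

lemma bessel_g_DERIV:
  "(bessel_g n has_real_derivative bessel_k' n t * (bessel n t * bessel_D n t)) (at t)"
proof -
  let ?J = "bessel n t" and ?D = "bessel_D n t"
  have dh: "(bessel_h n has_real_derivative (2 * t * ?J\<^sup>2 * r - bessel_H n t * (t / r)) / (r * r)) (at t)"
    unfolding bessel_h_def[abs_def]
    using DERIV_divide[OF bessel_H_DERIV[of t n] bessel_r_DERIV] bessel_r_pos bessel_t_pos by (simp add: r_def[symmetric])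
  have "(bessel_g n has_real_derivative
      (2 * t * ?J\<^sup>2 * r - bessel_H n t * (t / r)) / (r * r) +
      (bessel_k' n t * (?J * ?D) + (?D\<^sup>2 + ((of_int n)\<^sup>2 - t\<^sup>2) * ?J\<^sup>2) / t * bessel_k n t)) (at t)"
    unfolding bessel_g_def[abs_def]
    by (intro DERIV_add dh) (use DERIV_mult'[OF bessel_k_DERIV bessel_P_DERIV[of t n]] bessel_t_pos in \<open>simp add: algebra_simps\<close>)
  \<comment> \<open>This cancellation determines \<open>bessel_k\<close>. With
    \<open>r^2 = t^2 - n^2\<close>, the derivative of \<open>bessel_h\<close> is
    \<open>(t / r^3) (r^2 J^2 - D^2)\<close> and that of \<open>J * D\<close> is
    \<open>(D^2 - r^2 J^2) / t\<close>, so the factor must be \<open>t^2 / r^3\<close>.\<close>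
  moreover have "(2 * t * ?J\<^sup>2 * r - bessel_H n t * (t / r)) / (r * r) +
      (?D\<^sup>2 + ((of_int n)\<^sup>2 - t\<^sup>2) * ?J\<^sup>2) / t * bessel_k n t = 0"
  proof -
    have *: "(of_int n)\<^sup>2 - t\<^sup>2 = - r\<^sup>2" by (simp add: bessel_r_square)
    show ?thesis unfolding * bessel_k_def r_def[symmetric] bessel_H_eq_r using bessel_r_pos bessel_t_pos
      by (simp add: field_simps power2_eq_square power3_eq_cube)
  qed
  ultimately show ?thesis by (simp add: algebra_simps)
qed

lemma bessel_k_nonneg: "0 \<le> bessel_k n t"
  unfolding bessel_k_def r_def[symmetric] using bessel_r_pos by simp

text \<open>Where \<open>bessel_k \<le> 1\<close>, the bound \<open>bessel_P_le\<close> makes the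
  correction at most half of \<open>bessel_h\<close>. So \<open>bessel_g\<close> and
  \<open>bessel_h\<close> are comparable, and \<open>|J * D| \<le> bessel_g\<close>, the form that
  Gronwall's argument uses.\<close>

lemma bessel_g_bounds:
  assumes "bessel_k n t \<le> 1"
  shows "bessel_h n t / 2 \<le> bessel_g n t" "bessel_g n t \<le> 3 / 2 * bessel_h n t"
    "\<bar>bessel n t * bessel_D n t\<bar> \<le> bessel_g n t"
proof -
  have "\<bar>bessel_k n t * (bessel n t * bessel_D n t)\<bar> \<le> 1 * (bessel_h n t / 2)"
    unfolding abs_mult[of "bessel_k n t"] using bessel_k_nonneg assms
    by (intro mult_mono bessel_P_le) auto
  then show "bessel_h n t / 2 \<le> bessel_g n t" "bessel_g n t \<le> 3 / 2 * bessel_h n t"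
    unfolding bessel_g_def by (auto simp: abs_le_iff)
  then show "\<bar>bessel n t * bessel_D n t\<bar> \<le> bessel_g n t" using bessel_P_le by linarith
qed

text \<open>The condition reads \<open>r \<ge> t^(2/3)\<close>: the time lies beyond the turning
  point by at least a distance of order \<open>t^(1/3)\<close>, the width of the Airy zone.\<close>

lemma bessel_k_le_1_iff: "bessel_k n t \<le> 1 \<longleftrightarrow> t\<^sup>2 \<le> r ^ 3"
  unfolding bessel_k_def r_def[symmetric] using bessel_r_pos by (simp add: field_simps)

end

lemma bessel_k_antimono:
  assumes "\<bar>of_int n\<bar> < s" "s \<le> t" shows "bessel_k n t \<le> bessel_k n s"
  by (rule DERIV_nonpos_imp_nonincreasing[OF assms(2)])
    (use assms in \<open>auto intro!: exI bessel_k_DERIV bessel_k'_nonpos\<close>)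

text \<open>Since \<open>g' = k' * J * D\<close> with \<open>|J * D| \<le> g\<close> and
  \<open>k' \<le> 0\<close>, one has \<open>|g'| \<le> - k' * g\<close>, so \<open>g * exp k\<close>
  decreases and \<open>g * exp (- k)\<close> increases. As \<open>k\<close> stays in
  \<open>[0, 1]\<close>, passing between two times costs at most a factor
  \<open>exp 1\<close>.\<close>

lemma bessel_g_exp_nonincreasing:
  assumes "\<bar>of_int n\<bar> < s" "s \<le> t" "bessel_k n s \<le> 1"
  shows "bessel_g n t * exp (bessel_k n t) \<le> bessel_g n s * exp (bessel_k n s)"
proof (rule DERIV_nonpos_imp_nonincreasing[OF assms(2)], intro exI conjI)
  fix x assume x: "s \<le> x" "x \<le> t"
  then have nx: "\<bar>of_int n\<bar> < x" and k: "bessel_k n x \<le> 1"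
    using assms bessel_k_antimono[of n s x] by auto
  show "((\<lambda>t. bessel_g n t * exp (bessel_k n t)) has_real_derivative
      bessel_k' n x * ((bessel n x * bessel_D n x + bessel_g n x) * exp (bessel_k n x))) (at x)"
    by (rule derivative_eq_intros refl bessel_g_DERIV bessel_k_DERIV nx)+ (simp add: algebra_simps)
  show "bessel_k' n x * ((bessel n x * bessel_D n x + bessel_g n x) * exp (bessel_k n x)) \<le> 0"
    using bessel_k'_nonpos[OF nx] bessel_g_bounds(3)[OF nx k]
    by (intro mult_nonpos_nonneg mult_nonneg_nonneg) (auto simp: abs_le_iff)
qed

lemma bessel_g_exp_nondecreasing:
  assumes "\<bar>of_int n\<bar> < s" "s \<le> t" "bessel_k n s \<le> 1"
  shows "bessel_g n s * exp (- bessel_k n s) \<le> bessel_g n t * exp (- bessel_k n t)"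
proof (rule DERIV_nonneg_imp_nondecreasing[OF assms(2)], intro exI conjI)
  fix x assume x: "s \<le> x" "x \<le> t"
  then have nx: "\<bar>of_int n\<bar> < x" and k: "bessel_k n x \<le> 1"
    using assms bessel_k_antimono[of n s x] by auto
  show "((\<lambda>t. bessel_g n t * exp (- bessel_k n t)) has_real_derivative
      bessel_k' n x * ((bessel n x * bessel_D n x - bessel_g n x) * exp (- bessel_k n x))) (at x)"
    by (rule derivative_eq_intros refl bessel_g_DERIV bessel_k_DERIV nx)+ (simp add: algebra_simps)
  show "0 \<le> bessel_k' n x * ((bessel n x * bessel_D n x - bessel_g n x) * exp (- bessel_k n x))"
    using bessel_k'_nonpos[OF nx] bessel_g_bounds(3)[OF nx k]
    by (intro mult_nonpos_nonpos mult_nonpos_nonneg) (auto simp: abs_le_iff)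
qed

text \<open>For order \<open>0\<close> the turning point is \<open>t = 0\<close> and
  \<open>bessel_k\<close> equals \<open>1 / t\<close>, so the Gronwall argument starts at the fixed
  time \<open>1\<close>. The other orders are later compared with this one at infinity.\<close>

lemma bessel_energy_0_bounded:
  obtains L where "L > 0" "\<And>t. 1 \<le> t \<Longrightarrow> t * ((bessel (-1) t)\<^sup>2 + (bessel 0 t)\<^sup>2) \<le> L"
proof -
  \<comment> \<open>\<open>exp 1\<close> is \<open>exp (bessel_k 0 1)\<close>, the factor
    \<open>2\<close> passes from \<open>bessel_g\<close> to \<open>bessel_h\<close>, and the summand
    \<open>1\<close> makes the bound strict and \<open>L\<close> positive.\<close>
  define L where "L = 2 * (bessel_g 0 1 * exp 1) + 1"
  have k: "bessel_k 0 t = 1 / t" if "t > 0" for t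
    using that by (simp add: bessel_k_def power2_eq_square power3_eq_cube)
  have *: "t * ((bessel (-1) t)\<^sup>2 + (bessel 0 t)\<^sup>2) < L" if "1 \<le> t" for t
  proof -
    have h: "bessel_h 0 t = t * ((bessel (-1) t)\<^sup>2 + (bessel 0 t)\<^sup>2)"
      using that by (simp add: bessel_h_def bessel_H_def bessel_D_def power_mult_distrib)
        (simp add: power2_eq_square field_simps)
    have "bessel_g 0 t * 1 \<le> bessel_g 0 t * exp (bessel_k 0 t)"
      using bessel_g_bounds(3)[of 0 t] that k[of t] by (intro mult_left_mono) auto
    also have "\<dots> \<le> bessel_g 0 1 * exp (bessel_k 0 1)"
      using that k[of 1] by (intro bessel_g_exp_nonincreasing) auto
    finally show ?thesis using bessel_g_bounds(1)[of 0 t] that k[of t] k[of 1] h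
      by (simp add: L_def)
  qed
  moreover have "L > 0" using bessel_g_bounds(3)[of 0 1] k[of 1] by (simp add: L_def add_nonneg_pos)
  ultimately show ?thesis using that[of L] by (meson less_imp_le)
qed

text \<open>Orders \<open>-1\<close> and \<open>0\<close> decay by the energy bound, which gives
  \<open>J^2 = O(1 / t)\<close>. The recurrence, solved for an outer index as in
  \<open>J_(m+1) = (2 m / t) J_m - J_(m-1)\<close>, carries the limit upwards and downwards one
  order at a time.\<close>

lemma bessel_tendsto_0: "(bessel n \<longlongrightarrow> 0) at_top"
proof -
  obtain L where L: "L > 0" "\<And>t. 1 \<le> t \<Longrightarrow> t * ((bessel (-1) t)\<^sup>2 + (bessel 0 t)\<^sup>2) \<le> L"
    by (rule bessel_energy_0_bounded) blast
  have "((\<lambda>t. (bessel m t)\<^sup>2) \<longlongrightarrow> 0) at_top" if "m = -1 \<or> m = 0" for m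
  proof (rule Lim_null_comparison)
    show "\<forall>\<^sub>F t in at_top. norm ((bessel m t)\<^sup>2) \<le> L / t"
      using eventually_ge_at_top[of 1]
    proof eventually_elim
      case (elim t)
      have "t * (bessel m t)\<^sup>2 \<le> t * ((bessel (-1) t)\<^sup>2 + (bessel 0 t)\<^sup>2)"
        using elim that by (intro mult_left_mono) auto
      also have "\<dots> \<le> L" by (rule L(2)[OF elim])
      finally show ?case using elim by (simp add: field_simps)
    qed
    show "((\<lambda>t. L / t) \<longlongrightarrow> 0) at_top" by real_asymp
  qed
  then have base: "(bessel m \<longlongrightarrow> 0) at_top" if "m = -1 \<or> m = 0" for m
    using tendsto_real_sqrt[of "\<lambda>t. (bessel m t)\<^sup>2" 0 at_top] that
    by (auto intro: tendsto_rabs_zero_cancel)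
  have rec: "((\<lambda>t. 2 * of_int m * inverse t * bessel m t - bessel m' t) \<longlongrightarrow> 0) at_top"
    if "(bessel m \<longlongrightarrow> 0) at_top" "(bessel m' \<longlongrightarrow> 0) at_top" for m m'
  proof -
    have "((\<lambda>t. 2 * of_int m * inverse t * bessel m t - bessel m' t) \<longlongrightarrow> 2 * of_int m * 0 * 0 - 0) at_top"
      by (intro tendsto_intros that tendsto_inverse_0_at_top filterlim_ident)
    then show ?thesis by simp
  qed
  have ev: "\<forall>\<^sub>F t in at_top. bessel m t = 2 * of_int l * inverse t * bessel l t - bessel m' t"
    if "m = l + 1 \<and> m' = l - 1 \<or> m = l - 1 \<and> m' = l + 1" for m m' l
    using eventually_gt_at_top[of "0::real"]
  proof eventually_elim
    case (elim t)
    then show ?case using bessel_recurrence[of t l] that by (auto simp: field_simps)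
  qed
  have "(bessel (int k) \<longlongrightarrow> 0) at_top \<and> (bessel (int k - 1) \<longlongrightarrow> 0) at_top" for k
  proof (induction k)
    case (Suc k)
    have "(bessel (int k + 1) \<longlongrightarrow> 0) at_top"
      by (subst tendsto_cong[OF ev[of "int k + 1" "int k" "int k - 1"]]; (rule rec)?; use Suc in simp)
    then show ?case using Suc by (simp add: add.commute)
  qed (use base in auto)
  moreover have "(bessel (- int k) \<longlongrightarrow> 0) at_top \<and> (bessel (- int k - 1) \<longlongrightarrow> 0) at_top" for k
  proof (induction k)
    case (Suc k)
    have "(bessel (- int k - 2) \<longlongrightarrow> 0) at_top"
      by (subst tendsto_cong[OF ev[of "- int k - 2" "- int k - 1" "- int k"]]; (rule rec)?; use Suc in simp)
    moreover have "- int (Suc k) - 1 = - int k - 2" "- int (Suc k) = - int k - 1" by auto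
    ultimately show ?case using Suc by (simp only: simp_thms)
  qed (use base in auto)
  ultimately show ?thesis by (cases n rule: int_cases2) blast+
qed

text \<open>By the recurrence, neighbouring energies differ by
  \<open>2 m J_m (J_(m+1) - J_(m-1))\<close>, which tends to \<open>0\<close> for each fixed
  \<open>m\<close>; finitely many steps connect \<open>n\<close> with \<open>0\<close>. The rate may
  depend on \<open>n\<close>: only the limit enters the uniform bound.\<close>

lemma bessel_energy_diff_tendsto_0:
  "((\<lambda>t. t * ((bessel (n - 1) t)\<^sup>2 + (bessel n t)\<^sup>2) - t * ((bessel (-1) t)\<^sup>2 + (bessel 0 t)\<^sup>2)) \<longlongrightarrow> 0) at_top"
proof -
  let ?E = "\<lambda>n t. t * ((bessel (n - 1) t)\<^sup>2 + (bessel n t)\<^sup>2)"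
  have step_eq: "?E (m + 1) t - ?E m t = 2 * of_int m * bessel m t * (bessel (m + 1) t - bessel (m - 1) t)" for m t
  proof -
    have "?E (m + 1) t - ?E m t = (t * (bessel (m - 1) t + bessel (m + 1) t)) * (bessel (m + 1) t - bessel (m - 1) t)"
      by (simp add: power2_eq_square algebra_simps)
    then show ?thesis by (simp only: bessel_recurrence)
  qed
  have step: "((\<lambda>t. ?E (m + 1) t - ?E m t) \<longlongrightarrow> 0) at_top" for m
  proof -
    have "((\<lambda>t. 2 * of_int m * bessel m t * (bessel (m + 1) t - bessel (m - 1) t)) \<longlongrightarrow> 2 * of_int m * 0 * (0 - 0)) at_top"
      by (intro tendsto_intros bessel_tendsto_0)
    then show ?thesis by (simp only: step_eq) simp
  qed
  have up: "((\<lambda>t. ?E (int k) t - ?E 0 t) \<longlongrightarrow> 0) at_top" for k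
  proof (induction k)
    case (Suc k)
    have "((\<lambda>t. (?E (int k + 1) t - ?E (int k) t) + (?E (int k) t - ?E 0 t)) \<longlongrightarrow> 0 + 0) at_top"
      by (intro tendsto_add step Suc)
    moreover have "int (Suc k) = int k + 1" by simp
    ultimately show ?case by (simp only:) simp
  qed simp
  have down: "((\<lambda>t. ?E (- int k) t - ?E 0 t) \<longlongrightarrow> 0) at_top" for k
  proof (induction k)
    case (Suc k)
    have "((\<lambda>t. (?E (- int k) t - ?E 0 t) - (?E (- int (Suc k) + 1) t - ?E (- int (Suc k)) t)) \<longlongrightarrow> 0 - 0) at_top"
      by (intro tendsto_diff step Suc)
    moreover have "- int (Suc k) + 1 = - int k" by simp
    ultimately show ?case by (simp only:) simp
  qed simp
  show ?thesis using up[of "nat n"] down[of "nat (- n)"] by (cases "n \<ge> 0") simp_all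
qed

text \<open>The constant is uniform in \<open>n\<close>: as \<open>t\<close> tends to infinity, \<open>t * (J_(n-1)^2 + J_n^2)\<close> differs from its
  value at \<open>n = 0\<close> by \<open>o(1)\<close>, and monotonicity carries the bound back from infinity.\<close>

lemma bessel_H_bound:
  obtains C where "C \<ge> 1" "\<And>n t. \<bar>of_int n\<bar> < t \<Longrightarrow> bessel_k n t \<le> 1 \<Longrightarrow>
     bessel_H n t \<le> C * sqrt (t\<^sup>2 - (of_int n)\<^sup>2)"
proof -
  obtain L where L: "L > 0" "\<And>t. 1 \<le> t \<Longrightarrow> t * ((bessel (-1) t)\<^sup>2 + (bessel 0 t)\<^sup>2) \<le> L"
    by (rule bessel_energy_0_bounded) blast
  \<comment> \<open>Near infinity \<open>bessel_h \<le> 2 (L + 1)\<close>, where \<open>2\<close>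
    bounds \<open>s / sqrt (s^2 - n^2)\<close> and \<open>1\<close> bounds the \<open>o(1)\<close>
    terms. The factor \<open>3\<close> is \<open>2 * 3/2\<close>, from comparing
    \<open>bessel_g\<close> and \<open>bessel_h\<close> at both ends, and \<open>exp 1\<close> is
    the Gronwall loss.\<close>
  define C where "C = 3 * exp 1 * (2 * (L + 1))"
  have "bessel_H n t \<le> C * sqrt (t\<^sup>2 - (of_int n)\<^sup>2)" if t: "\<bar>of_int n\<bar> < t" "bessel_k n t \<le> 1" for n t
  proof -
    have lim1: "((\<lambda>s. (s * ((bessel (n - 1) s)\<^sup>2 + (bessel n s)\<^sup>2) - s * ((bessel (-1) s)\<^sup>2 + (bessel 0 s)\<^sup>2))
        - 2 * of_int n * bessel (n - 1) s * bessel n s) \<longlongrightarrow> 0 - 2 * of_int n * 0 * 0) at_top"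
      by (intro tendsto_intros bessel_tendsto_0 bessel_energy_diff_tendsto_0)
    have ev1: "\<forall>\<^sub>F s in at_top. (s * ((bessel (n - 1) s)\<^sup>2 + (bessel n s)\<^sup>2) - s * ((bessel (-1) s)\<^sup>2 + (bessel 0 s)\<^sup>2))
        - 2 * of_int n * bessel (n - 1) s * bessel n s < 1"
      using order_tendstoD(2)[OF lim1, of 1] by simp
    have "((\<lambda>s. s / sqrt (s\<^sup>2 - (of_int n)\<^sup>2)) \<longlongrightarrow> 1) at_top" by real_asymp
    then have ev2: "\<forall>\<^sub>F s in at_top. s / sqrt (s\<^sup>2 - (of_int n)\<^sup>2) < 2"
      by (rule order_tendstoD) simp
    have "\<forall>\<^sub>F s in at_top. bessel_h n s \<le> 2 * (L + 1)"
      using ev1 ev2 eventually_ge_at_top[of 1] eventually_gt_at_top[of "\<bar>of_int n\<bar>"]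
    proof eventually_elim
      case (elim s)
      define r where "r = sqrt (s\<^sup>2 - (of_int n)\<^sup>2)"
      have r: "r > 0" unfolding r_def by (rule bessel_r_pos) (use elim in auto)
      have "bessel_H n s / s = s * ((bessel (n - 1) s)\<^sup>2 + (bessel n s)\<^sup>2) - 2 * of_int n * bessel (n - 1) s * bessel n s"
        using elim by (simp add: bessel_H_def bessel_D_def field_simps power2_eq_square)
      also have "\<dots> \<le> L + 1" using elim L(2)[of s] by linarith
      finally have H: "bessel_H n s / s \<le> L + 1" .
      have "bessel_h n s = (s / r) * (bessel_H n s / s)"
        using elim r by (simp add: bessel_h_def r_def)
      also have "\<dots> \<le> 2 * (L + 1)"
        using H elim r bessel_H_nonneg[of s n] L(1) by (intro mult_mono) (auto simp: r_def)
      finally show ?case .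
    qed
    then have "\<forall>\<^sub>F s in at_top. bessel_h n s \<le> 2 * (L + 1) \<and> t \<le> s"
      using eventually_ge_at_top[of t] by eventually_elim simp
    then obtain s where s: "bessel_h n s \<le> 2 * (L + 1)" "t \<le> s"
      using eventually_happens'[of "at_top :: real filter"] by auto
    have ns: "\<bar>of_int n\<bar> < s" and ks: "bessel_k n s \<le> 1" using s t bessel_k_antimono[of n t s] by auto
    have "bessel_g n t * exp (- 1) \<le> bessel_g n t * exp (- bessel_k n t)"
      using t bessel_g_bounds(3)[OF t] by (intro mult_left_mono) auto
    also have "\<dots> \<le> bessel_g n s * exp (- bessel_k n s)"
      by (rule bessel_g_exp_nondecreasing) (use t s in auto)
    also have "\<dots> \<le> bessel_g n s * 1"
      using bessel_g_bounds(3)[OF ns ks] bessel_k_nonneg[OF ns] by (intro mult_left_mono) auto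
    also have "\<dots> \<le> 3/2 * (2 * (L + 1))" using bessel_g_bounds(2)[OF ns ks] s by simp
    finally have "bessel_g n t \<le> 3/2 * (2 * (L + 1)) * exp 1"
      by (simp add: exp_minus field_simps)
    then have "bessel_h n t \<le> C" using bessel_g_bounds(1)[OF t] by (simp add: C_def algebra_simps)
    then show ?thesis using bessel_r_pos[OF t(1)] by (simp add: bessel_h_def field_simps)
  qed
  moreover have "C \<ge> 1"
  proof -
    have "1 * 1 \<le> exp (1::real) * (2 * (L + 1))" using L(1) by (intro mult_mono) auto
    then show ?thesis by (simp add: C_def)
  qed
  ultimately show ?thesis using that by blast
qed

text \<open>The oscillatory bound starts where \<open>t^2 - n^2\<close> reaches \<open>t^(4/3)\<close>; writing this point as \<open>b ^ 3\<close>
  avoids fractional powers.\<close>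

lemma bessel_turning_point:
  obtains C where "C \<ge> 1"
    "\<And>n. \<exists>b\<ge>1. \<bar>of_int n\<bar> < b ^ 3 \<and> (b ^ 3)\<^sup>2 - (of_int n)\<^sup>2 = b ^ 4 \<and> bessel_k n (b ^ 3) \<le> 1 \<and>
       bessel_H n (b ^ 3) \<le> C * b\<^sup>2 \<and> (\<forall>t\<in>{1..b ^ 3}. (bessel n t)\<^sup>2 \<le> C / b\<^sup>2)"
    "\<And>n t. \<bar>of_int n\<bar> < t \<Longrightarrow> bessel_k n t \<le> 1 \<Longrightarrow> (bessel n t) ^ 4 \<le> C\<^sup>2 / (t\<^sup>2 - (of_int n)\<^sup>2)"
proof -
  obtain C where C: "C \<ge> 1" "\<And>n t. \<bar>of_int n\<bar> < t \<Longrightarrow> bessel_k n t \<le> 1 \<Longrightarrow>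
     bessel_H n t \<le> C * sqrt (t\<^sup>2 - (of_int n)\<^sup>2)" by (rule bessel_H_bound) blast
  have Jr: "(bessel n t)\<^sup>2 \<le> C / r" if t: "\<bar>of_int n\<bar> < t" "bessel_k n t \<le> 1"
    and r: "r = sqrt (t\<^sup>2 - (of_int n)\<^sup>2)" for n t r
  proof -
    have r0: "r > 0" using bessel_r_pos[OF t(1)] r by simp
    have "r\<^sup>2 * (bessel n t)\<^sup>2 \<le> bessel_H n t"
      using bessel_H_eq_r[OF t(1)] r by simp
    also have "\<dots> \<le> C * r" using C(2)[OF t] r by simp
    finally show ?thesis using r0 by (simp add: field_simps power2_eq_square)
  qed
  have J4: "(bessel n t) ^ 4 \<le> (9 * C)\<^sup>2 / (t\<^sup>2 - (of_int n)\<^sup>2)" if t: "\<bar>of_int n\<bar> < t" "bessel_k n t \<le> 1" for n t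
  proof -
    define r where "r = sqrt (t\<^sup>2 - (of_int n)\<^sup>2)"
    have r0: "r > 0" using bessel_r_pos[OF t(1)] r_def by simp
    have "((bessel n t)\<^sup>2)\<^sup>2 \<le> (C / r)\<^sup>2" by (intro power_mono Jr[OF t r_def]) auto
    also have "\<dots> \<le> (9 * C)\<^sup>2 / r\<^sup>2" using C(1) r0 by (simp add: power_divide divide_right_mono)
    finally show ?thesis unfolding bessel_r_square[OF t(1), folded r_def] by simp
  qed
  have ex: "\<exists>b\<ge>1. \<bar>of_int n\<bar> < b ^ 3 \<and> (b ^ 3)\<^sup>2 - (of_int n)\<^sup>2 = b ^ 4 \<and> bessel_k n (b ^ 3) \<le> 1 \<and>
       bessel_H n (b ^ 3) \<le> 9 * C * b\<^sup>2 \<and> (\<forall>t\<in>{1..b ^ 3}. (bessel n t)\<^sup>2 \<le> 9 * C / b\<^sup>2)" for n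
  proof -
    define a where "a = \<bar>real_of_int n\<bar>"
    have a: "a = 0 \<or> a \<ge> 1" unfolding a_def by (cases "n = 0") (auto simp flip: of_int_abs)
    \<comment> \<open>\<open>b\<close> is the root of \<open>b^6 - b^4 = n^2\<close>, so
      \<open>t = b^3\<close> gives \<open>t^2 - n^2 = b^4 = t^(4/3)\<close>. For
      \<open>n \<noteq> 0\<close> also \<open>b^3 \<le> 2 |n|\<close> is recorded: throughout
      \<open>[|n|, b^3]\<close> the time is then comparable with \<open>b^3\<close>.\<close>
    obtain b where b: "1 \<le> b" "b ^ 6 - a\<^sup>2 = b ^ 4" "b ^ 3 \<le> 2 * a \<or> a = 0" "a < b ^ 3"
    proof (cases "a = 0")
      case True
      then show ?thesis using that[of 1] by simp
    next
      case False
      then have a1: "a \<ge> 1" using a by simp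
      have "\<exists>x\<ge>1. x \<le> 1 + a \<and> x ^ 6 - x ^ 4 = a\<^sup>2"
      proof (rule IVT')
        have "a ^ 2 * 1 \<le> (1 + a) ^ 4 * ((1 + a)\<^sup>2 - 1)"
        proof (intro mult_mono)
          show "a\<^sup>2 \<le> (1 + a) ^ 4" using a1 power_mono[of a "1+a" 2] power_increasing[of 2 4 "1+a"] by linarith
          show "1 \<le> (1 + a)\<^sup>2 - 1" 
          proof -
            have "(1 + a)\<^sup>2 - 1 = a * a + 2 * a" by (simp add: power2_eq_square algebra_simps)
            moreover have "0 \<le> a * a" by simp
            ultimately show ?thesis using a1 by linarith
          qed
        qed (use a1 in auto)
        then show "a\<^sup>2 \<le> (1 + a) ^ 6 - (1 + a) ^ 4" by (simp add: algebra_simps flip: power_add)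
      qed (use a1 in \<open>auto intro!: continuous_intros\<close>)
      then obtain b where b: "b \<ge> 1" "b ^ 6 - b ^ 4 = a\<^sup>2" by blast
      have "b \<noteq> 1" using b a1 by auto
      have "0 < b ^ 4" using b by simp
      then have "a\<^sup>2 < b ^ 6" using b(2) by linarith
      then have "a\<^sup>2 < (b ^ 3)\<^sup>2" by (simp flip: power_mult)
      then have ab: "a < b ^ 3" using b by (auto intro: power2_less_imp_less)
      \<comment> \<open>Otherwise \<open>4 a^2 < b^6\<close> and \<open>a^2 = b^6 - b^4\<close> give
        \<open>b^2 < 4/3\<close>, while \<open>a \<ge> 1\<close> gives \<open>b^6 \<ge> 4\<close>;
        but \<open>(4/3)^3 < 4\<close>.\<close>
      have b2: "b ^ 3 \<le> 2 * a"
      proof (rule ccontr)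
        assume "\<not> b ^ 3 \<le> 2 * a"
        then have lt: "2 * a < b ^ 3" by simp
        have lt2: "4 * a\<^sup>2 < (b ^ 3)\<^sup>2" using power_strict_mono[OF lt, of 2] a1 by (simp add: power_mult_distrib)
        then have "3 * b ^ 6 < 4 * b ^ 4" using b by (simp flip: power_mult)
        then have "b\<^sup>2 * b ^ 4 < (4/3) * b ^ 4" by (simp flip: power_add)
        then have "b\<^sup>2 < 4/3" by (rule mult_right_less_imp_less) (use b in simp)
        moreover have "4 \<le> b ^ 6 "
        proof -
          have "4 \<le> 4 * a\<^sup>2" using one_le_power[OF a1, of 2] by simp
          also have "\<dots> \<le> b ^ 6" using lt2 by (simp flip: power_mult)
          finally show ?thesis .
        qed
        moreover have "b ^ 6 = (b\<^sup>2) ^ 3" by (simp flip: power_mult)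
        moreover have "(b\<^sup>2) ^ 3 \<le> (4/3) ^ 3" using calculation(1) by (intro power_mono) auto
        ultimately have "(4::real) \<le> (4/3) ^ 3" by linarith
        then show False by (simp add: power3_eq_cube)
      qed
      show ?thesis
      proof (rule that)
        show "b ^ 6 - a\<^sup>2 = b ^ 4" using b(2) by linarith
      qed (use b(1) ab b2 in auto)
    qed
    let ?t = "b ^ 3"
    have nt: "\<bar>of_int n\<bar> < ?t" using b(4) by (simp add: a_def)
    have a0: "0 \<le> a" by (simp add: a_def)
    have n2: "(of_int n)\<^sup>2 = a\<^sup>2" by (simp add: a_def)
    have sq: "?t\<^sup>2 - (of_int n)\<^sup>2 = b ^ 4" unfolding n2 using b(2) by (simp flip: power_mult)
    have r: "sqrt (?t\<^sup>2 - (of_int n)\<^sup>2) = b\<^sup>2"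
      unfolding sq by (rule real_sqrt_unique) (simp_all flip: power_mult)
    have k: "bessel_k n ?t \<le> 1" unfolding bessel_k_le_1_iff[OF nt] r by (simp flip: power_mult)
    have H: "bessel_H n ?t \<le> C * b\<^sup>2" using C(2)[OF nt k] unfolding r .
    have Jt: "\<bar>bessel n ?t\<bar> \<le> sqrt C / b"
    proof (rule power2_le_imp_le)
      show "\<bar>bessel n ?t\<bar>\<^sup>2 \<le> (sqrt C / b)\<^sup>2"
        using Jr[OF nt k r[symmetric]] C(1) by (simp add: power_divide)
    qed (use b C(1) in auto)
    \<comment> \<open>The Airy zone between \<open>|n|\<close> and \<open>b^3\<close>: since
      \<open>t^2 - n^2 \<ge> 0\<close> there,
      \<open>D^2 \<le> H(t) \<le> H(b^3) \<le> C b^2\<close>, so \<open>|J'| = |D| / t\<close> is at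
      most \<open>2 sqrt C / b^2\<close>. The zone has length at most \<open>b\<close>, so
      \<open>J\<close> moves by at most \<open>2 sqrt C / b\<close> from its value at
      \<open>b^3\<close>.\<close>
    have mid: "\<bar>bessel n t\<bar> \<le> 3 * sqrt C / b" if t: "a \<le> t" "0 < t" "t \<le> ?t" "a \<noteq> 0" for t
    proof -
      have b3: "b ^ 3 \<le> 2 * a" using b(3) t by simp
      have D: "\<bar>bessel_D n s / s\<bar> \<le> 2 * sqrt C / b\<^sup>2" if s: "t \<le> s" "s \<le> ?t" for s
      proof -
        have "(bessel_D n s)\<^sup>2 \<le> bessel_H n s"
          unfolding bessel_H_def n2 using power_mono[of a s 2] s t(1) a0 by simp
        also have "\<dots> \<le> C * b\<^sup>2" using bessel_H_mono[of s ?t n] s t H by linarith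
        finally have "\<bar>bessel_D n s\<bar> \<le> sqrt C * b"
          using b(1) real_le_rsqrt[of "\<bar>bessel_D n s\<bar>" "C * b\<^sup>2"] by (simp add: real_sqrt_mult)
        then have "\<bar>bessel_D n s\<bar> / s \<le> (sqrt C * b) / (b ^ 3 / 2)"
          using b3 b(1) s t C(1) by (intro frac_le) auto
        also have "\<dots> = 2 * sqrt C / b\<^sup>2" using b(1) by (simp add: field_simps eval_nat_numeral)
        finally show ?thesis using s t by simp
      qed
      have "\<bar>bessel n ?t - bessel n t\<bar> \<le> 2 * sqrt C / b\<^sup>2 * \<bar>?t - t\<bar>"
      proof (rule field_differentiable_bound[of "{t..?t}", unfolded real_norm_def])
        fix z assume "z \<in> {t..?t}"
        then show "(bessel n has_real_derivative bessel_D n z / z) (at z within {t..?t})"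
          "\<bar>bessel_D n z / z\<bar> \<le> 2 * sqrt C / b\<^sup>2"
          using bessel_DERIV_D[of z n] D[of z] t by (auto intro: has_field_derivative_at_within)
      qed (use t in auto)
      also have "\<dots> \<le> 2 * sqrt C / b\<^sup>2 * b"
      proof (intro mult_left_mono)
        have "(?t - a) * b ^ 3 \<le> (?t - a) * (?t + a)" using b(4) a0 by (intro mult_left_mono) auto
        also have "\<dots> = b ^ 6 - a\<^sup>2" by (simp add: algebra_simps power2_eq_square flip: power_add)
        also have "\<dots> = b * b ^ 3" unfolding b(2) by (simp flip: power_Suc)
        finally have "?t - a \<le> b" using b(1) by simp
        then show "\<bar>?t - t\<bar> \<le> b" using t by linarith
      qed (use C(1) in auto)
      also have "\<dots> = 2 * sqrt C / b" using b(1) by (simp add: power2_eq_square)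
      finally have "\<bar>bessel n t\<bar> \<le> sqrt C / b + 2 * sqrt C / b" using Jt by linarith
      then show ?thesis by (simp flip: add_divide_distrib)
    qed
    \<comment> \<open>Before the turning point \<open>J^2\<close> is nondecreasing: its derivative
      is \<open>2 J D / t\<close>, and \<open>J * D\<close> starts from \<open>0\<close> with
      nonnegative derivative as long as \<open>t \<le> |n|\<close>.\<close>
    have low: "(bessel n t)\<^sup>2 \<le> (bessel n a)\<^sup>2" if t: "0 < t" "t \<le> a" for t
    proof (rule DERIV_nonneg_imp_nondecreasing[OF t(2)], intro exI conjI)
      fix x assume x: "t \<le> x" "x \<le> a"
      show "((\<lambda>t. (bessel n t)\<^sup>2) has_real_derivative 2 * (bessel n x * bessel_D n x) / x) (at x)"
        using DERIV_power[OF bessel_DERIV_D[of x n], of 2] x t by (simp add: mult_ac)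
      have "bessel n 0 * bessel_D n 0 \<le> bessel n x * bessel_D n x"
      proof (rule DERIV_nonneg_imp_increasing_open[of 0 x "\<lambda>t. bessel n t * bessel_D n t"])
        fix y assume y: "0 < y" "y < x"
        have "y\<^sup>2 \<le> (of_int n)\<^sup>2" unfolding n2 using y x by (intro power_mono) auto
        then show "\<exists>z. ((\<lambda>t. bessel n t * bessel_D n t) has_real_derivative z) (at y) \<and> 0 \<le> z"
          using y bessel_P_DERIV[of y n]
          by (intro exI[of _ "((bessel_D n y)\<^sup>2 + ((of_int n)\<^sup>2 - y\<^sup>2) * (bessel n y)\<^sup>2) / y"]) auto
      qed (use x t in \<open>auto intro!: continuous_intros\<close>)
      then show "0 \<le> 2 * (bessel n x * bessel_D n x) / x" using x t by (simp add: bessel_D_0)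
    qed
    have sq9: "(3 * sqrt C / b)\<^sup>2 = 9 * C / b\<^sup>2" using C(1) by (simp add: power_divide power_mult_distrib)
    have "(bessel n t)\<^sup>2 \<le> 9 * C / b\<^sup>2" if t: "t \<in> {1..?t}" for t
    proof (cases "a = 0")
      case True
      then have "b ^ 4 * b\<^sup>2 = b ^ 4 * 1" using b(2) by (simp flip: power_add)
      moreover have "b ^ 4 \<noteq> 0" using b(1) by simp
      ultimately have "b\<^sup>2 = 1" by (rule mult_left_cancel[THEN iffD1, rotated])
      moreover have "(bessel n t)\<^sup>2 \<le> 1" using abs_bessel_le_1[of n t] by (simp add: abs_square_le_1)
      ultimately show ?thesis using C(1) by simp
    next
      case False
      have sqJ: "(bessel n s)\<^sup>2 \<le> 9 * C / b\<^sup>2" if "a \<le> s" "0 < s" "s \<le> ?t" for s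
        using power_mono[OF mid[OF that False], of 2] by (simp add: sq9)
      show ?thesis
      proof (cases "a \<le> t")
        case True
        then show ?thesis using sqJ[of t] t by simp
      next
        case nle: False
        have "(bessel n t)\<^sup>2 \<le> (bessel n a)\<^sup>2" by (rule low) (use t nle in auto)
        also have "\<dots> \<le> 9 * C / b\<^sup>2" by (rule sqJ) (use b(4) a0 False in auto)
        finally show ?thesis .
      qed
    qed
    moreover have "C * b\<^sup>2 \<le> 9 * C * b\<^sup>2" using C(1) by simp
    ultimately show ?thesis using b(1) nt sq k order_trans[OF H] by blast
  qed
  show ?thesis by (rule that[of "9 * C"]) (use C(1) ex J4 in auto)
qed

text \<open>The window is cut at \<open>b^3\<close>. Before it,
  \<open>J^4 \<le> (C / b^2) J^2\<close>, and \<open>2 t J^2\<close> integrates exactly to an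
  increment of \<open>bessel_H\<close>, at most \<open>C b^2\<close>: the powers of \<open>b\<close>
  cancel and \<open>C^2 / (2 T)\<close> remains, whatever \<open>n\<close> is. After it,
  \<open>J^4 \<le> C^2 / (T (t - |n|))\<close> integrates to a logarithm.\<close>

lemma bessel_fourth_power_integral_bound:
  obtains C where "C \<ge> 1"
    "\<And>n T. 1 \<le> T \<Longrightarrow> integral {T..2 * T} (\<lambda>t. (bessel n t) ^ 4) \<le> C * (1 + ln T) / T"
proof -
  obtain C where C: "C \<ge> 1"
    "\<And>n. \<exists>b\<ge>1. \<bar>of_int n\<bar> < b ^ 3 \<and> (b ^ 3)\<^sup>2 - (of_int n)\<^sup>2 = b ^ 4 \<and> bessel_k n (b ^ 3) \<le> 1 \<and>
       bessel_H n (b ^ 3) \<le> C * b\<^sup>2 \<and> (\<forall>t\<in>{1..b ^ 3}. (bessel n t)\<^sup>2 \<le> C / b\<^sup>2)"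
    "\<And>n t. \<bar>of_int n\<bar> < t \<Longrightarrow> bessel_k n t \<le> 1 \<Longrightarrow> (bessel n t) ^ 4 \<le> C\<^sup>2 / (t\<^sup>2 - (of_int n)\<^sup>2)"
    by (rule bessel_turning_point) blast
  have "integral {T..2 * T} (\<lambda>t. (bessel n t) ^ 4) \<le> 3 * C\<^sup>2 * (1 + ln T) / T" if T: "1 \<le> T" for n T
  proof -
    obtain b where b: "b \<ge> 1" "\<bar>of_int n\<bar> < b ^ 3" "(b ^ 3)\<^sup>2 - (of_int n)\<^sup>2 = b ^ 4" "bessel_k n (b ^ 3) \<le> 1"
       "bessel_H n (b ^ 3) \<le> C * b\<^sup>2" and bJ: "\<And>t. t \<in> {1..b ^ 3} \<Longrightarrow> (bessel n t)\<^sup>2 \<le> C / b\<^sup>2"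
      using C(2)[of n] by blast
    define a where "a = \<bar>real_of_int n\<bar>"
    have a: "0 \<le> a" "a < b ^ 3" "(of_int n)\<^sup>2 = a\<^sup>2" using b(2) by (auto simp: a_def)
    define m where "m = max T (min (2 * T) (b ^ 3))"
    have m: "T \<le> m" "m \<le> 2 * T" using T by (auto simp: m_def)
    have int: "(\<lambda>t. (bessel n t) ^ 4) integrable_on {u..v}" for u v
      by (intro integrable_continuous_interval continuous_intros)
    have "integral {T..m} (\<lambda>t. (bessel n t) ^ 4) \<le> C\<^sup>2 / (2 * T)"
    proof (cases "m = T")
      case False
      then have mt: "m \<le> b ^ 3" by (auto simp: m_def)
      have "((\<lambda>t. 2 * t * (bessel n t)\<^sup>2) has_integral bessel_H n m - bessel_H n T) {T..m}"
        using T m by (intro fundamental_theorem_of_calculus)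
          (auto intro!: has_field_derivative_at_within bessel_H_DERIV
            simp flip: has_real_derivative_iff_has_vector_derivative)
      then have HI: "((\<lambda>t. C / (2 * T * b\<^sup>2) * (2 * t * (bessel n t)\<^sup>2)) has_integral
          C / (2 * T * b\<^sup>2) * (bessel_H n m - bessel_H n T)) {T..m}"
        by (rule has_integral_mult_right)
      have "integral {T..m} (\<lambda>t. (bessel n t) ^ 4) \<le> C / (2 * T * b\<^sup>2) * (bessel_H n m - bessel_H n T)"
      proof (rule has_integral_le[OF integrable_integral[OF int] HI])
        fix t assume t: "t \<in> {T..m}"
        have "(bessel n t) ^ 4 = (bessel n t)\<^sup>2 * (bessel n t)\<^sup>2" by (simp flip: power_add)
        also have "\<dots> \<le> C / b\<^sup>2 * (t / T * (bessel n t)\<^sup>2)"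
        proof (rule mult_mono)
          show "(bessel n t)\<^sup>2 \<le> C / b\<^sup>2" using t T mt by (intro bJ) auto
          have "1 * (bessel n t)\<^sup>2 \<le> t / T * (bessel n t)\<^sup>2" using t T by (intro mult_right_mono) auto
          then show "(bessel n t)\<^sup>2 \<le> t / T * (bessel n t)\<^sup>2" by simp
        qed (use C(1) in auto)
        also have "\<dots> = C / (2 * T * b\<^sup>2) * (2 * t * (bessel n t)\<^sup>2)" using T b by (simp add: field_simps)
        finally show "(bessel n t) ^ 4 \<le> C / (2 * T * b\<^sup>2) * (2 * t * (bessel n t)\<^sup>2)" .
      qed
      also have "\<dots> \<le> C / (2 * T * b\<^sup>2) * (C * b\<^sup>2)"
        using bessel_H_mono[of m "b ^ 3" n] mt m T b(5) bessel_H_nonneg[of T n] C(1)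
        by (intro mult_left_mono) auto
      also have "\<dots> = C\<^sup>2 / (2 * T)" using b T by (simp add: field_simps power2_eq_square)
      finally show ?thesis .
    qed (use T in auto)
    moreover have "integral {m..2 * T} (\<lambda>t. (bessel n t) ^ 4) \<le> C\<^sup>2 / T * (2 + ln T)"
    proof (cases "m = 2 * T")
      case False
      then have mt: "b ^ 3 \<le> m" using T by (auto simp: m_def max_def min_def split: if_splits)
      \<comment> \<open>From \<open>b^4 = (b^3 - a) (b^3 + a)\<close> and \<open>a < b^3\<close>,
        the distance to \<open>a\<close> after the cut is at least \<open>b / 2 \<ge> 1 / 2\<close>,
        which bounds the logarithm at its lower end.\<close>
      have "b * b ^ 3 = (b ^ 3 - a) * (b ^ 3 + a)" using b(3) a(3) by (simp add: algebra_simps power2_eq_square eval_nat_numeral)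
      also have "\<dots> \<le> (b ^ 3 - a) * (2 * b ^ 3)" using a by (intro mult_left_mono) auto
      finally have "b \<le> 2 * (b ^ 3 - a)" using b(1) by simp
      then have "b / 2 \<le> b ^ 3 - a" by simp
      moreover have "b ^ 3 - a \<le> m - a" using mt by simp
      ultimately have "b / 2 \<le> m - a" by (rule order_trans)
      then have ma: "1 / 2 \<le> m - a" using b(1) by simp
      have "((\<lambda>t. 1 / (t - a)) has_integral ln (2 * T - a) - ln (m - a)) {m..2 * T}"
        using ma m by (intro fundamental_theorem_of_calculus)
          (auto intro!: derivative_eq_intros simp flip: has_real_derivative_iff_has_vector_derivative)
      then have HI: "((\<lambda>t. C\<^sup>2 / T * (1 / (t - a))) has_integral C\<^sup>2 / T * (ln (2 * T - a) - ln (m - a))) {m..2 * T}"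
        by (rule has_integral_mult_right)
      have "integral {m..2 * T} (\<lambda>t. (bessel n t) ^ 4) \<le> C\<^sup>2 / T * (ln (2 * T - a) - ln (m - a))"
      proof (rule has_integral_le[OF integrable_integral[OF int] HI])
        fix t assume t: "t \<in> {m..2 * T}"
        have nt: "\<bar>of_int n\<bar> < t" and kt: "bessel_k n t \<le> 1"
          using t mt b(2,4) bessel_k_antimono[of n "b ^ 3" t] by auto
        have "(bessel n t) ^ 4 \<le> C\<^sup>2 / (t\<^sup>2 - (of_int n)\<^sup>2)" by (rule C(3)[OF nt kt])
        also have "t\<^sup>2 - (of_int n)\<^sup>2 = (t + a) * (t - a)" by (simp only: a(3)) (simp add: power2_eq_square algebra_simps)
        also have "C\<^sup>2 / ((t + a) * (t - a)) \<le> C\<^sup>2 / (T * (t - a))"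
          using t m T ma a by (intro divide_left_mono mult_right_mono) auto
        finally show "(bessel n t) ^ 4 \<le> C\<^sup>2 / T * (1 / (t - a))" by simp
      qed
      also have "\<dots> \<le> C\<^sup>2 / T * (2 + ln T)"
      proof (intro mult_left_mono)
        have "ln (2 * T - a) \<le> ln (2 * T)" using a ma m T by (subst ln_le_cancel_iff) auto
        moreover have "ln (2 * T) = ln 2 + ln T" using T by (simp add: ln_mult)
        moreover have "ln (1/2) \<le> ln (m - a)" using ma by (subst ln_le_cancel_iff) auto
        moreover have "ln (1 / 2) = - ln (2::real)" by (simp add: ln_div)
        moreover have "ln (2::real) \<le> 1" using ln_le_minus_one[of 2] by simp
        ultimately show "ln (2 * T - a) - ln (m - a) \<le> 2 + ln T" by linarith
      qed (use T in auto)
      finally show ?thesis .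
    qed (use T in auto)
    moreover have "integral {T..2 * T} (\<lambda>t. (bessel n t) ^ 4) =
       integral {T..m} (\<lambda>t. (bessel n t) ^ 4) + integral {m..2 * T} (\<lambda>t. (bessel n t) ^ 4)"
      using Henstock_Kurzweil_Integration.integral_combine[OF m int] by simp
    moreover have "C\<^sup>2 / (2 * T) + C\<^sup>2 / T * (2 + ln T) \<le> 3 * C\<^sup>2 * (1 + ln T) / T"
    proof -
      have "C\<^sup>2 / (2 * T) + C\<^sup>2 / T * (2 + ln T) = C\<^sup>2 / T * (1 / 2 + (2 + ln T))"
        using T by (simp add: field_simps)
      also have "\<dots> \<le> C\<^sup>2 / T * (3 * (1 + ln T))"
        using T by (intro mult_left_mono) auto
      finally show ?thesis by (simp add: field_simps)
    qed
    ultimately show ?thesis by linarith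
  qed
  moreover have "3 * C\<^sup>2 \<ge> 1" using one_le_power[OF C(1), of 2] by linarith
  ultimately show ?thesis using that by blast
qed

section \<open>Products of Bessel functions over the coordinates\<close>

definition bessel_prod :: "int ^ 'd::finite \<Rightarrow> real \<Rightarrow> real" where
  "bessel_prod x t = (\<Prod>j\<in>UNIV. bessel (x $ j) t)"

lemma continuous_on_bessel_prod [continuous_intros]: "continuous_on A (bessel_prod x)"
  unfolding bessel_prod_def[abs_def] by (intro continuous_intros)

lemma abs_bessel_prod_le_1: "\<bar>bessel_prod x t\<bar> \<le> 1"
  unfolding bessel_prod_def abs_prod by (intro prod_le_1) (auto simp: abs_bessel_le_1)

lemma bessel_prod_tendsto_0: "(bessel_prod x \<longlongrightarrow> 0) at_top"
proof -
  have "((\<lambda>t. \<Prod>j\<in>UNIV. bessel (x $ j) t) \<longlongrightarrow> (\<Prod>j\<in>(UNIV :: 'a set). 0)) at_top"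
    by (intro tendsto_prod bessel_tendsto_0)
  then show ?thesis by (simp add: bessel_prod_def[abs_def] power_0_left)
qed

text \<open>With \<open>M\<close> the largest modulus among the factors, the product is at most
  \<open>M^d\<close>, and \<open>M^4\<close> is at most the sum of the fourth powers. For
  \<open>d = 3\<close>, \<open>M^3 \<le> sqrt T * M^4 + T^(-3/2)\<close>, by comparing
  \<open>M\<close> with \<open>T^(-1/2)\<close>; both terms contribute \<open>T^(-1/2)\<close> to
  the integral, up to the logarithm.\<close>

lemma bessel_prod_integral_bound:
  assumes d: "CARD('d::finite) \<in> {3, 4}"
  obtains C where "C \<ge> 1" "\<And>(x :: int ^ 'd) T. 1 \<le> T \<Longrightarrow>
    integral {T..2 * T} (\<lambda>t. \<bar>bessel_prod x t\<bar>) \<le> C * (1 + ln T) * T powr (1 - CARD('d) / 2)"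
proof -
  obtain C where C: "C \<ge> 1"
    "\<And>n T. 1 \<le> T \<Longrightarrow> integral {T..2 * T} (\<lambda>t. (bessel n t) ^ 4) \<le> C * (1 + ln T) / T"
    by (rule bessel_fourth_power_integral_bound) blast
  have "integral {T..2 * T} (\<lambda>t. \<bar>bessel_prod x t\<bar>) \<le> (4 * C + 1) * (1 + ln T) * T powr (1 - CARD('d) / 2)"
    if T: "1 \<le> T" for x :: "int ^ 'd" and T
  proof -
    define l where "l = (if CARD('d) = 3 then sqrt T else 1)"
    define e where "e = (if CARD('d) = 3 then 1 / sqrt T ^ 3 else 0)"
    have sT: "sqrt T > 0" "sqrt T * sqrt T = T" using T by auto
    have pw: "\<bar>bessel_prod x t\<bar> \<le> l * (\<Sum>j\<in>UNIV. (bessel (x $ j) t) ^ 4) + e" for t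
    proof -
      define M where "M = Max (range (\<lambda>j. \<bar>bessel (x $ j) t\<bar>))"
      have "M \<in> range (\<lambda>j. \<bar>bessel (x $ j) t\<bar>)" unfolding M_def by (intro Max_in) auto
      then obtain i where i: "M = \<bar>bessel (x $ i) t\<bar>" by auto
      have le: "\<bar>bessel (x $ j) t\<bar> \<le> M" for j unfolding M_def by (intro Max_ge) auto
      have "\<bar>bessel_prod x t\<bar> \<le> (\<Prod>j\<in>(UNIV::'d set). M)"
        unfolding bessel_prod_def abs_prod by (intro prod_mono) (auto simp: le)
      then have 1: "\<bar>bessel_prod x t\<bar> \<le> M ^ CARD('d)" by simp
      have M0: "M \<ge> 0" using i by simp
      have "M ^ 4 = (bessel (x $ i) t) ^ 4" by (simp add: i)
      also have "\<dots> \<le> (\<Sum>j\<in>UNIV. (bessel (x $ j) t) ^ 4)" by (rule member_le_sum) auto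
      finally have 2: "M ^ 4 \<le> (\<Sum>j\<in>UNIV. (bessel (x $ j) t) ^ 4)" .
      show ?thesis
      proof (cases "CARD('d) = 3")
        case True
        have "M ^ 3 \<le> sqrt T * M ^ 4 + 1 / sqrt T ^ 3"
        proof (cases "1 \<le> sqrt T * M")
          case True
          then have "M ^ 3 * 1 \<le> M ^ 3 * (sqrt T * M)" using M0 by (intro mult_left_mono) auto
          moreover have "0 \<le> 1 / sqrt T ^ 3" using sT by simp
          moreover have "M ^ 3 * (sqrt T * M) = sqrt T * M ^ 4" by (simp add: eval_nat_numeral)
          ultimately show ?thesis by linarith
        next
          case False
          then have "(sqrt T * M) ^ 3 \<le> 1" using M0 sT by (intro power_le_one) auto
          then have "M ^ 3 \<le> 1 / sqrt T ^ 3" using sT by (simp add: field_simps power_mult_distrib)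
          moreover have "0 \<le> sqrt T * M ^ 4" using M0 sT by simp
          ultimately show ?thesis by linarith
        qed
        moreover have "sqrt T * M ^ 4 \<le> sqrt T * (\<Sum>j\<in>UNIV. (bessel (x $ j) t) ^ 4)"
          using 2 sT by (intro mult_left_mono) auto
        ultimately show ?thesis using 1 True by (simp add: l_def e_def)
      next
        case False
        then have "CARD('d) = 4" using d by auto
        then show ?thesis using 1 2 by (simp add: l_def e_def)
      qed
    qed
    have "integral {T..2 * T} (\<lambda>t. \<bar>bessel_prod x t\<bar>) \<le>
       integral {T..2 * T} (\<lambda>t. l * (\<Sum>j\<in>UNIV. (bessel (x $ j) t) ^ 4) + e)"
      by (intro integral_le integrable_continuous_interval continuous_intros pw)
    also have "\<dots> = l * (\<Sum>j\<in>UNIV. integral {T..2 * T} (\<lambda>t. (bessel (x $ j) t) ^ 4)) + e * T"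
      using T by (subst integral_add integral_mult_right integral_sum;
        (intro integrable_continuous_interval continuous_intros | simp)?)+
    also have "\<dots> \<le> l * (\<Sum>j\<in>(UNIV::'d set). C * (1 + ln T) / T) + e * T"
      using T by (intro add_mono mult_left_mono sum_mono C(2)) (auto simp: l_def e_def)
    also have "\<dots> = CARD('d) * C * (1 + ln T) * (l / T) + e * T" by simp
    also have "\<dots> \<le> CARD('d) * C * (1 + ln T) * T powr (1 - CARD('d) / 2) + (1 + ln T) * T powr (1 - CARD('d) / 2)"
    proof (cases "CARD('d) = 3")
      case True
      have p: "T powr (1 - CARD('d) / 2) = 1 / sqrt T"
        using T by (simp add: True powr_minus_divide powr_half_sqrt)
      have "l / T = 1 / sqrt T" "e * T = 1 / sqrt T" using sT T True
        by (simp_all add: l_def e_def field_simps power3_eq_cube)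
      moreover have "1 * (1 / sqrt T) \<le> (1 + ln T) * (1 / sqrt T)"
        using T by (intro mult_right_mono) auto
      ultimately show ?thesis unfolding p by simp
    next
      case False
      then have "CARD('d) = 4" using d by auto
      then have "T powr (1 - CARD('d) / 2) = l / T" "e = 0" "l = 1" using T
        by (simp_all add: l_def e_def powr_minus_divide)
      then show ?thesis using T by simp
    qed
    also have "\<dots> = (CARD('d) * C + 1) * (1 + ln T) * T powr (1 - CARD('d) / 2)" by (simp add: algebra_simps)
    also have "\<dots> \<le> (4 * C + 1) * (1 + ln T) * T powr (1 - CARD('d) / 2)"
      using T C(1) d by (intro mult_right_mono add_mono) auto
    finally show ?thesis .
  qed
  moreover have "4 * C + 1 \<ge> 1" using C(1) by simp
  ultimately show ?thesis using that by blast
qed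

lemma bessel_prod_0: "bessel_prod x 0 = (if x = 0 then 1 else 0)"
  by (auto simp: bessel_prod_def bessel_0 vec_eq_iff)

text \<open>The product rule. After multiplication by the phase \<open>i^(x_1 + ... + x_d)\<close>
  this is the equation \<open>u' = (i / 2) N u\<close>.\<close>

lemma bessel_prod_DERIV:
  "(bessel_prod x has_real_derivative
     (\<Sum>j\<in>UNIV. bessel_prod (x - axis j 1) t - bessel_prod (x + axis j 1) t) / 2) (at t)"
proof -
  have shift: "bessel_prod (x + axis j c) t = bessel (x $ j + c) t * (\<Prod>i\<in>UNIV - {j}. bessel (x $ i) t)" for j c
    unfolding bessel_prod_def
    by (subst prod.remove[of _ j]) (auto intro!: prod.cong simp: axis_def)
  have "x - axis j 1 = x + axis j (-1)" for j by (simp add: vec_eq_iff axis_def)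
  then have *: "bessel_prod (x - axis j 1) t - bessel_prod (x + axis j 1) t =
     (bessel (x $ j - 1) t - bessel (x $ j + 1) t) * (\<Prod>i\<in>UNIV - {j}. bessel (x $ i) t)" for j
    by (simp only: shift) (simp add: left_diff_distrib)
  have "(bessel_prod x has_real_derivative
     (\<Sum>j\<in>UNIV. (bessel (x $ j - 1) t - bessel (x $ j + 1) t) / 2 * (\<Prod>i\<in>UNIV - {j}. bessel (x $ i) t))) (at t)"
    unfolding bessel_prod_def[abs_def] by (intro has_field_derivative_prod bessel_has_derivative)
  then show ?thesis by (simp only: * sum_divide_distrib times_divide_eq_left)
qed

section \<open>Absolutely summable coefficient sequences\<close>

definition coeff_conv :: "(nat \<Rightarrow> complex) \<Rightarrow> (nat \<Rightarrow> complex) \<Rightarrow> nat \<Rightarrow> complex" where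
  "coeff_conv a b k = (\<Sum>i\<le>k. a i * b (k - i))"

lemma coeff_conv_commute: "coeff_conv a b = coeff_conv b a"
proof
  fix k
  show "coeff_conv a b k = coeff_conv b a k"
    unfolding coeff_conv_def
    by (rule sum.reindex_bij_witness[of _ "\<lambda>i. k - i" "\<lambda>i. k - i"]) (auto simp: mult.commute)
qed

text \<open>Below, \<open>R = 2 d\<close> bounds the norm of the adjacency operator.\<close>

definition coeff_summable :: "real \<Rightarrow> (nat \<Rightarrow> complex) \<Rightarrow> bool" where
  "coeff_summable R a \<longleftrightarrow> summable (\<lambda>n. norm (a n) * R ^ n)"

text \<open>The norm of the algebra of power series that converge absolutely on the disc of radius
  \<open>R\<close>. It dominates the series as a multiplier on \<open>[-R, R]\<close> and, because
  \<open>N^n\<close> enlarges the supremum norm by at most \<open>R^n\<close>, as an operator on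
  bounded functions.\<close>

definition coeff_norm :: "real \<Rightarrow> (nat \<Rightarrow> complex) \<Rightarrow> real" where
  "coeff_norm R a = (\<Sum>n. norm (a n) * R ^ n)"

lemma coeff_summable_coeff_conv:
  assumes "0 \<le> R" "coeff_summable R a" "coeff_summable R b" shows "coeff_summable R (coeff_conv a b)"
proof -
  have "summable (\<lambda>k. \<Sum>i\<le>k. (norm (a i) * R ^ i) * (norm (b (k - i)) * R ^ (k - i)))"
    by (rule summable_Cauchy_product) (use assms in \<open>auto simp: coeff_summable_def\<close>)
  then show ?thesis unfolding coeff_summable_def
  proof (rule summable_comparison_test')
    fix k
    have "norm (coeff_conv a b k) * R ^ k \<le> (\<Sum>i\<le>k. norm (a i * b (k - i))) * R ^ k"
      unfolding coeff_conv_def using assms(1) by (intro mult_right_mono norm_sum) auto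
    also have "\<dots> = (\<Sum>i\<le>k. (norm (a i) * R ^ i) * (norm (b (k - i)) * R ^ (k - i)))"
      unfolding sum_distrib_right by (rule sum.cong) (auto simp: norm_mult simp flip: power_add)
    finally show "norm (norm (coeff_conv a b k) * R ^ k) \<le> (\<Sum>i\<le>k. (norm (a i) * R ^ i) * (norm (b (k - i)) * R ^ (k - i)))"
      using assms(1) by simp
  qed
qed

text \<open>An absolutely summable double family, regrouped along the diagonals
  \<open>n + m = k\<close>. In use, \<open>g k\<close> is the value of \<open>N^k f\<close> at a
  point, which explains the growth condition; the identity then says that composing two series in
  \<open>N\<close> convolves their coefficients.\<close>

lemma double_series_conv:
  fixes a b g :: "nat \<Rightarrow> complex"
  assumes R: "0 \<le> R" and a: "coeff_summable R a" and b: "coeff_summable R b" and g: "\<And>k. norm (g k) \<le> R ^ k * B"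
  shows "(\<lambda>k. coeff_conv a b k * g k) sums (\<Sum>n. a n * (\<Sum>m. b m * g (n + m)))"
proof -
  define f where "f = (\<lambda>(n, m). a n * b m * g (n + m))"
  have B: "B \<ge> 0" using g[of 0] norm_ge_zero[of "g 0"] by (simp del: norm_ge_zero)
  have bound: "norm (f (n, m)) \<le> (norm (a n) * R ^ n) * (norm (b m) * R ^ m) * B" for n m
    unfolding f_def using mult_left_mono[OF g[of "n+m"], of "norm (a n) * norm (b m)"]
    by (simp add: norm_mult power_add mult_ac)
  have "(\<lambda>p. norm (f p)) summable_on UNIV"
  proof (rule nonneg_bdd_above_summable_on)
    show "bdd_above (sum (\<lambda>p. norm (f p)) ` {F. F \<subseteq> UNIV \<and> finite F})"
    proof (rule bdd_aboveI2)
      fix F :: "(nat \<times> nat) set" assume "F \<in> {F. F \<subseteq> UNIV \<and> finite F}"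
      then have F: "finite F" by simp
      define N where "N = Suc (Max (insert 0 (fst ` F \<union> snd ` F)))"
      have "p < N" if "p \<in> fst ` F \<union> snd ` F" for p
        unfolding N_def less_Suc_eq_le using F that by (intro Max_ge) auto
      then have sub: "F \<subseteq> {..<N} \<times> {..<N}" by (force simp: image_iff)
      have "sum (\<lambda>p. norm (f p)) F \<le> sum (\<lambda>p. norm (f p)) ({..<N} \<times> {..<N})"
        by (rule sum_mono2) (use sub in auto)
      also have "\<dots> = (\<Sum>n<N. \<Sum>m<N. norm (f (n, m)))" by (simp add: sum.cartesian_product)
      also have "\<dots> \<le> (\<Sum>n<N. \<Sum>m<N. (norm (a n) * R ^ n) * (norm (b m) * R ^ m) * B)"
        by (intro sum_mono bound)
      also have "\<dots> = (\<Sum>n<N. norm (a n) * R ^ n) * (\<Sum>m<N. norm (b m) * R ^ m) * B"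
        by (subst sum_product, simp only: sum_distrib_right)
      also have "\<dots> \<le> coeff_norm R a * coeff_norm R b * B"
        unfolding coeff_norm_def using a b R B
        by (intro mult_right_mono mult_mono sum_le_suminf sum_nonneg suminf_nonneg) (auto simp: coeff_summable_def)
      finally show "sum (\<lambda>p. norm (f p)) F \<le> coeff_norm R a * coeff_norm R b * B" .
    qed
  qed simp
  then have "f summable_on UNIV" by (rule abs_summable_summable)
  then obtain S where S: "(f has_sum S) (UNIV \<times> UNIV)" by (auto simp: summable_on_def)
  have "((\<lambda>n. a n * (\<Sum>m. b m * g (n + m))) has_sum S) UNIV"
  proof (rule has_sum_SigmaD[OF S])
    fix n
    have "summable (\<lambda>m. norm (b m * g (n + m)))"
    proof (rule summable_comparison_test')
      show "summable (\<lambda>m. (R ^ n * B) * (norm (b m) * R ^ m))"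
        using b by (intro summable_mult) (simp add: coeff_summable_def)
      show "norm (norm (b m * g (n + m))) \<le> (R ^ n * B) * (norm (b m) * R ^ m)" for m
        using mult_left_mono[OF g[of "n+m"], of "norm (b m)"] by (simp add: norm_mult power_add mult_ac)
    qed
    then have "((\<lambda>m. b m * g (n + m)) has_sum (\<Sum>m. b m * g (n + m))) UNIV"
      by (intro norm_summable_imp_has_sum) (auto intro: summable_norm_cancel summable_sums)
    then have "((\<lambda>m. a n * (b m * g (n + m))) has_sum a n * (\<Sum>m. b m * g (n + m))) UNIV"
      by (rule has_sum_cmult_right)
    then show "((\<lambda>m. f (n, m)) has_sum a n * (\<Sum>m. b m * g (n + m))) UNIV"
      by (simp add: f_def mult.assoc)
  qed
  then have S1: "(\<lambda>n. a n * (\<Sum>m. b m * g (n + m))) sums S" by (rule has_sum_imp_sums)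
  have "((\<lambda>(k, i). a i * b (k - i) * g k) has_sum S) (SIGMA k:UNIV. {..k})"
    using S by (subst has_sum_reindex_bij_witness[of _ "\<lambda>(n, m). (n + m, n)" "\<lambda>(k, i). (i, k - i)" _ f _ S])
      (auto simp: f_def)
  then have "((\<lambda>k. coeff_conv a b k * g k) has_sum S) UNIV"
    by (rule has_sum_SigmaD) (auto simp: coeff_conv_def sum_distrib_right intro!: has_sum_finiteI)
  then have "(\<lambda>k. coeff_conv a b k * g k) sums S" by (rule has_sum_imp_sums)
  then show ?thesis using sums_unique[OF S1] by simp
qed

section \<open>Power series in the adjacency operator of the lattice\<close>

text \<open>The operator \<open>N\<close> of the overview: \<open>\<Delta> = N - 2 d\<close>, so
  \<open>sqrt (1 - \<Delta>)\<close> is the function \<open>sqrt (1 + 2 d - s)\<close> of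
  \<open>N\<close>.\<close>

definition nbr_sum :: "(int ^ 'd::finite \<Rightarrow> complex) \<Rightarrow> int ^ 'd \<Rightarrow> complex" where
  "nbr_sum f x = (\<Sum>j\<in>UNIV. f (x + axis j 1) + f (x - axis j 1))"

text \<open>A functional calculus on bounded functions, defined pointwise. For absolutely summable
  coefficients these operators commute with translations and with one another; they are matched with
  Fourier multipliers later.\<close>

definition nbr_series :: "(nat \<Rightarrow> complex) \<Rightarrow> (int ^ 'd::finite \<Rightarrow> complex) \<Rightarrow> int ^ 'd \<Rightarrow> complex" where
  "nbr_series a f x = (\<Sum>n. a n * (nbr_sum ^^ n) f x)"

lemma nbr_pow_add: "(nbr_sum ^^ n) (\<lambda>x. f x + g x) = (\<lambda>x. (nbr_sum ^^ n) f x + (nbr_sum ^^ n) g x)"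
  by (induction n) (auto simp: nbr_sum_def fun_eq_iff sum.distrib[symmetric] add_ac intro!: sum.cong)

lemma nbr_pow_scale: "(nbr_sum ^^ n) (\<lambda>x. c * f x) = (\<lambda>x. c * (nbr_sum ^^ n) f x)"
  by (induction n) (auto simp: nbr_sum_def fun_eq_iff sum_distrib_left distrib_left)

lemma nbr_pow_translate: "(nbr_sum ^^ n) (\<lambda>x. f (x - y)) = (\<lambda>x. (nbr_sum ^^ n) f (x - y))"
  by (induction n) (auto simp: nbr_sum_def fun_eq_iff algebra_simps)

lemma nbr_pow_cnj: "(nbr_sum ^^ n) (\<lambda>x. cnj (f x)) = (\<lambda>x. cnj ((nbr_sum ^^ n) f x))"
  by (induction n) (auto simp: nbr_sum_def fun_eq_iff)

lemma nbr_pow_sum: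
  fixes f :: "'b \<Rightarrow> int ^ 'a::finite \<Rightarrow> complex"
  shows "(nbr_sum ^^ n) (\<lambda>x. \<Sum>y\<in>A. f y x) = (\<lambda>x. \<Sum>y\<in>A. (nbr_sum ^^ n) (f y) x)"
proof (induction n)
  case (Suc n)
  have "nbr_sum (\<lambda>x. \<Sum>y\<in>A. g y x) = (\<lambda>x. \<Sum>y\<in>A. nbr_sum (g y) x)" for g :: "'b \<Rightarrow> int ^ 'a \<Rightarrow> complex"
    unfolding nbr_sum_def sum.distrib[symmetric] by (rule ext, rule sum.swap)
  then show ?case by (simp add: Suc)
qed simp

lemma nbr_pow_bound:
  fixes f :: "int ^ 'd::finite \<Rightarrow> complex"
  assumes "\<And>x. norm (f x) \<le> B"
  shows "norm ((nbr_sum ^^ n) f x) \<le> (2 * real CARD('d)) ^ n * B"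
proof (induction n arbitrary: x)
  case (Suc n)
  let ?g = "(nbr_sum ^^ n) f"
  have "norm (?g (x + axis j 1) + ?g (x - axis j 1)) \<le> 2 * ((2 * real CARD('d)) ^ n * B)" for j
    using norm_triangle_mono[OF Suc[of "x + axis j 1"] Suc[of "x - axis j 1"]] by (simp add: mult_ac)
  then have "norm ((nbr_sum ^^ Suc n) f x) \<le> (\<Sum>j\<in>(UNIV::'d set). 2 * ((2 * real CARD('d)) ^ n * B))"
    unfolding nbr_sum_def[of ?g] funpow.simps o_def by (intro sum_norm_le)
  then show ?case by (simp add: mult_ac)
qed (use assms in simp)

context
  fixes a :: "nat \<Rightarrow> complex" and f :: "int ^ 'd::finite \<Rightarrow> complex" and B :: real
  assumes coeff_summable_a: "coeff_summable (2 * real CARD('d)) a" and bound_f: "\<And>x. norm (f x) \<le> B"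
begin

lemma nbr_series_term_bound: "norm (a n * (nbr_sum ^^ n) f x) \<le> norm (a n) * (2 * real CARD('d)) ^ n * B"
  using mult_left_mono[OF nbr_pow_bound[OF bound_f, where n=n and x=x], of "norm (a n)"] by (simp add: norm_mult mult_ac)

lemma nbr_series_norm_summable: "summable (\<lambda>n. norm (a n * (nbr_sum ^^ n) f x))"
  by (rule summable_comparison_test'[of "\<lambda>n. norm (a n) * (2 * real CARD('d)) ^ n * B"])
    (use coeff_summable_a nbr_series_term_bound in \<open>auto simp: coeff_summable_def intro: summable_mult2\<close>)

lemma nbr_series_sums: "(\<lambda>n. a n * (nbr_sum ^^ n) f x) sums nbr_series a f x"
  unfolding nbr_series_def by (intro summable_sums summable_norm_cancel[OF nbr_series_norm_summable])

lemma nbr_series_bound: "norm (nbr_series a f x) \<le> coeff_norm (2 * real CARD('d)) a * B"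
proof -
  have "norm (nbr_series a f x) \<le> (\<Sum>n. norm (a n * (nbr_sum ^^ n) f x))"
    unfolding nbr_series_def by (rule summable_norm[OF nbr_series_norm_summable])
  also have "\<dots> \<le> (\<Sum>n. norm (a n) * (2 * real CARD('d)) ^ n * B)"
    using coeff_summable_a by (intro suminf_le nbr_series_term_bound nbr_series_norm_summable) (auto simp: coeff_summable_def intro: summable_mult2)
  also have "\<dots> = coeff_norm (2 * real CARD('d)) a * B"
    unfolding coeff_norm_def using coeff_summable_a by (subst suminf_mult2) (auto simp: coeff_summable_def)
  finally show ?thesis .
qed

end

lemma nbr_series_add:
  fixes f g :: "int ^ 'd::finite \<Rightarrow> complex"
  assumes "coeff_summable (2 * real CARD('d)) a" "\<And>x. norm (f x) \<le> B" "\<And>x. norm (g x) \<le> C"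
  shows "nbr_series a (\<lambda>x. f x + g x) x = nbr_series a f x + nbr_series a g x"
  using sums_unique[OF sums_add[OF nbr_series_sums[OF assms(1,2), where x=x] nbr_series_sums[OF assms(1,3), where x=x]]]
  by (simp add: nbr_series_def nbr_pow_add distrib_left)

lemma nbr_series_scale:
  fixes f :: "int ^ 'd::finite \<Rightarrow> complex"
  assumes "coeff_summable (2 * real CARD('d)) a" "\<And>x. norm (f x) \<le> B"
  shows "nbr_series a (\<lambda>x. c * f x) x = c * nbr_series a f x"
  using sums_unique[OF sums_mult[OF nbr_series_sums[OF assms, where x=x], of c]]
  by (simp add: nbr_series_def nbr_pow_scale mult_ac)

lemma nbr_series_sum:
  fixes f :: "'b \<Rightarrow> int ^ 'd::finite \<Rightarrow> complex"
  assumes "coeff_summable (2 * real CARD('d)) a" "\<And>y x. y \<in> A \<Longrightarrow> norm (f y x) \<le> B y"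
  shows "nbr_series a (\<lambda>x. \<Sum>y\<in>A. f y x) x = (\<Sum>y\<in>A. nbr_series a (f y) x)"
proof -
  have "(\<lambda>n. \<Sum>y\<in>A. a n * (nbr_sum ^^ n) (f y) x) sums (\<Sum>y\<in>A. nbr_series a (f y) x)"
    using assms by (intro sums_sum nbr_series_sums)
  then show ?thesis unfolding nbr_series_def[of a "\<lambda>x. \<Sum>y\<in>A. f y x"]
    by (simp add: nbr_pow_sum sum_distrib_left sums_iff)
qed

lemma nbr_series_translate: "nbr_series a (\<lambda>x. f (x - y)) x = nbr_series a f (x - y)"
  by (simp add: nbr_series_def nbr_pow_translate)

lemma nbr_series_translate_plus: "nbr_series a (\<lambda>x. f (x + y)) x = nbr_series a f (x + y)"
  using nbr_series_translate[of a f "- y" x] by simp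

lemma nbr_pow_nbr_series:
  fixes f :: "int ^ 'd::finite \<Rightarrow> complex"
  assumes "coeff_summable (2 * real CARD('d)) a" "\<And>x. norm (f x) \<le> B"
  shows "(nbr_sum ^^ n) (nbr_series a f) x = nbr_series a ((nbr_sum ^^ n) f) x"
proof (induction n arbitrary: x)
  case (Suc n)
  note b = nbr_pow_bound[OF assms(2)]
  have "(nbr_sum ^^ Suc n) (nbr_series a f) x = nbr_sum (nbr_series a ((nbr_sum ^^ n) f)) x"
    using ext[of "(nbr_sum ^^ n) (nbr_series a f)", OF Suc] by simp
  also have "\<dots> = (\<Sum>j\<in>UNIV. nbr_series a (\<lambda>x. (nbr_sum ^^ n) f (x - - axis j 1)) x + nbr_series a (\<lambda>x. (nbr_sum ^^ n) f (x - axis j 1)) x)"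
    by (simp add: nbr_sum_def[of "nbr_series a ((nbr_sum ^^ n) f)"] nbr_series_translate nbr_series_translate_plus)
  also have "\<dots> = nbr_series a (\<lambda>x. \<Sum>j\<in>UNIV. (nbr_sum ^^ n) f (x - - axis j 1) + (nbr_sum ^^ n) f (x - axis j 1)) x"
    by (subst nbr_series_sum[OF assms(1) norm_triangle_le[OF add_mono[OF b b]]];
        subst nbr_series_add[OF assms(1) b b]; simp)
  also have "(\<lambda>x. \<Sum>j\<in>UNIV. (nbr_sum ^^ n) f (x - - axis j 1) + (nbr_sum ^^ n) f (x - axis j 1)) = (nbr_sum ^^ Suc n) f"
    by (rule ext) (simp add: nbr_sum_def[of "(nbr_sum ^^ n) f"])
  finally show ?case .
qed simp

lemma nbr_series_nbr_series:
  fixes f :: "int ^ 'd::finite \<Rightarrow> complex"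
  assumes "coeff_summable (2 * real CARD('d)) a" "coeff_summable (2 * real CARD('d)) b" "\<And>x. norm (f x) \<le> B"
  shows "nbr_series a (nbr_series b f) x = nbr_series (coeff_conv a b) f x"
proof -
  have comp: "(nbr_sum ^^ m) ((nbr_sum ^^ n) f) = (nbr_sum ^^ (n + m)) f" for n m
    by (metis add.commute comp_apply funpow_add)
  have "nbr_series a (nbr_series b f) x = (\<Sum>n. a n * (\<Sum>m. b m * (nbr_sum ^^ (n + m)) f x))"
    unfolding nbr_series_def[of a] nbr_pow_nbr_series[OF assms(2,3)] nbr_series_def[of b] comp by simp
  also have "\<dots> = nbr_series (coeff_conv a b) f x"
    unfolding nbr_series_def[of "coeff_conv a b"]
    by (rule sums_unique[OF double_series_conv[OF _ assms(1,2) nbr_pow_bound[OF assms(3)]]]) simp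
  finally show ?thesis .
qed

text \<open>Taylor coefficients of \<open>exp (i t s / 2)\<close>, so that \<open>nbr_series (prop_coeff t)\<close> is the propagator.\<close>

definition prop_coeff :: "real \<Rightarrow> nat \<Rightarrow> complex" where
  "prop_coeff t n = (\<i> * of_real t / 2) ^ n / fact n"

lemma coeff_summable_prop_coeff: "coeff_summable R (prop_coeff t)"
proof -
  have "(\<lambda>n. norm (prop_coeff t n) * R ^ n) = (\<lambda>n. inverse (fact n) * (\<bar>t\<bar> / 2 * R) ^ n)"
    by (simp add: fun_eq_iff prop_coeff_def norm_divide norm_power norm_mult power_mult_distrib power_divide field_simps)
  then show ?thesis unfolding coeff_summable_def using summable_exp[of "\<bar>t\<bar> / 2 * R"] by simp
qed

lemma coeff_norm_prop_coeff: "coeff_norm R (prop_coeff t) = exp (\<bar>t\<bar> / 2 * R)"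
proof -
  have "(\<lambda>n. norm (prop_coeff t n) * R ^ n) = (\<lambda>n. inverse (fact n) *\<^sub>R (\<bar>t\<bar> / 2 * R) ^ n)"
    by (simp add: fun_eq_iff prop_coeff_def norm_divide norm_power norm_mult power_mult_distrib power_divide field_simps)
  then show ?thesis unfolding coeff_norm_def by (simp add: exp_def)
qed

text \<open>At a fixed point \<open>x\<close> this is an entire power series in \<open>t\<close>
  with coefficients \<open>(i / 2)^n / n! * (N^n f)(x)\<close>; termwise differentiation lowers the
  factorial and leaves one extra factor \<open>N\<close>, which is moved onto
  \<open>f\<close>.\<close>

lemma nbr_series_prop_DERIV:
  fixes f :: "int ^ 'd::finite \<Rightarrow> complex"
  assumes "\<And>x. norm (f x) \<le> B"
  shows "((\<lambda>t. nbr_series (prop_coeff t) f x) has_vector_derivative \<i> / 2 * nbr_series (prop_coeff t) (nbr_sum f) x) (at t within S)"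
proof -
  have nb: "norm (nbr_sum f x) \<le> 2 * real CARD('d) * B" for x
    using nbr_pow_bound[OF assms, where n = 1 and x = x] by simp
  define c where "c n = (\<i> / 2) ^ n / fact n * (nbr_sum ^^ n) f x" for n
  have c_sum: "summable (\<lambda>n. c n * z ^ n)" for z
  proof (rule summable_comparison_test')
    show "summable (\<lambda>n. inverse (fact n) * (norm z * (real CARD('d))) ^ n * B)"
      by (intro summable_mult2 summable_exp)
    fix n
    have "norm (c n * z ^ n) = (1/2) ^ n / fact n * norm z ^ n * norm ((nbr_sum ^^ n) f x)"
      by (simp add: c_def norm_mult norm_divide norm_power)
    also have "\<dots> \<le> (1/2) ^ n / fact n * norm z ^ n * ((2 * real CARD('d)) ^ n * B)"
      by (intro mult_left_mono nbr_pow_bound assms) auto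
    also have "\<dots> = inverse (fact n) * (norm z * (real CARD('d))) ^ n * B"
      by (simp add: power_mult_distrib power_divide field_simps)
    finally show "norm (c n * z ^ n) \<le> \<dots>" .
  qed
  have eq: "nbr_series (prop_coeff s) f x = (\<Sum>n. c n * of_real s ^ n)" for s
    unfolding nbr_series_def prop_coeff_def c_def
    by (intro suminf_cong) (simp add: power_mult_distrib power_divide)
  have "((\<lambda>z. \<Sum>n. c n * z ^ n) has_field_derivative (\<Sum>n. diffs c n * (of_real t) ^ n)) (at (of_real t))"
    by (rule termdiffs_strong_converges_everywhere[OF c_sum])
  then have "((\<lambda>s. \<Sum>n. c n * of_real s ^ n) has_vector_derivative (\<Sum>n. diffs c n * (of_real t) ^ n)) (at t within S)"
    by (rule has_vector_derivative_real_field)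
  moreover have "(\<Sum>n. diffs c n * (of_real t) ^ n) = (\<Sum>n. \<i> / 2 * (prop_coeff t n * (nbr_sum ^^ n) (nbr_sum f) x))"
  proof (intro suminf_cong)
    fix n
    have nz: "(of_nat (Suc n) :: complex) \<noteq> 0" by (simp only: of_nat_eq_0_iff)
    have f: "fact (Suc n) = (of_nat (Suc n) * fact n :: complex)" by (simp only: fact_Suc)
    have d: "diffs c n = \<i> / 2 * ((\<i> / 2) ^ n / fact n * (nbr_sum ^^ n) (nbr_sum f) x)"
      unfolding diffs_def c_def f funpow_swap1[of nbr_sum n f] power_Suc funpow.simps(2) o_def using nz by simp
    have p: "prop_coeff t n = (\<i> / 2) ^ n * of_real t ^ n / fact n"
      by (simp add: prop_coeff_def flip: power_mult_distrib)
    show "diffs c n * (of_real t) ^ n = \<i> / 2 * (prop_coeff t n * (nbr_sum ^^ n) (nbr_sum f) x)"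
      unfolding d p by simp
  qed
  moreover have "\<dots> = \<i> / 2 * nbr_series (prop_coeff t) (nbr_sum f) x"
    unfolding nbr_series_def by (rule suminf_mult[OF summable_norm_cancel[OF nbr_series_norm_summable[OF coeff_summable_prop_coeff nb]]])
  ultimately show ?thesis unfolding eq by (simp only:)
qed

lemma nbr_series_prop_0: "nbr_series (prop_coeff 0) f x = f x"
proof -
  have "nbr_series (prop_coeff 0) f x = (\<Sum>n. if n = 0 then f x else 0)"
    unfolding nbr_series_def prop_coeff_def by (intro suminf_cong) auto
  also have "\<dots> = f x" by (rule sums_unique[OF sums_single, symmetric])
  finally show ?thesis .
qed

lemma continuous_on_nbr_series_prop:
  fixes f :: "int ^ 'd::finite \<Rightarrow> complex"
  assumes "\<And>x. norm (f x) \<le> B"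
  shows "continuous_on S (\<lambda>t. nbr_series (prop_coeff t) f x)"
  by (rule continuous_on_vector_derivative) (rule nbr_series_prop_DERIV[OF assms])

section \<open>The convolution kernel of the propagator\<close>

definition lat_delta :: "int ^ 'd::finite \<Rightarrow> int ^ 'd \<Rightarrow> complex" where
  "lat_delta y x = (if x = y then 1 else 0)"

text \<open>The real operator obtained from \<open>(i / 2) N\<close> by conjugation with
  \<open>lat_phase\<close>; by \<open>bessel_prod_DERIV\<close> it generates the evolution of the
  Bessel products.\<close>

definition bessel_step :: "(int ^ 'd::finite \<Rightarrow> real) \<Rightarrow> int ^ 'd \<Rightarrow> real" where
  "bessel_step r x = (\<Sum>j\<in>UNIV. r (x - axis j 1) - r (x + axis j 1)) / 2"

lemma bessel_step_pow_DERIV: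
  "((\<lambda>t. (bessel_step ^^ n) (\<lambda>x. bessel_prod x t) x) has_real_derivative
     (bessel_step ^^ Suc n) (\<lambda>x. bessel_prod x t) x) (at t)"
proof (induction n arbitrary: x)
  case 0
  show ?case using bessel_prod_DERIV[of x t] by (simp add: bessel_step_def)
next
  case (Suc n)
  let ?G = "\<lambda>n t. (bessel_step ^^ n) (\<lambda>x. bessel_prod x t)"
  have "((\<lambda>t. (\<Sum>j\<in>UNIV. ?G n t (x - axis j 1) - ?G n t (x + axis j 1)) / 2) has_real_derivative
      (\<Sum>j\<in>UNIV. ?G (Suc n) t (x - axis j 1) - ?G (Suc n) t (x + axis j 1)) / 2) (at t)"
    by (intro DERIV_cdivide DERIV_sum DERIV_diff Suc)
  then show ?case
    by (simp add: bessel_step_def[of "?G n _"] bessel_step_def[of "bessel_step (?G n t)"])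
qed

lemma bessel_step_pow_bound:
  fixes r :: "int ^ 'd::finite \<Rightarrow> real"
  assumes "\<And>x. \<bar>r x\<bar> \<le> 1" shows "\<bar>(bessel_step ^^ n) r x\<bar> \<le> real CARD('d) ^ n"
proof (induction n arbitrary: x)
  case (Suc n)
  let ?g = "(bessel_step ^^ n) r"
  have "\<bar>\<Sum>j\<in>UNIV. ?g (x - axis j 1) - ?g (x + axis j 1)\<bar> \<le> (\<Sum>j\<in>(UNIV::'d set). 2 * real CARD('d) ^ n)"
    by (intro order_trans[OF sum_abs] sum_mono order_trans[OF abs_triangle_ineq4])
       (use add_mono[OF Suc Suc] in simp)
  then show ?case by (simp add: bessel_step_def[of ?g] field_simps)
qed (use assms in simp)

text \<open>This is \<open>i^(x_1 + ... + x_d)\<close>, written through \<open>cis\<close> so that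
  negative exponents are covered.\<close>

definition lat_phase :: "int ^ 'd::finite \<Rightarrow> complex" where
  "lat_phase x = cis (pi / 2 * of_int (\<Sum>j\<in>UNIV. x $ j))"

lemma norm_lat_phase [simp]: "norm (lat_phase x) = 1"
  by (simp add: lat_phase_def)

lemma lat_phase_axis: "lat_phase (x + axis j 1) = \<i> * lat_phase x" "lat_phase (x - axis j 1) = - \<i> * lat_phase x"
proof -
  have s: "(\<Sum>i\<in>UNIV. (axis j 1 :: int ^ 'a) $ i) = 1" by (simp add: axis_def)
  have c: "cis (pi / 2) = \<i>" "cis (- (pi / 2)) = - \<i>" by (simp_all add: complex_eq_iff)
  have "pi / 2 * of_int (\<Sum>i\<in>UNIV. (x + axis j 1) $ i) = pi / 2 + pi / 2 * of_int (\<Sum>i\<in>UNIV. x $ i)"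
    by (simp only: vector_add_component sum.distrib s of_int_add distrib_left of_int_1 mult_1_right add.commute)
  then show "lat_phase (x + axis j 1) = \<i> * lat_phase x"
    unfolding lat_phase_def c(1)[symmetric] cis_mult by (simp only:)
  have "pi / 2 * of_int (\<Sum>i\<in>UNIV. (x - axis j 1) $ i) = - (pi / 2) + pi / 2 * of_int (\<Sum>i\<in>UNIV. x $ i)"
    by (simp only: vector_minus_component sum_subtractf s of_int_diff right_diff_distrib of_int_1 mult_1_right uminus_add_conv_diff)
  then show "lat_phase (x - axis j 1) = - \<i> * lat_phase x"
    unfolding lat_phase_def c(2)[symmetric] cis_mult by (simp only:)
qed

lemma nbr_pow_phase:
  "(\<i> / 2) ^ n * (nbr_sum ^^ n) (\<lambda>x. lat_phase x * of_real (r x)) x = lat_phase x * of_real ((bessel_step ^^ n) r x)"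
proof (induction n arbitrary: x)
  case (Suc n)
  define f where "f = (nbr_sum ^^ n) (\<lambda>x. lat_phase x * of_real (r x))"
  define g where "g = (bessel_step ^^ n) r"
  have fg: "(\<i> / 2) ^ n * f x = lat_phase x * of_real (g x)" for x using Suc by (simp add: f_def g_def)
  have "(\<i> / 2) ^ Suc n * nbr_sum f x = \<i> / 2 * (\<Sum>j\<in>UNIV. (\<i> / 2) ^ n * f (x + axis j 1) + (\<i> / 2) ^ n * f (x - axis j 1))"
    unfolding nbr_sum_def sum_distrib_left distrib_left power_Suc by (simp only: mult.assoc)
  also have "\<dots> = \<i> / 2 * (\<Sum>j\<in>UNIV. \<i> * lat_phase x * of_real (g (x + axis j 1)) + (- \<i> * lat_phase x) * of_real (g (x - axis j 1)))"
    by (simp only: fg lat_phase_axis)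
  also have "\<dots> = (\<Sum>j\<in>UNIV. lat_phase x * of_real (g (x - axis j 1) - g (x + axis j 1)) / 2)"
    unfolding sum_distrib_left by (intro sum.cong refl) (simp add: algebra_simps)
  also have "\<dots> = lat_phase x * of_real (bessel_step g x)"
    by (simp add: bessel_step_def sum_distrib_left sum_divide_distrib)
  finally show ?case by (simp add: f_def g_def)
qed simp

text \<open>Both sides have the same Taylor series in \<open>t\<close>: at \<open>t = 0\<close> the
  Bessel product is the delta function, its \<open>n\<close>-th derivative is
  \<open>bessel_step\<close> applied \<open>n\<close> times, and these derivatives are bounded by
  \<open>d^n\<close>, so Maclaurin's remainder tends to \<open>0\<close>.\<close>

lemma nbr_series_prop_delta:
  fixes x y :: "int ^ 'd::finite"
  shows "nbr_series (prop_coeff t) (lat_delta y) x = lat_phase (x - y) * of_real (bessel_prod (x - y) t)"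
proof -
  let ?D = "\<lambda>m t. (bessel_step ^^ m) (\<lambda>x. bessel_prod x t)"
  have sums: "(\<lambda>m. ?D m 0 z / fact m * t ^ m) sums bessel_prod z t" for z :: "int ^ 'd"
  proof -
    have b: "norm ((\<Sum>m<n. ?D m 0 z / fact m * t ^ m) - bessel_prod z t) \<le> (real CARD('d) * \<bar>t\<bar>) ^ n /\<^sub>R fact n" for n
    proof -
      obtain s where s: "bessel_prod z t = (\<Sum>m<n. ?D m 0 z / fact m * t ^ m) + ?D n s z / fact n * t ^ n"
        using Maclaurin_all_le[of "\<lambda>m t. ?D m t z" "bessel_prod z" t n] bessel_step_pow_DERIV by auto
      have "\<bar>?D n s z / fact n * t ^ n\<bar> \<le> real CARD('d) ^ n / fact n * \<bar>t\<bar> ^ n"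
        using mult_right_mono[OF bessel_step_pow_bound[of "\<lambda>x. bessel_prod x s" n z, OF abs_bessel_prod_le_1], of "\<bar>t\<bar> ^ n / fact n"]
        by (simp add: abs_mult power_abs)
      then show ?thesis using s by (simp add: power_mult_distrib divide_inverse mult_ac)
    qed
    have l: "(\<lambda>n. (real CARD('d) * \<bar>t\<bar>) ^ n /\<^sub>R fact n) \<longlonglongrightarrow> 0"
      using summable_LIMSEQ_zero[OF summable_exp_generic[of "real CARD('d) * \<bar>t\<bar>"]] by simp
    have "(\<lambda>n. (\<Sum>m<n. ?D m 0 z / fact m * t ^ m) - bessel_prod z t) \<longlonglongrightarrow> 0"
      by (rule Lim_null_comparison[OF always_eventually[OF allI[OF b]] l])
    then show ?thesis unfolding sums_def by (simp add: LIM_zero_iff)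
  qed
  define z where "z = x - y"
  have "lat_delta y x = lat_delta 0 (x - y)" for x by (simp add: lat_delta_def)
  then have "nbr_series (prop_coeff t) (lat_delta y) x = nbr_series (prop_coeff t) (lat_delta 0) z"
    using nbr_series_translate[of "prop_coeff t" "lat_delta 0" y x] unfolding z_def by (metis (no_types, lifting) ext)
  also have "lat_delta 0 = (\<lambda>x. lat_phase x * of_real (bessel_prod x 0))"
    by (auto simp: lat_delta_def bessel_prod_0 lat_phase_def fun_eq_iff)
  also have "nbr_series (prop_coeff t) \<dots> z = (\<Sum>n. lat_phase z * of_real (?D n 0 z / fact n * t ^ n))"
    unfolding nbr_series_def
  proof (intro suminf_cong)
    fix n
    show "prop_coeff t n * (nbr_sum ^^ n) (\<lambda>x. lat_phase x * of_real (bessel_prod x 0)) z =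
      lat_phase z * of_real (?D n 0 z / fact n * t ^ n)"
      using nbr_pow_phase[of n "\<lambda>x. bessel_prod x 0" z]
      by (simp add: prop_coeff_def power_mult_distrib power_divide field_simps)
  qed
  also have "\<dots> = lat_phase z * of_real (bessel_prod z t)"
    by (rule sums_unique[symmetric]) (intro sums_mult sums_of_real sums)
  finally show ?thesis by (simp add: z_def)
qed

section \<open>Fourier series on the torus\<close>

abbreviation torus_vol :: "'d::finite itself \<Rightarrow> real" where
  "torus_vol _ \<equiv> (2 * pi) ^ CARD('d)"

lemma mult_cnj_norm: "z * cnj z = (complex_of_real (norm z))\<^sup>2"
  by (metis complex_norm_square of_real_power)

lemma space_torus [simp]: "space torus = cbox (\<chi> j. - pi) (\<chi> j. pi)"
  by (simp add: torus_def space_restrict_space)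

lemma borel_measurable_torus_continuous:
  fixes f :: "real ^ 'd::finite \<Rightarrow> 'b::topological_space"
  assumes "continuous_on UNIV f" shows "f \<in> borel_measurable torus"
  unfolding torus_def
  by (rule measurable_restrict_space1) (use assms in \<open>simp add: borel_measurable_continuous_onI\<close>)

lemma integrable_torus_continuous:
  fixes f :: "real ^ 'd::finite \<Rightarrow> 'b::euclidean_space"
  assumes "continuous_on UNIV f" shows "integrable torus f"
  unfolding torus_def
  by (subst integrable_restrict_space)
    (auto intro!: borel_integrable_compact continuous_on_subset[OF assms])

lemma integral_torus:
  fixes f :: "real ^ 'd::finite \<Rightarrow> 'b::euclidean_space"
  shows "(LINT \<xi>|torus. f \<xi>) = (LINT \<xi>|lborel. indicator (cbox (\<chi> j. - pi) (\<chi> j. pi)) \<xi> *\<^sub>R f \<xi>)"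
  unfolding torus_def by (subst integral_restrict_space) auto

lemma continuous_on_pairing [continuous_intros]:
  "continuous_on A f \<Longrightarrow> continuous_on A (\<lambda>\<xi>. pairing x (f \<xi>))"
  unfolding pairing_def by (intro continuous_intros)

lemma continuous_on_cis' [continuous_intros]:
  "continuous_on A f \<Longrightarrow> continuous_on A (\<lambda>\<xi>. cis (f \<xi>))"
  unfolding cis_conv_exp by (intro continuous_intros)

lemma pairing_add: "pairing (x + y) \<xi> = pairing x \<xi> + pairing y \<xi>"
  by (simp add: pairing_def sum.distrib distrib_right)

lemma pairing_diff: "pairing (x - y) \<xi> = pairing x \<xi> - pairing y \<xi>"
  by (simp add: pairing_def sum_subtractf left_diff_distrib)

lemma pairing_axis: "pairing (axis j 1) \<xi> = \<xi> $ j"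
proof -
  have "pairing (axis j 1) \<xi> = (\<Sum>i\<in>UNIV. if i = j then \<xi> $ i else 0)"
    unfolding pairing_def by (rule sum.cong) (auto simp: axis_def)
  then show ?thesis by simp
qed

lemma integral_cis_interval:
  "(LINT s|lborel. indicator {-pi..pi} s *\<^sub>R cis (of_int n * s)) = (if n = 0 then of_real (2 * pi) else 0)"
  "integrable lborel (\<lambda>s. indicator {-pi..pi} s *\<^sub>R cis (of_int n * s))"
proof -
  show int: "integrable lborel (\<lambda>s. indicator {-pi..pi} s *\<^sub>R cis (of_int n * s))"
    by (intro borel_integrable_compact continuous_intros) auto
  define F where "F s = (if n = 0 then of_real s else cis (of_int n * s) / (\<i> * of_int n))" for s
  have "has_bochner_integral lborel (\<lambda>s. indicator {-pi..pi} s *\<^sub>R cis (of_int n * s)) (F pi - F (- pi))"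
  proof (rule has_bochner_integral_FTC_Icc)
    fix s
    show "(F has_vector_derivative cis (of_int n * s)) (at s within {- pi..pi})"
    proof (cases "n = 0")
      case True
      then show ?thesis by (auto simp: F_def[abs_def] intro!: derivative_eq_intros has_vector_derivative_of_real)
    next
      case False
      have "((\<lambda>s. exp (\<i> * of_int n * of_real s) / (\<i> * of_int n)) has_vector_derivative exp (\<i> * of_int n * of_real s)) (at s within {- pi..pi})"
        using False by (auto intro!: has_vector_derivative_real_field derivative_eq_intros)
      then show ?thesis using False by (simp add: F_def[abs_def] cis_conv_exp mult.assoc)
    qed
  qed (auto intro!: continuous_intros)
  then have "(LINT s|lborel. indicator {-pi..pi} s *\<^sub>R cis (of_int n * s)) = F pi - F (- pi)"
    by (rule has_bochner_integral_integral_eq)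
  moreover have "cis (of_int n * pi) = cis (- (of_int n * pi))"
    by (rule complex_eqI) (simp_all add: sin_zero_iff_int2 mult.commute)
  ultimately show "(LINT s|lborel. indicator {-pi..pi} s *\<^sub>R cis (of_int n * s)) = (if n = 0 then of_real (2 * pi) else 0)"
    by (auto simp: F_def)
qed

lemma integral_lborel_prod_complex:
  fixes f :: "'a::euclidean_space \<Rightarrow> real \<Rightarrow> complex"
  assumes "\<And>b. b \<in> Basis \<Longrightarrow> integrable lborel (f b)"
  shows "(LINT x|lborel. (\<Prod>b\<in>Basis. f b (x \<bullet> b))) = (\<Prod>b\<in>Basis. (LINT s|lborel. f b s))"
proof -
  interpret product_sigma_finite "\<lambda>b::'a. lborel :: real measure" by standard
  have [measurable]: "f b \<in> borel_measurable borel" if "b \<in> Basis" for b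
    using borel_measurable_integrable[OF assms[OF that]] by simp
  have "(LINT x|lborel. (\<Prod>b\<in>Basis. f b (x \<bullet> b)))
    = (LINT g|(\<Pi>\<^sub>M b\<in>Basis. lborel). (\<Prod>b\<in>Basis. f b ((\<Sum>c\<in>Basis. g c *\<^sub>R c) \<bullet> b)))"
    by (subst lborel_eq, subst integral_distr) auto
  also have "\<dots> = (LINT g|(\<Pi>\<^sub>M b\<in>Basis. lborel). (\<Prod>b\<in>Basis. f b (g b)))"
    by (intro Bochner_Integration.integral_cong prod.cong refl) simp
  also have "\<dots> = (\<Prod>b\<in>Basis. (LINT s|lborel. f b s))"
    by (rule product_integral_prod) (use assms in auto)
  finally show ?thesis .
qed

lemma integral_torus_character:
  fixes x :: "int ^ 'd::finite"
  shows "(LINT \<xi>|torus. cis (pairing x \<xi>)) = (if x = 0 then of_real (torus_vol TYPE('d)) else 0)"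
proof -
  \<comment> \<open>The product formula runs over basis vectors; \<open>n\<close> reads off the
    coordinate of \<open>x\<close> that belongs to one.\<close>
  define n where "n b = x $ (THE j. axis j 1 = b)" for b :: "real ^ 'd"
  have n: "n (axis j 1) = x $ j" for j
  proof -
    have "(THE i. axis i 1 = (axis j 1 :: real ^ 'd)) = j"
      by (rule the_equality) (auto simp: axis_eq_axis)
    then show ?thesis by (simp add: n_def)
  qed
  have inj: "inj (\<lambda>j::'d. axis j (1::real))" by (auto simp: inj_on_def axis_eq_axis)
  have Basis: "(Basis :: (real ^ 'd) set) = range (\<lambda>j. axis j 1)" by (auto simp: Basis_vec_def)
  have prod_Basis: "(\<Prod>b\<in>Basis. h b) = (\<Prod>j\<in>UNIV. h (axis j 1))" for h :: "real ^ 'd \<Rightarrow> complex"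
    unfolding Basis by (simp add: prod.reindex[OF inj] o_def)
  have cis_sum: "cis (\<Sum>j\<in>A. g j) = (\<Prod>j\<in>A. cis (g j))" if "finite A" for A and g :: "'d \<Rightarrow> real"
    using that by (induction A rule: finite_induct) (auto simp: cis_mult[symmetric])
  have "indicator (cbox (\<chi> j. - pi) (\<chi> j. pi)) \<xi> *\<^sub>R cis (pairing x \<xi>) =
      (\<Prod>b\<in>Basis. indicator {-pi..pi} (\<xi> \<bullet> b) *\<^sub>R cis (of_int (n b) * (\<xi> \<bullet> b)))" for \<xi> :: "real ^ 'd"
  proof (cases "\<xi> \<in> cbox (\<chi> j. - pi) (\<chi> j. pi)")
    case True
    then have "\<xi> $ j \<in> {-pi..pi}" for j by (auto simp: mem_box_cart)
    then show ?thesis using True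
      by (simp add: prod_Basis inner_axis n pairing_def cis_sum)
  next
    case False
    then obtain j where "\<xi> $ j \<notin> {-pi..pi}" by (auto simp: mem_box_cart)
    then have "(\<Prod>j\<in>UNIV. indicator {-pi..pi} (\<xi> $ j) *\<^sub>R cis (of_int (x $ j) * \<xi> $ j)) = 0"
      by (intro prod_zero bexI[of _ j]) auto
    then show ?thesis using False by (simp add: prod_Basis inner_axis n)
  qed
  then have "(LINT \<xi>|torus. cis (pairing x \<xi>)) =
     (LINT \<xi>|lborel. (\<Prod>b\<in>Basis. indicator {-pi..pi} (\<xi> \<bullet> b) *\<^sub>R cis (of_int (n b) * (\<xi> \<bullet> b))))"
    by (simp add: integral_torus)
  also have "\<dots> = (\<Prod>b\<in>Basis. if n b = 0 then of_real (2 * pi) else 0)"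
    by (subst integral_lborel_prod_complex) (use integral_cis_interval in auto)
  also have "\<dots> = (if x = 0 then of_real (torus_vol TYPE('d)) else 0)"
    by (auto simp: prod_Basis n vec_eq_iff intro!: prod_zero)
  finally show ?thesis .
qed

lemma measure_torus: "(LINT \<xi>|(torus :: (real ^ 'd::finite) measure). 1) = torus_vol TYPE('d)"
proof -
  have "complex_of_real (LINT \<xi>|(torus :: (real ^ 'd) measure). 1) = of_real (torus_vol TYPE('d))"
    using integral_torus_character[of "0 :: int ^ 'd"] by (simp add: pairing_def scaleR_conv_of_real flip: integral_complex_of_real)
  then show ?thesis by (simp only: of_real_eq_iff)
qed

section \<open>Trigonometric polynomials and Bessel's inequality\<close>

definition trig_poly :: "(int ^ 'd::finite \<Rightarrow> complex) \<Rightarrow> (int ^ 'd) set \<Rightarrow> real ^ 'd \<Rightarrow> complex" where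
  "trig_poly c A \<xi> = (\<Sum>x\<in>A. c x * cis (- pairing x \<xi>))"

lemma continuous_on_trig_poly [continuous_intros]: "continuous_on B (trig_poly c A)"
  unfolding trig_poly_def[abs_def] by (intro continuous_intros continuous_on_id)

lemma inverse_fourier_trig_poly:
  assumes "finite A"
  shows "inverse_fourier (trig_poly c A) x = (if x \<in> A then c x else 0)"
proof -
  have "(LINT \<xi>|torus. trig_poly c A \<xi> * cis (pairing x \<xi>)) =
     (LINT \<xi>|torus. (\<Sum>y\<in>A. c y * cis (pairing (x - y) \<xi>)))"
    by (intro Bochner_Integration.integral_cong)
      (auto simp: trig_poly_def sum_distrib_right pairing_diff mult.assoc cis_mult)
  also have "\<dots> = (\<Sum>y\<in>A. c y * (LINT \<xi>|torus. cis (pairing (x - y) \<xi>)))"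
    by (subst Bochner_Integration.integral_sum)
       (auto intro!: integrable_torus_continuous continuous_intros continuous_on_id)
  also have "\<dots> = (\<Sum>y\<in>A. if y = x then c y * of_real (torus_vol TYPE('a)) else 0)"
    by (intro sum.cong) (auto simp: integral_torus_character)
  finally show ?thesis using assms by (simp add: inverse_fourier_def)
qed

lemma integral_mult_cnj_trig_poly:
  fixes g :: "real ^ 'd::finite \<Rightarrow> complex"
  assumes "continuous_on UNIV g"
  shows "(LINT \<xi>|torus. g \<xi> * cnj (trig_poly c A \<xi>)) =
     of_real (torus_vol TYPE('d)) * (\<Sum>x\<in>A. cnj (c x) * inverse_fourier g x)"
proof -
  have "(LINT \<xi>|torus. g \<xi> * cnj (trig_poly c A \<xi>)) = (LINT \<xi>|torus. (\<Sum>x\<in>A. cnj (c x) * (g \<xi> * cis (pairing x \<xi>))))"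
    by (intro Bochner_Integration.integral_cong) (auto simp: trig_poly_def sum_distrib_left cis_cnj mult_ac)
  also have "\<dots> = (\<Sum>x\<in>A. cnj (c x) * (LINT \<xi>|torus. g \<xi> * cis (pairing x \<xi>)))"
    by (subst Bochner_Integration.integral_sum)
       (auto intro!: integrable_torus_continuous continuous_intros continuous_on_id assms)
  finally show ?thesis by (simp add: inverse_fourier_def sum_distrib_left)
qed

lemma parseval_trig_poly:
  fixes c :: "int ^ 'd::finite \<Rightarrow> complex"
  assumes "finite A"
  shows "(LINT \<xi>|torus. (norm (trig_poly c A \<xi>))\<^sup>2) = torus_vol TYPE('d) * (\<Sum>x\<in>A. (norm (c x))\<^sup>2)"
proof -
  have "complex_of_real (LINT \<xi>|torus. (norm (trig_poly c A \<xi>))\<^sup>2) = (LINT \<xi>|torus. trig_poly c A \<xi> * cnj (trig_poly c A \<xi>))"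
    by (simp add: mult_cnj_norm flip: integral_complex_of_real)
  also have "\<dots> = of_real (torus_vol TYPE('d)) * (\<Sum>x\<in>A. cnj (c x) * inverse_fourier (trig_poly c A) x)"
    by (intro integral_mult_cnj_trig_poly continuous_intros)
  also have "(\<Sum>x\<in>A. cnj (c x) * inverse_fourier (trig_poly c A) x) = of_real (\<Sum>x\<in>A. (norm (c x))\<^sup>2)"
    unfolding of_real_sum by (intro sum.cong) (auto simp: inverse_fourier_trig_poly assms mult_cnj_norm mult.commute[of "cnj _"])
  finally show ?thesis by (simp only: of_real_mult[symmetric] of_real_eq_iff)
qed

text \<open>Expansion of the integral of \<open>|g - p|^2 \<ge> 0\<close>, where \<open>p\<close> is
  the partial Fourier sum of \<open>g\<close> over \<open>A\<close>: the cross term and the square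
  of \<open>p\<close> yield the same multiple of the sum of squared coefficients.\<close>

lemma bessel_inequality:
  fixes g :: "real ^ 'd::finite \<Rightarrow> complex"
  assumes g: "continuous_on UNIV g" and A: "finite A"
  shows "torus_vol TYPE('d) * (\<Sum>x\<in>A. (norm (inverse_fourier g x))\<^sup>2) \<le> (LINT \<xi>|torus. (norm (g \<xi>))\<^sup>2)"
proof -
  let ?p = "trig_poly (inverse_fourier g) A"
  let ?S = "\<Sum>x\<in>A. (norm (inverse_fourier g x))\<^sup>2"
  have "(LINT \<xi>|torus. g \<xi> * cnj (?p \<xi>)) = of_real (torus_vol TYPE('d) * ?S)"
    by (simp add: integral_mult_cnj_trig_poly[OF g] mult_cnj_norm mult.commute[of "cnj _"])
  then have cross: "(LINT \<xi>|torus. Re (g \<xi> * cnj (?p \<xi>))) = torus_vol TYPE('d) * ?S"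
    by (subst integral_Re) (auto intro!: integrable_torus_continuous continuous_intros g simp del: of_real_mult)
  have "0 \<le> (LINT \<xi>|torus. (norm (g \<xi> - ?p \<xi>))\<^sup>2)" by simp
  also have "\<dots> = (LINT \<xi>|torus. (norm (g \<xi>))\<^sup>2 - 2 * Re (g \<xi> * cnj (?p \<xi>)) + (norm (?p \<xi>))\<^sup>2)"
    by (intro Bochner_Integration.integral_cong refl)
       (unfold cmod_power2, simp add: power2_eq_square algebra_simps)
  also have "\<dots> = (LINT \<xi>|torus. (norm (g \<xi>))\<^sup>2) - 2 * (LINT \<xi>|torus. Re (g \<xi> * cnj (?p \<xi>))) + (LINT \<xi>|torus. (norm (?p \<xi>))\<^sup>2)"
    by (subst Bochner_Integration.integral_add Bochner_Integration.integral_diff integral_mult_right_zero;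
       (intro integrable_torus_continuous continuous_intros g)?)+ simp
  also have "\<dots> = (LINT \<xi>|torus. (norm (g \<xi>))\<^sup>2) - torus_vol TYPE('d) * ?S"
    unfolding cross parseval_trig_poly[OF A] by simp
  finally show ?thesis by simp
qed


section \<open>The Fourier transform of square-summable functions\<close>

lemma summable_subset_tail:
  fixes f :: "'a \<Rightarrow> real"
  assumes f: "f summable_on UNIV" and nonneg: "\<And>x. 0 \<le> f x" and e: "0 < e"
  obtains A where "finite A" "\<And>B. finite B \<Longrightarrow> B \<inter> A = {} \<Longrightarrow> sum f B \<le> e"
proof -
  obtain S where S: "(f has_sum S) UNIV" using f by (auto simp: summable_on_def)
  then have "\<forall>\<^sub>F A in finite_subsets_at_top UNIV. dist (sum f A) S < e"
    using e unfolding has_sum_def by (rule tendstoD)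
  then obtain A where A: "finite A" "\<And>B. finite B \<Longrightarrow> A \<subseteq> B \<Longrightarrow> dist (sum f B) S < e"
    by (auto simp: eventually_finite_subsets_at_top)
  have "sum f B \<le> e" if B: "finite B" "B \<inter> A = {}" for B
  proof -
    have "sum f (A \<union> B) \<le> S"
      using S A(1) B(1) nonneg by (intro finite_sum_le_has_sum) auto
    moreover have "sum f (A \<union> B) = sum f A + sum f B" using A(1) B by (intro sum.union_disjoint) auto
    moreover have "dist (sum f A) S < e" using A by simp
    ultimately show ?thesis by (auto simp: dist_real_def)
  qed
  then show ?thesis using that A(1) by blast
qed

lemma parseval_trig_poly_diff:
  fixes c :: "int ^ 'd::finite \<Rightarrow> complex"
  assumes "finite A" "finite B"
  shows "(LINT \<xi>|torus. (norm (trig_poly c A \<xi> - trig_poly c B \<xi>))\<^sup>2) =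
     torus_vol TYPE('d) * (\<Sum>x\<in>(A - B) \<union> (B - A). (norm (c x))\<^sup>2)"
proof -
  define c' where "c' x = (if x \<in> A then c x else 0) - (if x \<in> B then c x else 0)" for x
  have "trig_poly c A \<xi> - trig_poly c B \<xi> = trig_poly c' (A \<union> B) \<xi>" for \<xi>
  proof -
    have ext: "trig_poly c D \<xi> = (\<Sum>x\<in>A \<union> B. (if x \<in> D then c x else 0) * cis (- pairing x \<xi>))" if "D \<subseteq> A \<union> B" for D
      unfolding trig_poly_def using that assms by (intro sum.mono_neutral_cong_left) auto
    show ?thesis unfolding trig_poly_def[of c'] c'_def left_diff_distrib sum_subtractf by (simp add: ext)
  qed
  then have "(LINT \<xi>|torus. (norm (trig_poly c A \<xi> - trig_poly c B \<xi>))\<^sup>2) = torus_vol TYPE('d) * (\<Sum>x\<in>A \<union> B. (norm (c' x))\<^sup>2)"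
    using assms by (simp add: parseval_trig_poly)
  also have "(\<Sum>x\<in>A \<union> B. (norm (c' x))\<^sup>2) = (\<Sum>x\<in>(A - B) \<union> (B - A). (norm (c x))\<^sup>2)"
    using assms by (intro sum.mono_neutral_cong_right) (auto simp: c'_def)
  finally show ?thesis .
qed

lemma norm_powr_2: "norm (z::complex) powr 2 = (norm z)\<^sup>2"
  by (cases "z = 0") (auto simp: powr_numeral)

lemma ell_2_iff: "\<psi> \<in> ell 2 \<longleftrightarrow> (\<lambda>x. (norm (\<psi> x))\<^sup>2) summable_on UNIV"
  by (simp add: ell_def norm_powr_2)

text \<open>Riesz-Fischer: partial sums along finite sets with tails below \<open>8 ^ - n\<close> converge almost
  everywhere, and Fatou's lemma turns this into convergence in \<open>L^2\<close>.\<close>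

lemma fourier_transform_exists:
  fixes \<psi> :: "int ^ 'd::finite \<Rightarrow> complex"
  assumes "\<psi> \<in> ell 2" shows "\<exists>f. is_fourier_transform \<psi> f"
proof -
  let ?vol = "torus_vol TYPE('d)" and ?w = "\<lambda>x. (norm (\<psi> x))\<^sup>2" and ?M = "torus :: (real ^ 'd) measure"
  have "\<exists>A. finite A \<and> (\<forall>B. finite B \<longrightarrow> B \<inter> A = {} \<longrightarrow> sum ?w B \<le> (1/8) ^ n / ?vol)" for n :: nat
    using summable_subset_tail[of ?w "(1/8) ^ n / ?vol"] assms by (metis ell_2_iff divide_pos_pos zero_less_power
      zero_le_power2 zero_less_divide_1_iff zero_less_numeral mult_pos_pos pi_gt_zero)
  then obtain A0 where A0: "\<And>n. finite (A0 n)" "\<And>n B. finite B \<Longrightarrow> B \<inter> A0 n = {} \<Longrightarrow> sum ?w B \<le> (1/8) ^ n / ?vol"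
    by metis
  \<comment> \<open>Taking unions makes the sets increase while each keeps the tail bound of its
    last member.\<close>
  define A where "A n = (\<Union>k\<le>n. A0 k)" for n
  have fin: "finite (A n)" for n using A0(1) by (simp add: A_def)
  have mono: "A m \<subseteq> A n" if "m \<le> n" for m n using that by (force simp: A_def)
  define S where "S n = trig_poly \<psi> (A n)" for n
  have meas [measurable]: "trig_poly c B \<in> borel_measurable ?M" for c B
    by (intro borel_measurable_torus_continuous continuous_intros)
  have S_meas [measurable]: "S n \<in> borel_measurable ?M" for n by (simp add: S_def)
  have dist: "(LINT \<xi>|torus. (norm (S n \<xi> - trig_poly \<psi> B \<xi>))\<^sup>2) \<le> (1/8) ^ m"
    if "m \<le> n" "A m \<subseteq> B" "finite B" for m n B
  proof -
    have "sum ?w ((A n - B) \<union> (B - A n)) \<le> (1/8) ^ m / ?vol"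
      by (rule A0(2)) (use that fin mono[OF that(1)] in \<open>auto simp: A_def\<close>)
    then show ?thesis using that(3) fin by (simp add: S_def parseval_trig_poly_diff field_simps)
  qed
  have int2: "integrable ?M (\<lambda>\<xi>. (norm (S n \<xi> - trig_poly \<psi> B \<xi>))\<^sup>2)" for n B
    unfolding S_def by (intro integrable_torus_continuous continuous_intros)
  define g where "g n \<xi> = norm (S (Suc n) \<xi> - S n \<xi>)" for n \<xi>
  have g_int: "integrable ?M (g n)" for n
    unfolding S_def g_def by (intro integrable_torus_continuous continuous_intros)
  \<comment> \<open>\<open>g \<le> 2^(-n) + 2^n g^2\<close> stands in for Cauchy-Schwarz. The tails
    \<open>8^(-n)\<close> are chosen so that the second term still integrates to at most
    \<open>2^(-n)\<close>.\<close>
  have g_le: "(LINT \<xi>|torus. g n \<xi>) \<le> (?vol + 1) * (1/2) ^ n" for n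
  proof -
    have "(LINT \<xi>|torus. g n \<xi>) \<le> (LINT \<xi>|?M. (1/2) ^ n + 2 ^ n * (g n \<xi>)\<^sup>2)"
    proof (rule integral_mono)
      show "integrable ?M (\<lambda>\<xi>. (1/2) ^ n + 2 ^ n * (g n \<xi>)\<^sup>2)"
        unfolding S_def g_def by (intro integrable_torus_continuous continuous_intros)
      fix \<xi>
      show "g n \<xi> \<le> (1/2) ^ n + 2 ^ n * (g n \<xi>)\<^sup>2"
      proof (cases "g n \<xi> \<le> (1/2) ^ n")
        case False
        then have "(1/2) ^ n * g n \<xi> \<le> g n \<xi> * g n \<xi>" by (intro mult_right_mono) (auto simp: g_def)
        then have "g n \<xi> \<le> 2 ^ n * (g n \<xi>)\<^sup>2" by (simp add: power_divide field_simps power2_eq_square)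
        then show ?thesis by (simp add: add_increasing)
      qed (simp add: add_increasing2)
    qed (rule g_int)
    also have "\<dots> = (1/2) ^ n * ?vol + 2 ^ n * (LINT \<xi>|torus. (g n \<xi>)\<^sup>2)"
    proof -
      have "(LINT \<xi>|?M. 1) = ?vol" by (rule measure_torus)
      moreover have "(LINT \<xi>|?M. (1/2::real) ^ n) = (1/2) ^ n * (LINT \<xi>|?M. 1)" by simp
      moreover have "integrable ?M (\<lambda>\<xi>. (g n \<xi>)\<^sup>2)" unfolding S_def g_def by (intro integrable_torus_continuous continuous_intros)
      moreover have "integrable ?M (\<lambda>\<xi>. (1/2::real) ^ n)" by (intro integrable_torus_continuous continuous_intros)
      ultimately show ?thesis by (simp del: Bochner_Integration.lebesgue_integral_const)
    qed
    also have "(LINT \<xi>|torus. (g n \<xi>)\<^sup>2) \<le> (1/8) ^ n"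
    proof -
      have "(LINT \<xi>|torus. (g n \<xi>)\<^sup>2) = (LINT \<xi>|torus. (norm (S n \<xi> - trig_poly \<psi> (A (Suc n)) \<xi>))\<^sup>2)"
        by (simp add: g_def S_def norm_minus_commute)
      then show ?thesis using dist[of n n "A (Suc n)"] fin mono[of n "Suc n"] by simp
    qed
    also have "(1/2) ^ n * ?vol + 2 ^ n * (1/8) ^ n \<le> (?vol + 1) * (1/2) ^ n"
    proof -
      have "(2::real) ^ n * (1/8) ^ n = (1/4) ^ n" by (simp flip: power_mult_distrib)
      also have "\<dots> \<le> (1/2) ^ n" by (intro power_mono) auto
      finally show ?thesis by (simp add: algebra_simps)
    qed
    finally show ?thesis by simp
  qed
  have gn: "0 \<le> g n \<xi>" for n \<xi> by (simp add: g_def)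
  have gi: "0 \<le> (LINT \<xi>|torus. g n \<xi>)" for n by (simp add: g_def)
  have "summable (\<lambda>n. LINT \<xi>|torus. g n \<xi>)"
  proof (rule summable_comparison_test')
    show "summable (\<lambda>n. (?vol + 1) * (1/2) ^ n)" by (intro summable_mult summable_geometric) simp
    fix n
    show "norm (LINT \<xi>|torus. g n \<xi>) \<le> (?vol + 1) * (1/2) ^ n" using g_le[of n] gi[of n] by simp
  qed
  then have fin_sum: "(\<Sum>n. ennreal (LINT \<xi>|torus. g n \<xi>)) \<noteq> \<infinity>"
    by (subst suminf_ennreal2) (use gi in auto)
  have "(\<integral>\<^sup>+\<xi>. (\<Sum>n. ennreal (g n \<xi>)) \<partial>torus) = (\<Sum>n. ennreal (LINT \<xi>|torus. g n \<xi>))"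
    using borel_measurable_integrable[OF g_int]
    by (subst nn_integral_suminf) (auto intro!: suminf_cong nn_integral_eq_integral g_int simp: gn)
  then have "AE \<xi> in torus. (\<Sum>n. ennreal (g n \<xi>)) \<noteq> \<infinity>"
    using borel_measurable_integrable[OF g_int] fin_sum by (intro nn_integral_PInf_AE) auto
  then have AE_conv: "AE \<xi> in torus. convergent (\<lambda>n. S n \<xi>)"
  proof eventually_elim
    case (elim \<xi>)
    then have "summable (\<lambda>n. g n \<xi>)" by (intro summable_suminf_not_top) (auto simp: g_def)
    then have "summable (\<lambda>n. S (Suc n) \<xi> - S n \<xi>)" unfolding g_def by (rule summable_norm_cancel)
    then have "convergent (\<lambda>n. \<Sum>k<n. S (Suc k) \<xi> - S k \<xi>)" by (simp add: summable_iff_convergent)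
    then have "convergent (\<lambda>n. S n \<xi> - S 0 \<xi>)"
      unfolding sum_lessThan_telescope[of "\<lambda>n. S n \<xi>"] .
    then show ?case by (simp add: convergent_diff_const_right_iff)
  qed
  define f where "f \<xi> = lim (\<lambda>n. S n \<xi>)" for \<xi>
  have f_meas [measurable]: "f \<in> borel_measurable ?M"
    unfolding f_def[abs_def] by (rule borel_measurable_lim_metric) simp
  have nn: "(\<integral>\<^sup>+\<xi>. ennreal ((norm (f \<xi> - trig_poly \<psi> B \<xi>))\<^sup>2) \<partial>torus) \<le> ennreal ((1/8) ^ m)"
    if B: "A m \<subseteq> B" "finite B" for m B
  proof -
    have "(\<integral>\<^sup>+\<xi>. ennreal ((norm (f \<xi> - trig_poly \<psi> B \<xi>))\<^sup>2) \<partial>torus)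
       \<le> (\<integral>\<^sup>+\<xi>. liminf (\<lambda>n. ennreal ((norm (S n \<xi> - trig_poly \<psi> B \<xi>))\<^sup>2)) \<partial>torus)"
    proof (rule nn_integral_mono_AE)
      show "AE \<xi> in torus. ennreal ((norm (f \<xi> - trig_poly \<psi> B \<xi>))\<^sup>2)
         \<le> liminf (\<lambda>n. ennreal ((norm (S n \<xi> - trig_poly \<psi> B \<xi>))\<^sup>2))"
        using AE_conv
      proof eventually_elim
        case (elim \<xi>)
        then have "(\<lambda>n. S n \<xi>) \<longlonglongrightarrow> f \<xi>" unfolding f_def by (simp add: convergent_LIMSEQ_iff)
        then have L: "(\<lambda>n. ennreal ((norm (S n \<xi> - trig_poly \<psi> B \<xi>))\<^sup>2)) \<longlonglongrightarrow> ennreal ((norm (f \<xi> - trig_poly \<psi> B \<xi>))\<^sup>2)"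
          by (intro tendsto_intros)
        show ?case unfolding lim_imp_Liminf[OF trivial_limit_sequentially L] by (rule order_refl)
      qed
    qed
    also have "\<dots> \<le> liminf (\<lambda>n. \<integral>\<^sup>+\<xi>. ennreal ((norm (S n \<xi> - trig_poly \<psi> B \<xi>))\<^sup>2) \<partial>torus)"
      by (rule nn_integral_liminf) measurable
    also have "\<dots> \<le> ennreal ((1/8) ^ m)"
    proof (rule Liminf_le)
      show "\<forall>\<^sub>F n in sequentially. (\<integral>\<^sup>+\<xi>. ennreal ((norm (S n \<xi> - trig_poly \<psi> B \<xi>))\<^sup>2) \<partial>torus) \<le> ennreal ((1/8) ^ m)"
        using eventually_ge_at_top[of m]
        by eventually_elim (subst nn_integral_eq_integral[OF int2], use dist B in \<open>auto intro: ennreal_leI\<close>)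
    qed simp
    finally show ?thesis .
  qed
  have int_f: "integrable ?M (\<lambda>\<xi>. (norm (f \<xi> - trig_poly \<psi> B \<xi>))\<^sup>2)" if "A m \<subseteq> B" "finite B" for m B
    by (rule integrableI_bounded) (use le_less_trans[OF nn[OF that]] in auto)
  have le: "(LINT \<xi>|torus. (norm (f \<xi> - trig_poly \<psi> B \<xi>))\<^sup>2) \<le> (1/8) ^ m" if "A m \<subseteq> B" "finite B" for m B
    using nn[OF that] int_f[OF that] by (subst (asm) nn_integral_eq_integral) auto
  have "integrable ?M (\<lambda>\<xi>. (norm (f \<xi>))\<^sup>2)"
  proof (rule Bochner_Integration.integrable_bound)
    show "integrable ?M (\<lambda>\<xi>. 2 * (norm (f \<xi> - S 0 \<xi>))\<^sup>2 + 2 * (norm (S 0 \<xi>))\<^sup>2)"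
    proof (intro Bochner_Integration.integrable_add integrable_mult_right)
      show "integrable ?M (\<lambda>\<xi>. (norm (f \<xi> - S 0 \<xi>))\<^sup>2)" using int_f[of 0 "A 0"] fin by (simp add: S_def)
      show "integrable ?M (\<lambda>\<xi>. (norm (S 0 \<xi>))\<^sup>2)" unfolding S_def by (intro integrable_torus_continuous continuous_intros)
    qed
    have "(norm (f \<xi>))\<^sup>2 \<le> 2 * (norm (f \<xi> - S 0 \<xi>))\<^sup>2 + 2 * (norm (S 0 \<xi>))\<^sup>2" for \<xi>
    proof -
      have "(norm (f \<xi>))\<^sup>2 \<le> (norm (f \<xi> - S 0 \<xi>) + norm (S 0 \<xi>))\<^sup>2"
        using norm_triangle_ineq[of "f \<xi> - S 0 \<xi>" "S 0 \<xi>"] by (intro power_mono) auto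
      also have "\<dots> \<le> 2 * (norm (f \<xi> - S 0 \<xi>))\<^sup>2 + 2 * (norm (S 0 \<xi>))\<^sup>2"
        using zero_le_power2[of "norm (f \<xi> - S 0 \<xi>) - norm (S 0 \<xi>)"]
        by (simp add: power2_sum power2_diff)
      finally show ?thesis .
    qed
    then show "AE \<xi> in torus. norm ((norm (f \<xi>))\<^sup>2) \<le> norm (2 * (norm (f \<xi> - S 0 \<xi>))\<^sup>2 + 2 * (norm (S 0 \<xi>))\<^sup>2)"
      by simp
  qed measurable
  then have "square_integrable f" by (simp add: square_integrable_def)
  moreover have "((\<lambda>B. LINT \<xi>|torus. (norm (f \<xi> - (\<Sum>x\<in>B. \<psi> x * cis (- pairing x \<xi>))))\<^sup>2) \<longlongrightarrow> 0) (finite_subsets_at_top UNIV)"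
  proof (rule tendstoI)
    fix e :: real assume "0 < e"
    then obtain m where m: "(1/8) ^ m < e" using real_arch_pow_inv[of e "1/8"] by auto
    have "dist (LINT \<xi>|torus. (norm (f \<xi> - trig_poly \<psi> B \<xi>))\<^sup>2) 0 < e" if "finite B" "A m \<subseteq> B" for B
      using le[OF that(2,1)] m by (simp add: dist_real_def)
    then show "\<forall>\<^sub>F B in finite_subsets_at_top UNIV. dist (LINT \<xi>|torus. (norm (f \<xi> - (\<Sum>x\<in>B. \<psi> x * cis (- pairing x \<xi>))))\<^sup>2) 0 < e"
      using fin by (auto simp: eventually_finite_subsets_at_top trig_poly_def)
  qed
  ultimately show ?thesis unfolding is_fourier_transform_def by blast
qed

lemma integrable_torus_square_integrable:
  assumes "square_integrable f" shows "integrable torus f"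
proof (rule Bochner_Integration.integrable_bound)
  have sq: "integrable torus (\<lambda>\<xi>. (norm (f \<xi>))\<^sup>2)" using assms by (simp add: square_integrable_def)
  show "integrable torus (\<lambda>\<xi>. 1 + (norm (f \<xi>))\<^sup>2)"
    by (intro Bochner_Integration.integrable_add sq) (intro integrable_torus_continuous continuous_intros)
  show "f \<in> borel_measurable torus" using assms by (simp add: square_integrable_def)
  have "norm (f \<xi>) \<le> 1 + (norm (f \<xi>))\<^sup>2" for \<xi>
    using zero_le_power2[of "norm (f \<xi>) - 1 / 2"] by (simp add: power2_diff power2_eq_square algebra_simps)
  then show "AE \<xi> in torus. norm (f \<xi>) \<le> norm (1 + (norm (f \<xi>))\<^sup>2)" by simp
qed

lemma integrable_bounded_mult_torus:
  fixes f h :: "real ^ 'd::finite \<Rightarrow> complex"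
  assumes "integrable torus f" "continuous_on UNIV h" "\<And>\<xi>. norm (h \<xi>) \<le> K"
  shows "integrable torus (\<lambda>\<xi>. h \<xi> * f \<xi>)"
proof (rule Bochner_Integration.integrable_bound)
  show "integrable torus (\<lambda>\<xi>. K * norm (f \<xi>))" using assms by (intro integrable_mult_right integrable_norm)
  show "(\<lambda>\<xi>. h \<xi> * f \<xi>) \<in> borel_measurable torus"
    using borel_measurable_integrable[OF assms(1)] borel_measurable_torus_continuous[OF assms(2)] by measurable
  have "norm (h \<xi> * f \<xi>) \<le> norm (K * norm (f \<xi>))" for \<xi>
    using mult_right_mono[OF assms(3)[of \<xi>] norm_ge_zero[of "f \<xi>"]] by (simp add: norm_mult)
  then show "AE \<xi> in torus. norm (h \<xi> * f \<xi>) \<le> norm (K * norm (f \<xi>))" by simp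
qed

lemma inverse_fourier_diff:
  fixes f g :: "real ^ 'd::finite \<Rightarrow> complex"
  assumes "integrable torus f" "integrable torus g"
  shows "inverse_fourier (\<lambda>\<xi>. f \<xi> - g \<xi>) x = inverse_fourier f x - inverse_fourier g x"
proof -
  have "integrable torus (\<lambda>\<xi>. h \<xi> * cis (pairing x \<xi>))" if "integrable torus h" for h
    using integrable_bounded_mult_torus[OF that, of "\<lambda>\<xi>. cis (pairing x \<xi>)" 1]
    by (simp add: mult.commute continuous_intros)
  then show ?thesis using assms
    by (simp add: inverse_fourier_def left_diff_distrib diff_divide_distrib)
qed

lemma norm_inverse_fourier_le:
  fixes f :: "real ^ 'd::finite \<Rightarrow> complex"
  assumes "integrable torus f"
  shows "norm (inverse_fourier f x) \<le> (LINT \<xi>|torus. norm (f \<xi>)) / torus_vol TYPE('d)"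
proof -
  have "norm (LINT \<xi>|torus. f \<xi> * cis (pairing x \<xi>)) \<le> (LINT \<xi>|torus. norm (f \<xi> * cis (pairing x \<xi>)))"
    by (rule integral_norm_bound)
  then show ?thesis by (simp add: inverse_fourier_def norm_divide norm_mult norm_power divide_right_mono)
qed

text \<open>A finite partial sum over a set containing \<open>x\<close> has \<open>x\<close>-th
  coefficient exactly \<open>\<psi> x\<close>, and the inverse transform of the error is bounded by
  its \<open>L^1\<close> norm. The argument rests on the defining \<open>L^2\<close> convergence, so
  it holds for whichever representative the choice operator picks.\<close>

lemma fourier_inversion:
  fixes \<psi> :: "int ^ 'd::finite \<Rightarrow> complex"
  assumes "\<psi> \<in> ell 2"
  shows "integrable torus (fourier \<psi>)" "inverse_fourier (fourier \<psi>) x = \<psi> x"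
proof -
  let ?f = "fourier \<psi>" and ?vol = "torus_vol TYPE('d)"
  have ft: "is_fourier_transform \<psi> ?f"
    unfolding fourier_def by (rule someI_ex[OF fourier_transform_exists[OF assms]])
  then have sq: "square_integrable ?f" by (simp add: is_fourier_transform_def)
  have sq2: "integrable torus (\<lambda>\<xi>. (norm (?f \<xi>))\<^sup>2)" using sq by (simp add: square_integrable_def)
  show int: "integrable torus ?f" by (rule integrable_torus_square_integrable[OF sq])
  have lim: "((\<lambda>A. LINT \<xi>|torus. (norm (?f \<xi> - trig_poly \<psi> A \<xi>))\<^sup>2) \<longlongrightarrow> 0) (finite_subsets_at_top UNIV)"
    using ft by (simp add: is_fourier_transform_def trig_poly_def)
  have "norm (inverse_fourier ?f x - \<psi> x) \<le> 0 + e * (1 + 1 / ?vol)" if e: "e > 0" for e :: real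
  proof -
    have "\<forall>\<^sub>F A in finite_subsets_at_top UNIV. (LINT \<xi>|torus. (norm (?f \<xi> - trig_poly \<psi> A \<xi>))\<^sup>2) < e\<^sup>2"
      using order_tendstoD(2)[OF lim, of "e\<^sup>2"] e by simp
    then obtain A0 where A0: "finite A0" "\<And>A. finite A \<Longrightarrow> A0 \<subseteq> A \<Longrightarrow>
        (LINT \<xi>|torus. (norm (?f \<xi> - trig_poly \<psi> A \<xi>))\<^sup>2) < e\<^sup>2"
      by (auto simp: eventually_finite_subsets_at_top)
    define A where "A = insert x A0"
    have A: "finite A" "x \<in> A" "(LINT \<xi>|torus. (norm (?f \<xi> - trig_poly \<psi> A \<xi>))\<^sup>2) < e\<^sup>2"
      using A0(1) A0(2)[of A] by (auto simp: A_def)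
    have int_tp: "integrable torus (trig_poly \<psi> A)" by (intro integrable_torus_continuous continuous_intros)
    have sq_diff: "integrable torus (\<lambda>\<xi>. (norm (?f \<xi> - trig_poly \<psi> A \<xi>))\<^sup>2)"
    proof (rule Bochner_Integration.integrable_bound)
      show "integrable torus (\<lambda>\<xi>. 2 * (norm (?f \<xi>))\<^sup>2 + 2 * (norm (trig_poly \<psi> A \<xi>))\<^sup>2)"
        by (intro Bochner_Integration.integrable_add integrable_mult_right sq2)
          (intro integrable_torus_continuous continuous_intros)
      show "(\<lambda>\<xi>. (norm (?f \<xi> - trig_poly \<psi> A \<xi>))\<^sup>2) \<in> borel_measurable torus"
        using borel_measurable_integrable[OF int] borel_measurable_integrable[OF int_tp] by measurable
      have "(norm (u - v))\<^sup>2 \<le> 2 * (norm u)\<^sup>2 + 2 * (norm v)\<^sup>2" for u v :: complex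
      proof -
        have "(norm (u - v))\<^sup>2 \<le> (norm u + norm v)\<^sup>2" by (intro power_mono norm_triangle_ineq4) auto
        also have "\<dots> \<le> 2 * (norm u)\<^sup>2 + 2 * (norm v)\<^sup>2"
          using zero_le_power2[of "norm u - norm v"] by (simp add: power2_sum power2_diff)
        finally show ?thesis .
      qed
      then show "AE \<xi> in torus. norm ((norm (?f \<xi> - trig_poly \<psi> A \<xi>))\<^sup>2) \<le> norm (2 * (norm (?f \<xi>))\<^sup>2 + 2 * (norm (trig_poly \<psi> A \<xi>))\<^sup>2)"
        by simp
    qed
    have "inverse_fourier ?f x - \<psi> x = inverse_fourier (\<lambda>\<xi>. ?f \<xi> - trig_poly \<psi> A \<xi>) x"
      using A by (simp add: inverse_fourier_diff[OF int int_tp] inverse_fourier_trig_poly)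
    also have "norm \<dots> \<le> (LINT \<xi>|torus. norm (?f \<xi> - trig_poly \<psi> A \<xi>)) / ?vol"
      by (intro norm_inverse_fourier_le Bochner_Integration.integrable_diff int int_tp)
    \<comment> \<open>On a space of finite measure \<open>u \<le> e + u^2 / e\<close> bounds the
      \<open>L^1\<close> norm by the \<open>L^2\<close> norm; with squared \<open>L^2\<close> norm
      below \<open>e^2\<close> the total is \<open>O(e)\<close>.\<close>
    also have "\<dots> \<le> (LINT \<xi>|(torus :: (real ^ 'd) measure). e * 1 + (1 / e) * (norm (?f \<xi> - trig_poly \<psi> A \<xi>))\<^sup>2) / ?vol"
    proof (intro divide_right_mono integral_mono)
      fix \<xi>
      let ?u = "norm (?f \<xi> - trig_poly \<psi> A \<xi>)"
      have "?u \<le> e * 1 + (1 / e) * ?u\<^sup>2"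
      proof (cases "?u \<le> e")
        case True
        then show ?thesis using e by (simp add: add_increasing2)
      next
        case False
        then have "e * ?u \<le> ?u * ?u" by (intro mult_right_mono) auto
        then have "?u \<le> (1 / e) * ?u\<^sup>2" using e by (simp add: field_simps power2_eq_square)
        then show ?thesis using e by linarith
      qed
      then show "norm (?f \<xi> - trig_poly \<psi> A \<xi>) \<le> e * 1 + (1 / e) * (norm (?f \<xi> - trig_poly \<psi> A \<xi>))\<^sup>2" .
    next
      show "integrable torus (\<lambda>\<xi>. norm (?f \<xi> - trig_poly \<psi> A \<xi>))"
        by (intro integrable_norm Bochner_Integration.integrable_diff int int_tp)
      show "integrable torus (\<lambda>\<xi> :: real ^ 'd. e * 1 + (1 / e) * (norm (?f \<xi> - trig_poly \<psi> A \<xi>))\<^sup>2)"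
        by (rule Bochner_Integration.integrable_add[OF _ integrable_mult_right[OF sq_diff]])
          (intro integrable_torus_continuous continuous_intros)
    qed simp
    also have "(LINT \<xi>|(torus :: (real ^ 'd) measure). e * 1 + (1 / e) * (norm (?f \<xi> - trig_poly \<psi> A \<xi>))\<^sup>2)
       = e * ?vol + (1 / e) * (LINT \<xi>|torus. (norm (?f \<xi> - trig_poly \<psi> A \<xi>))\<^sup>2)"
    proof -
      have c: "integrable torus (\<lambda>\<xi>::real ^ 'd. e * 1)" by (intro integrable_torus_continuous continuous_intros)
      show ?thesis
        unfolding Bochner_Integration.integral_add[OF c integrable_mult_right[OF sq_diff]]
          integral_mult_right_zero measure_torus ..
    qed
    also have "(e * ?vol + (1 / e) * (LINT \<xi>|torus. (norm (?f \<xi> - trig_poly \<psi> A \<xi>))\<^sup>2)) / ?vol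
       \<le> (e * ?vol + (1 / e) * e\<^sup>2) / ?vol"
      using A(3) e by (intro divide_right_mono add_left_mono mult_left_mono) auto
    also have "\<dots> = 0 + e * (1 + 1 / ?vol)" using e by (simp add: field_simps power2_eq_square)
    finally show ?thesis .
  qed
  then have bd: "norm (inverse_fourier ?f x - \<psi> x) \<le> 0 + e" if "e > 0" for e :: real
  proof -
    have "0 < 1 + 1 / ?vol" by (intro add_pos_nonneg) auto
    then show ?thesis using \<open>\<And>e. e > 0 \<Longrightarrow> norm (inverse_fourier ?f x - \<psi> x) \<le> 0 + e * (1 + 1 / ?vol)\<close>[of "e / (1 + 1 / ?vol)"] that
      by simp
  qed
  have "norm (inverse_fourier ?f x - \<psi> x) \<le> 0" by (rule field_le_epsilon) (rule bd)
  then show "inverse_fourier ?f x = \<psi> x" by simp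
qed

section \<open>Series in the adjacency operator as Fourier multipliers\<close>

definition nbr_symbol :: "real ^ 'd::finite \<Rightarrow> real" where
  "nbr_symbol \<xi> = (\<Sum>j\<in>UNIV. 2 * cos (\<xi> $ j))"

lemma continuous_on_nbr_symbol [continuous_intros]: "continuous_on A nbr_symbol"
  unfolding nbr_symbol_def[abs_def] by (intro continuous_intros)

lemma abs_nbr_symbol_le: "\<bar>nbr_symbol (\<xi> :: real ^ 'd::finite)\<bar> \<le> 2 * real CARD('d)"
proof -
  have "\<bar>nbr_symbol \<xi>\<bar> \<le> (\<Sum>j\<in>(UNIV :: 'd set). 2)"
    unfolding nbr_symbol_def by (intro order_trans[OF sum_abs] sum_mono) (auto simp: abs_mult)
  then show ?thesis by simp
qed

lemma integrable_nbr_symbol_power: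
  fixes f :: "real ^ 'd::finite \<Rightarrow> complex"
  assumes "integrable torus f"
  shows "integrable torus (\<lambda>\<xi>. of_real (nbr_symbol \<xi>) ^ n * f \<xi>)"
proof (rule integrable_bounded_mult_torus[OF assms, of _ "(2 * real CARD('d)) ^ n"])
  show "norm (complex_of_real (nbr_symbol \<xi>) ^ n) \<le> (2 * real CARD('d)) ^ n" for \<xi> :: "real ^ 'd"
    unfolding norm_power norm_of_real by (intro power_mono abs_nbr_symbol_le) auto
qed (intro continuous_intros)

lemma inverse_fourier_nbr_symbol:
  fixes f :: "real ^ 'd::finite \<Rightarrow> complex"
  assumes "integrable torus f"
  shows "inverse_fourier (\<lambda>\<xi>. of_real (nbr_symbol \<xi>) * f \<xi>) x = nbr_sum (inverse_fourier f) x"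
proof -
  have int: "integrable torus (\<lambda>\<xi>. f \<xi> * cis (pairing y \<xi>))" for y
    using integrable_bounded_mult_torus[OF assms, of "\<lambda>\<xi>. cis (pairing y \<xi>)" 1]
    by (simp add: mult.commute continuous_intros)
  have c2: "of_real (2 * cos s) = cis s + cis (- s)" for s by (simp add: complex_eq_iff)
  have "(LINT \<xi>|torus. of_real (nbr_symbol \<xi>) * f \<xi> * cis (pairing x \<xi>)) =
    (LINT \<xi>|torus. (\<Sum>j\<in>UNIV. f \<xi> * cis (pairing (x + axis j 1) \<xi>) + f \<xi> * cis (pairing (x - axis j 1) \<xi>)))"
  proof (intro Bochner_Integration.integral_cong refl)
    fix \<xi>
    have "of_real (nbr_symbol \<xi>) * f \<xi> * cis (pairing x \<xi>) = (\<Sum>j\<in>UNIV. of_real (2 * cos (\<xi> $ j)) * (f \<xi> * cis (pairing x \<xi>)))"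
      unfolding nbr_symbol_def of_real_sum sum_distrib_right by (simp only: mult.assoc)
    also have "\<dots> = (\<Sum>j\<in>UNIV. f \<xi> * cis (pairing (x + axis j 1) \<xi>) + f \<xi> * cis (pairing (x - axis j 1) \<xi>))"
    proof (intro sum.cong refl)
      fix j
      have "cis (pairing (x + axis j 1) \<xi>) = cis (pairing x \<xi>) * cis (\<xi> $ j)"
        "cis (pairing (x - axis j 1) \<xi>) = cis (pairing x \<xi>) * cis (- (\<xi> $ j))"
        by (simp_all add: pairing_add pairing_diff pairing_axis cis_mult)
      then show "of_real (2 * cos (\<xi> $ j)) * (f \<xi> * cis (pairing x \<xi>)) =
         f \<xi> * cis (pairing (x + axis j 1) \<xi>) + f \<xi> * cis (pairing (x - axis j 1) \<xi>)"
        unfolding c2 by (simp add: algebra_simps)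
    qed
    finally show "of_real (nbr_symbol \<xi>) * f \<xi> * cis (pairing x \<xi>) = \<dots>" .
  qed
  also have "\<dots> = (\<Sum>j\<in>UNIV. (LINT \<xi>|torus. f \<xi> * cis (pairing (x + axis j 1) \<xi>)) + (LINT \<xi>|torus. f \<xi> * cis (pairing (x - axis j 1) \<xi>)))"
    by (simp add: int)
  finally show ?thesis by (simp add: inverse_fourier_def nbr_sum_def sum_divide_distrib add_divide_distrib)
qed

lemma inverse_fourier_nbr_symbol_power:
  fixes f :: "real ^ 'd::finite \<Rightarrow> complex"
  assumes "integrable torus f"
  shows "inverse_fourier (\<lambda>\<xi>. of_real (nbr_symbol \<xi>) ^ n * f \<xi>) = (nbr_sum ^^ n) (inverse_fourier f)"
proof (induction n)
  case (Suc n)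
  have "inverse_fourier (\<lambda>\<xi>. of_real (nbr_symbol \<xi>) ^ Suc n * f \<xi>) x =
    nbr_sum (inverse_fourier (\<lambda>\<xi>. of_real (nbr_symbol \<xi>) ^ n * f \<xi>)) x" for x
    using inverse_fourier_nbr_symbol[OF integrable_nbr_symbol_power[OF assms, of n], of x] by (simp add: mult.assoc)
  then show ?case unfolding Suc by (simp add: fun_eq_iff)
qed simp

lemma norm_power_series_term:
  assumes "\<bar>s\<bar> \<le> R" shows "norm (a n * complex_of_real s ^ n) \<le> norm (a n) * R ^ n"
  using assms by (auto simp: norm_mult norm_power intro!: mult_left_mono power_mono)

text \<open>Term by term this is \<open>inverse_fourier_nbr_symbol_power\<close>; sum and integral
  are exchanged by absolute convergence, as \<open>|nbr_symbol| \<le> 2 d\<close>. It turns the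
  multiplier that defines \<open>sqrt (1 - \<Delta>)\<close> into a series in
  \<open>N\<close>.\<close>

lemma inverse_fourier_power_series:
  fixes f :: "real ^ 'd::finite \<Rightarrow> complex"
  assumes f: "integrable torus f" and a: "coeff_summable (2 * real CARD('d)) a"
  shows "inverse_fourier (\<lambda>\<xi>. (\<Sum>n. a n * of_real (nbr_symbol \<xi>) ^ n) * f \<xi>) x = nbr_series a (inverse_fourier f) x"
proof -
  let ?R = "2 * real CARD('d)"
  let ?F = "\<lambda>n \<xi>. a n * (of_real (nbr_symbol \<xi>) ^ n * f \<xi> * cis (pairing x \<xi>))"
  have int1: "integrable torus (\<lambda>\<xi>. of_real (nbr_symbol \<xi>) ^ n * f \<xi> * cis (pairing x \<xi>))" for n
    using integrable_bounded_mult_torus[OF integrable_nbr_symbol_power[OF f, of n], of "\<lambda>\<xi>. cis (pairing x \<xi>)" 1]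
    by (simp add: mult.commute continuous_intros)
  have int: "integrable torus (?F n)" for n by (intro integrable_mult_right int1)
  have F_le: "norm (?F n \<xi>) \<le> norm (a n) * ?R ^ n * norm (f \<xi>)" for n \<xi>
    using mult_right_mono[OF norm_power_series_term[OF abs_nbr_symbol_le[of \<xi>], of a n] norm_ge_zero[of "f \<xi>"]]
    by (simp add: norm_mult mult.assoc)
  have sum_a: "summable (\<lambda>n. norm (a n) * ?R ^ n)" using a by (simp add: coeff_summable_def)
  have sum_F: "summable (\<lambda>n. norm (?F n \<xi>))" for \<xi>
    by (rule summable_comparison_test'[OF summable_mult2[OF sum_a, of "norm (f \<xi>)"]]) (use F_le in simp)
  have sum_int: "summable (\<lambda>n. LINT \<xi>|torus. norm (?F n \<xi>))"
  proof (rule summable_comparison_test'[OF summable_mult2[OF sum_a, of "LINT \<xi>|torus. norm (f \<xi>)"]])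
    fix n
    have "(LINT \<xi>|torus. norm (?F n \<xi>)) \<le> (LINT \<xi>|torus. norm (a n) * ?R ^ n * norm (f \<xi>))"
      by (intro integral_mono integrable_norm int integrable_mult_right f F_le)
    then show "norm (LINT \<xi>|torus. norm (?F n \<xi>)) \<le> norm (a n) * ?R ^ n * (LINT \<xi>|torus. norm (f \<xi>))"
      by simp
  qed
  have "(LINT \<xi>|torus. (\<Sum>n. a n * of_real (nbr_symbol \<xi>) ^ n) * f \<xi> * cis (pairing x \<xi>)) = (LINT \<xi>|torus. (\<Sum>n. ?F n \<xi>))"
  proof (intro Bochner_Integration.integral_cong refl)
    fix \<xi> :: "real ^ 'd"
    have "summable (\<lambda>n. a n * of_real (nbr_symbol \<xi>) ^ n)"
      by (rule summable_comparison_test'[OF sum_a]) (rule norm_power_series_term[OF abs_nbr_symbol_le])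
    from suminf_mult2[OF this, of "f \<xi> * cis (pairing x \<xi>)"]
    show "(\<Sum>n. a n * of_real (nbr_symbol \<xi>) ^ n) * f \<xi> * cis (pairing x \<xi>) = (\<Sum>n. ?F n \<xi>)"
      by (simp add: mult.assoc)
  qed
  also have "\<dots> = (\<Sum>n. LINT \<xi>|torus. ?F n \<xi>)"
    by (rule integral_suminf[OF int _ sum_int]) (use sum_F in simp)
  also have "\<dots> = (\<Sum>n. of_real (torus_vol TYPE('d)) * (a n * (nbr_sum ^^ n) (inverse_fourier f) x))"
  proof (intro suminf_cong)
    fix n
    have "inverse_fourier (\<lambda>\<xi>. of_real (nbr_symbol \<xi>) ^ n * f \<xi>) x = (nbr_sum ^^ n) (inverse_fourier f) x"
      by (simp add: inverse_fourier_nbr_symbol_power[OF f])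
    then show "(LINT \<xi>|torus. ?F n \<xi>) = of_real (torus_vol TYPE('d)) * (a n * (nbr_sum ^^ n) (inverse_fourier f) x)"
      by (simp add: inverse_fourier_def field_simps)
  qed
  also have "\<dots> = of_real (torus_vol TYPE('d)) * nbr_series a (inverse_fourier f) x"
    unfolding nbr_series_def
    by (intro suminf_mult summable_norm_cancel[OF nbr_series_norm_summable[OF a norm_inverse_fourier_le[OF f]]])
  finally show ?thesis by (simp add: inverse_fourier_def)
qed

text \<open>On finitely supported functions the \<open>l^2\<close> bound is governed by the size of
  the multiplier on the spectral interval \<open>[-2 d, 2 d]\<close>. The transform is a
  trigonometric polynomial times a continuous function, so Bessel's inequality and Parseval for
  polynomials suffice.\<close>

lemma nbr_series_l2_bound:
  fixes c :: "int ^ 'd::finite \<Rightarrow> complex"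
  assumes a: "coeff_summable (2 * real CARD('d)) a"
    and K: "\<And>s. \<bar>s\<bar> \<le> 2 * real CARD('d) \<Longrightarrow> norm (\<Sum>n. a n * of_real s ^ n) \<le> K"
    and A: "finite A" and X: "finite X"
  shows "(\<Sum>x\<in>X. (norm (nbr_series a (\<lambda>x. if x \<in> A then c x else 0) x))\<^sup>2) \<le> K\<^sup>2 * (\<Sum>x\<in>A. (norm (c x))\<^sup>2)"
proof -
  let ?R = "2 * real CARD('d)" and ?vol = "torus_vol TYPE('d)"
  let ?m = "\<lambda>\<xi> :: real ^ 'd. \<Sum>n. a n * of_real (nbr_symbol \<xi>) ^ n"
  let ?g = "\<lambda>\<xi>. ?m \<xi> * trig_poly c A \<xi>"
  have cont_m: "continuous_on UNIV ?m"
  proof (rule uniform_limit_theorem)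
    show "uniform_limit UNIV (\<lambda>n \<xi>. \<Sum>i<n. a i * of_real (nbr_symbol \<xi>) ^ i) ?m sequentially"
    proof (rule Weierstrass_m_test)
      show "summable (\<lambda>n. norm (a n) * ?R ^ n)" using a by (simp add: coeff_summable_def)
      show "norm (a n * of_real (nbr_symbol \<xi>) ^ n) \<le> norm (a n) * ?R ^ n" for n and \<xi> :: "real ^ 'd"
        by (rule norm_power_series_term[OF abs_nbr_symbol_le])
    qed
  qed (auto intro!: always_eventually continuous_intros)
  have cont: "continuous_on UNIV ?g" by (intro continuous_intros cont_m)
  have int_tp: "integrable torus (trig_poly c A)" by (intro integrable_torus_continuous continuous_intros)
  have inv: "inverse_fourier (trig_poly c A) = (\<lambda>x. if x \<in> A then c x else 0)"
    by (simp add: fun_eq_iff inverse_fourier_trig_poly A)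
  have eq: "nbr_series a (\<lambda>x. if x \<in> A then c x else 0) x = inverse_fourier ?g x" for x
    unfolding inverse_fourier_power_series[OF int_tp a] inv ..
  have "?vol * (\<Sum>x\<in>X. (norm (inverse_fourier ?g x))\<^sup>2) \<le> (LINT \<xi>|torus. (norm (?g \<xi>))\<^sup>2)"
    by (rule bessel_inequality[OF cont X])
  also have "\<dots> \<le> (LINT \<xi>|torus. K\<^sup>2 * (norm (trig_poly c A \<xi>))\<^sup>2)"
  proof (intro integral_mono)
    show "integrable torus (\<lambda>\<xi>. (norm (?g \<xi>))\<^sup>2)"
      by (intro integrable_torus_continuous continuous_intros cont)
    show "integrable torus (\<lambda>\<xi>. K\<^sup>2 * (norm (trig_poly c A \<xi>))\<^sup>2)"
      by (intro integrable_torus_continuous continuous_intros)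
    show "(norm (?g \<xi>))\<^sup>2 \<le> K\<^sup>2 * (norm (trig_poly c A \<xi>))\<^sup>2" for \<xi>
      unfolding norm_mult power_mult_distrib
      by (intro mult_right_mono power_mono K abs_nbr_symbol_le) auto
  qed
  also have "\<dots> = ?vol * (K\<^sup>2 * (\<Sum>x\<in>A. (norm (c x))\<^sup>2))"
    by (simp add: parseval_trig_poly[OF A])
  finally show ?thesis unfolding eq by (rule mult_left_le_imp_le) simp
qed

text \<open>Taylor coefficients of \<open>sqrt (1 + R - s)\<close> in \<open>s\<close>.\<close>

definition sqrt_coeff :: "real \<Rightarrow> nat \<Rightarrow> complex" where
  "sqrt_coeff R n = of_real ((1/2 gchoose n) * (1 + R) powr (1/2 - real n) * (-1) ^ n)"

text \<open>The series has radius of convergence \<open>1 + R\<close>: it converges at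
  \<open>R + 1/2\<close> and therefore absolutely at \<open>R\<close>. The mass term
  \<open>1\<close> in \<open>1 - \<Delta>\<close> provides this room.\<close>

lemma coeff_summable_sqrt_coeff:
  assumes "0 \<le> R" shows "coeff_summable R (sqrt_coeff R)"
proof -
  have "summable (\<lambda>n. ((1/2) gchoose n) * (1 + R) powr (1/2 - real n) * (R + 1/2) ^ n)"
    using sqrt_series'[of "R + 1/2" "1 + R"] assms by (auto simp: sums_iff)
  then have "summable (\<lambda>n. norm (((1/2) gchoose n) * (1 + R) powr (1/2 - real n) * R ^ n))"
    by (rule powser_insidea) (use assms in auto)
  then show ?thesis
    unfolding coeff_summable_def sqrt_coeff_def using assms by (simp add: norm_mult norm_power abs_mult)
qed

lemma sqrt_coeff_sums:
  assumes "\<bar>s\<bar> \<le> R" shows "(\<lambda>n. sqrt_coeff R n * of_real s ^ n) sums of_real (sqrt (1 + R - s))"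
proof -
  have "(\<lambda>n. ((1/2) gchoose n) * (1 + R) powr (1/2 - real n) * (- s) ^ n) sums sqrt (1 + R + - s)"
    using assms by (intro sqrt_series') auto
  then have "(\<lambda>n. complex_of_real (((1/2) gchoose n) * (1 + R) powr (1/2 - real n) * (- s) ^ n)) sums of_real (sqrt (1 + R + - s))"
    by (rule sums_of_real)
  moreover have "(- s) ^ n = (-1) ^ n * s ^ n" for n by (simp flip: power_mult_distrib)
  ultimately show ?thesis by (simp add: sqrt_coeff_def mult.assoc)
qed

text \<open>Vandermonde's convolution for \<open>1/2 + 1/2 = 1\<close>: the square of the series is
  \<open>1 + R - s\<close>. In operator terms, applying \<open>sqrt (1 - \<Delta>)\<close> twice
  gives \<open>1 + 2 d - N\<close>.\<close>

lemma sqrt_coeff_conv: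
  assumes "0 \<le> R"
  shows "coeff_conv (sqrt_coeff R) (sqrt_coeff R) k = (if k = 0 then of_real (1 + R) else if k = 1 then - 1 else 0)"
proof -
  have "coeff_conv (sqrt_coeff R) (sqrt_coeff R) k =
     of_real (\<Sum>i\<le>k. ((1/2 gchoose i) * (1/2 gchoose (k - i))) * ((1 + R) powr (1 - real k) * (-1) ^ k))"
    unfolding coeff_conv_def sqrt_coeff_def of_real_sum
  proof (intro sum.cong refl)
    fix i assume "i \<in> {..k}"
    then have i: "i \<le> k" by simp
    have "(1 + R) powr (1/2 - real i) * (1 + R) powr (1/2 - real (k - i)) = (1 + R) powr (1 - real k)"
      using i by (simp flip: powr_add)
    moreover have "(-1::real) ^ i * (-1) ^ (k - i) = (-1) ^ k" using i by (simp flip: power_add)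
    moreover have "(g * p * u) * (g' * p' * u') = (g * g') * ((p * p') * (u * u'))" for g p u g' p' u' :: real
      by (simp only: mult_ac)
    ultimately have "((1/2 gchoose i) * (1 + R) powr (1/2 - real i) * (-1) ^ i) * ((1/2 gchoose (k - i)) * (1 + R) powr (1/2 - real (k - i)) * (-1) ^ (k - i))
      = ((1/2 gchoose i) * (1/2 gchoose (k - i))) * ((1 + R) powr (1 - real k) * (-1) ^ k)"
      by (simp only:)
    then show "complex_of_real ((1/2 gchoose i) * (1 + R) powr (1/2 - real i) * (-1) ^ i) * complex_of_real ((1/2 gchoose (k - i)) * (1 + R) powr (1/2 - real (k - i)) * (-1) ^ (k - i))
      = complex_of_real (((1/2 gchoose i) * (1/2 gchoose (k - i))) * ((1 + R) powr (1 - real k) * (-1) ^ k))"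
      by (simp only: of_real_mult[symmetric])
  qed
  also have "(\<Sum>i\<le>k. ((1/2 gchoose i) * (1/2 gchoose (k - i))) * ((1 + R) powr (1 - real k) * (-1) ^ k)) =
     (1 gchoose k) * ((1 + R) powr (1 - real k) * (-1) ^ k)"
    unfolding sum_distrib_right[symmetric] using gbinomial_Vandermonde[of "1/2::real" "1/2" k]
    by (simp add: atLeast0AtMost)
  also have "(1::real) gchoose k = of_nat (1 choose k)" by (simp add: binomial_gbinomial)
  also have "of_nat (1 choose k) * ((1 + R) powr (1 - real k) * (-1) ^ k) =
      (if k = 0 then 1 + R else if k = 1 then - 1 else 0)"
    using assms by (auto simp: binomial_eq_0)
  finally show ?thesis by auto
qed

lemma sqrt_one_minus_laplacian_eq_nbr_series:
  fixes \<psi> :: "int ^ 'd::finite \<Rightarrow> complex"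
  assumes "\<psi> \<in> ell 2"
  shows "sqrt_one_minus_laplacian \<psi> x = nbr_series (sqrt_coeff (2 * real CARD('d))) \<psi> x"
proof -
  let ?R = "2 * real CARD('d)"
  have "of_real (symbol_omega \<xi>) = (\<Sum>n. sqrt_coeff ?R n * of_real (nbr_symbol \<xi>) ^ n)" for \<xi> :: "real ^ 'd"
  proof -
    have "symbol_omega \<xi> = sqrt (1 + ?R - nbr_symbol \<xi>)"
      by (simp add: symbol_omega_def nbr_symbol_def right_diff_distrib sum_subtractf sum_distrib_left[symmetric])
    then show ?thesis using sums_unique[OF sqrt_coeff_sums[OF abs_nbr_symbol_le[of \<xi>]]] by simp
  qed
  moreover have "inverse_fourier (fourier \<psi>) = \<psi>" using fourier_inversion(2)[OF assms] by (simp add: fun_eq_iff)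
  ultimately show ?thesis
    using inverse_fourier_power_series[OF fourier_inversion(1)[OF assms] coeff_summable_sqrt_coeff[of ?R], of x]
    by (simp add: sqrt_one_minus_laplacian_def fourier_multiplier_def)
qed

section \<open>Bounds for the propagator\<close>

text \<open>The coefficients of \<open>q(s) exp (i t s / 2)\<close>. In use, \<open>q(N)\<close> is
  \<open>sqrt (1 - \<Delta>) + \<mu>\<close>; it is kept inside the propagator so that the decay
  estimates act directly on \<open>V \<psi>\<close>.\<close>

definition prop_series :: "(nat \<Rightarrow> complex) \<Rightarrow> real \<Rightarrow> nat \<Rightarrow> complex" where
  "prop_series q t = coeff_conv q (prop_coeff t)"

definition restrict_to :: "'a set \<Rightarrow> ('a \<Rightarrow> complex) \<Rightarrow> 'a \<Rightarrow> complex" where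
  "restrict_to A f x = (if x \<in> A then f x else 0)"

lemma coeff_summable_prop_series: "0 \<le> R \<Longrightarrow> coeff_summable R q \<Longrightarrow> coeff_summable R (prop_series q t)"
  unfolding prop_series_def by (intro coeff_summable_coeff_conv coeff_summable_prop_coeff)

lemma coeff_norm_nonneg: "0 \<le> R \<Longrightarrow> coeff_summable R q \<Longrightarrow> 0 \<le> coeff_norm R q"
  unfolding coeff_norm_def coeff_summable_def by (intro suminf_nonneg) auto

lemma prop_coeff_multiplier: "(\<Sum>n. prop_coeff t n * of_real s ^ n) = exp (\<i> * of_real (t * s / 2))"
  unfolding exp_def prop_coeff_def
  by (intro suminf_cong) (simp add: scaleR_conv_of_real power_mult_distrib power_divide field_simps)

text \<open>The exponential has modulus \<open>1\<close> for real \<open>s\<close>, so the bound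
  does not grow with \<open>t\<close>, in contrast to
  \<open>coeff_norm R (prop_coeff t) = exp (|t| R / 2)\<close>.\<close>

lemma norm_prop_series_multiplier_le:
  assumes q: "coeff_summable R q" and s: "\<bar>s\<bar> \<le> R"
  shows "norm (\<Sum>n. prop_series q t n * of_real s ^ n) \<le> coeff_norm R q"
proof -
  let ?a = "\<lambda>n. q n * complex_of_real s ^ n" and ?b = "\<lambda>n. prop_coeff t n * complex_of_real s ^ n"
  have sum_R: "summable (\<lambda>n. norm (a n) * R ^ n)" if "coeff_summable R a" for a using that by (simp add: coeff_summable_def)
  have sum: "summable (\<lambda>n. norm (a n * complex_of_real s ^ n))" if "coeff_summable R a" for a
    by (rule summable_comparison_test'[OF sum_R[OF that]]) (use norm_power_series_term[OF s] in simp)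
  have "(\<Sum>n. prop_series q t n * of_real s ^ n) = (\<Sum>n. \<Sum>i\<le>n. ?a i * ?b (n - i))"
    unfolding prop_series_def coeff_conv_def sum_distrib_right
    by (intro suminf_cong sum.cong refl) (simp add: mult_ac flip: power_add)
  also have "\<dots> = (\<Sum>n. ?a n) * (\<Sum>n. ?b n)"
    by (intro Cauchy_product[symmetric] sum q coeff_summable_prop_coeff)
  also have "(\<Sum>n. ?b n) = exp (\<i> * of_real (t * s / 2))" by (rule prop_coeff_multiplier)
  also have "norm ((\<Sum>n. ?a n) * exp (\<i> * of_real (t * s / 2))) = norm (\<Sum>n. ?a n)"
    by (simp add: norm_mult)
  also have "\<dots> \<le> (\<Sum>n. norm (?a n))" by (rule summable_norm[OF sum[OF q]])
  also have "\<dots> \<le> coeff_norm R q"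
    unfolding coeff_norm_def by (intro suminf_le norm_power_series_term s sum sum_R q)
  finally show ?thesis .
qed

lemma restrict_to_eq_sum_delta:
  assumes "finite A" shows "restrict_to A f = (\<lambda>x. \<Sum>y\<in>A. f y * lat_delta y x)"
proof
  fix x
  have "(\<Sum>y\<in>A. f y * lat_delta y x) = (\<Sum>y\<in>A. if y = x then f y else 0)"
    by (intro sum.cong) (auto simp: lat_delta_def)
  then show "restrict_to A f x = (\<Sum>y\<in>A. f y * lat_delta y x)" using assms by (simp add: restrict_to_def)
qed

lemma norm_lat_delta_le: "norm (lat_delta y x) \<le> 1"
  by (simp add: lat_delta_def)

lemma nbr_series_restrict_to:
  fixes f :: "int ^ 'd::finite \<Rightarrow> complex"
  assumes "coeff_summable (2 * real CARD('d)) a" "finite A"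
  shows "nbr_series a (restrict_to A f) x = (\<Sum>y\<in>A. f y * nbr_series a (lat_delta y) x)"
proof -
  have "nbr_series a (restrict_to A f) x = (\<Sum>y\<in>A. nbr_series a (\<lambda>x. f y * lat_delta y x) x)"
    unfolding restrict_to_eq_sum_delta[OF assms(2)]
  proof (rule nbr_series_sum[OF assms(1)])
    show "norm (f y * lat_delta y x) \<le> norm (f y) * 1" for x y
      unfolding norm_mult by (intro mult_left_mono norm_lat_delta_le) auto
  qed
  also have "\<dots> = (\<Sum>y\<in>A. f y * nbr_series a (lat_delta y) x)"
    by (intro sum.cong refl nbr_series_scale[OF assms(1) norm_lat_delta_le])
  finally show ?thesis .
qed

lemma nbr_series_prop_series:
  fixes f :: "int ^ 'd::finite \<Rightarrow> complex"
  assumes "coeff_summable (2 * real CARD('d)) q" "\<And>x. norm (f x) \<le> B"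
  shows "nbr_series (prop_series q t) f x = nbr_series q (nbr_series (prop_coeff t) f) x"
    "nbr_series (prop_series q t) f x = nbr_series (prop_coeff t) (nbr_series q f) x"
proof -
  show "nbr_series (prop_series q t) f x = nbr_series q (nbr_series (prop_coeff t) f) x"
    unfolding prop_series_def by (rule nbr_series_nbr_series[OF assms(1) coeff_summable_prop_coeff assms(2), symmetric])
  show "nbr_series (prop_series q t) f x = nbr_series (prop_coeff t) (nbr_series q f) x"
    unfolding prop_series_def coeff_conv_commute[of q] by (rule nbr_series_nbr_series[OF coeff_summable_prop_coeff assms, symmetric])
qed

lemma continuous_on_nbr_series_prop_series:
  fixes f :: "int ^ 'd::finite \<Rightarrow> complex"
  assumes "coeff_summable (2 * real CARD('d)) q" "\<And>x. norm (f x) \<le> B"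
  shows "continuous_on S (\<lambda>t. nbr_series (prop_series q t) f x)"
  unfolding nbr_series_prop_series(2)[OF assms]
  by (rule continuous_on_nbr_series_prop[OF nbr_series_bound[OF assms]])

text \<open>The window bound \<open>M\<close> is uniform in space, so every application of
  \<open>N\<close>, a sum over \<open>2 d\<close> neighbours, costs at most the factor
  \<open>2 d\<close>. Summation against \<open>|q n|\<close> gives
  \<open>coeff_norm q * M\<close>.\<close>

lemma propagator_kernel_integral_bound:
  fixes x y :: "int ^ 'd::finite"
  assumes q: "coeff_summable (2 * real CARD('d)) q" and T: "0 \<le> T"
    and M: "\<And>z :: int ^ 'd. integral {T..2 * T} (\<lambda>t. \<bar>bessel_prod z t\<bar>) \<le> M"
  shows "integral {T..2 * T} (\<lambda>t. norm (nbr_series (prop_series q t) (lat_delta y) x)) \<le> coeff_norm (2 * real CARD('d)) q * M"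
proof -
  let ?R = "2 * real CARD('d)"
  define g where "g t = nbr_series (prop_coeff t) (lat_delta y)" for t
  have norm_g: "norm (g t z) = \<bar>bessel_prod (z - y) t\<bar>" for t z
    unfolding g_def nbr_series_prop_delta by (simp add: norm_mult)
  then have g_le: "norm (g t z) \<le> 1" for t z using abs_bessel_prod_le_1 by simp
  have delta_pow: "norm ((nbr_sum ^^ n) (lat_delta y) z) \<le> ?R ^ n * 1" for n z
    by (rule nbr_pow_bound[OF norm_lat_delta_le])
  have g_pow: "(nbr_sum ^^ n) (g t) z = nbr_series (prop_coeff t) ((nbr_sum ^^ n) (lat_delta y)) z" for n t z
    unfolding g_def by (rule nbr_pow_nbr_series[OF coeff_summable_prop_coeff norm_lat_delta_le])
  have cont: "continuous_on {T..2 * T} (\<lambda>t. (nbr_sum ^^ n) (g t) z)" for n z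
    unfolding g_pow by (rule continuous_on_nbr_series_prop[OF delta_pow])
  have int: "(\<lambda>t. norm ((nbr_sum ^^ n) (g t) z)) integrable_on {T..2 * T}" for n z
    by (intro integrable_continuous_interval continuous_intros cont)
  have pow: "integral {T..2 * T} (\<lambda>t. norm ((nbr_sum ^^ n) (g t) z)) \<le> ?R ^ n * M" for n z
  proof (induction n arbitrary: z)
    case 0
    then show ?case using M[of "z - y"] by (simp add: norm_g)
  next
    case (Suc n)
    let ?G = "\<lambda>t. (nbr_sum ^^ n) (g t)"
    have "integral {T..2 * T} (\<lambda>t. norm ((nbr_sum ^^ Suc n) (g t) z)) \<le>
        integral {T..2 * T} (\<lambda>t. \<Sum>j\<in>UNIV. norm (?G t (z + axis j 1)) + norm (?G t (z - axis j 1)))"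
    proof (rule integral_le[OF int])
      show "(\<lambda>t. \<Sum>j\<in>UNIV. norm (?G t (z + axis j 1)) + norm (?G t (z - axis j 1))) integrable_on {T..2 * T}"
        by (intro integrable_continuous_interval continuous_intros cont)
      show "norm ((nbr_sum ^^ Suc n) (g t) z) \<le> (\<Sum>j\<in>UNIV. norm (?G t (z + axis j 1)) + norm (?G t (z - axis j 1)))" for t
        unfolding funpow.simps(2) o_def nbr_sum_def[of "?G t"] by (intro sum_norm_le norm_triangle_ineq)
    qed
    also have "\<dots> = (\<Sum>j\<in>UNIV. integral {T..2 * T} (\<lambda>t. norm (?G t (z + axis j 1))) + integral {T..2 * T} (\<lambda>t. norm (?G t (z - axis j 1))))"
      by (subst integral_sum) (auto intro!: integrable_add int sum.cong Henstock_Kurzweil_Integration.integral_add)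
    also have "\<dots> \<le> (\<Sum>j\<in>(UNIV :: 'd set). ?R ^ n * M + ?R ^ n * M)"
      by (intro sum_mono add_mono Suc)
    finally show ?case by (simp add: algebra_simps)
  qed
  have sum_q: "summable (\<lambda>n. norm (q n) * ?R ^ n)" using q by (simp add: coeff_summable_def)
  have M0: "0 \<le> M"
  proof -
    have "0 \<le> integral {T..2 * T} (\<lambda>t. \<bar>bessel_prod (0 :: int ^ 'd) t\<bar>)"
      by (intro integral_nonneg integrable_continuous_interval continuous_intros) auto
    then show ?thesis using M[of 0] by linarith
  qed
  have nbr_series_eq: "nbr_series (prop_series q t) (lat_delta y) x = nbr_series q (g t) x" for t
    unfolding g_def by (rule nbr_series_prop_series(1)[OF q norm_lat_delta_le])
  have cont_p: "continuous_on {T..2 * T} (\<lambda>t. nbr_series q (g t) x)"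
    unfolding nbr_series_eq[symmetric] by (rule continuous_on_nbr_series_prop_series[OF q norm_lat_delta_le])
  \<comment> \<open>Cutting the series at \<open>k\<close> leaves only a finite sum to exchange with
    the integral. The tail is bounded pointwise through \<open>|g| \<le> 1\<close>, integrates to
    \<open>T\<close> times the tail of \<open>coeff_norm\<close>, and vanishes as \<open>k\<close>
    grows with \<open>T\<close> fixed.\<close>
  have bound: "integral {T..2 * T} (\<lambda>t. norm (nbr_series q (g t) x)) \<le>
      coeff_norm ?R q * M + T * (coeff_norm ?R q - (\<Sum>n<k. norm (q n) * ?R ^ n))" for k
  proof -
    let ?tail = "coeff_norm ?R q - (\<Sum>n<k. norm (q n) * ?R ^ n)"
    have pw: "norm (nbr_series q (g t) x) \<le> (\<Sum>n<k. norm (q n) * norm ((nbr_sum ^^ n) (g t) x)) + ?tail" for t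
    proof -
      have "nbr_series q (g t) x = (\<Sum>n. q (n + k) * (nbr_sum ^^ (n + k)) (g t) x) + (\<Sum>n<k. q n * (nbr_sum ^^ n) (g t) x)"
        unfolding nbr_series_def by (rule suminf_split_initial_segment)
          (rule summable_norm_cancel[OF nbr_series_norm_summable[OF q g_le]])
      moreover have "norm (\<Sum>n<k. q n * (nbr_sum ^^ n) (g t) x) \<le> (\<Sum>n<k. norm (q n) * norm ((nbr_sum ^^ n) (g t) x))"
        by (rule order_trans[OF norm_sum]) (simp add: norm_mult)
      moreover have "norm (\<Sum>n. q (n + k) * (nbr_sum ^^ (n + k)) (g t) x) \<le> ?tail"
      proof -
        have s: "summable (\<lambda>n. norm (q (n + k) * (nbr_sum ^^ (n + k)) (g t) x))"
          using nbr_series_norm_summable[OF q g_le[of t], where x = x] by (rule summable_ignore_initial_segment)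
        have "norm (\<Sum>n. q (n + k) * (nbr_sum ^^ (n + k)) (g t) x) \<le> (\<Sum>n. norm (q (n + k) * (nbr_sum ^^ (n + k)) (g t) x))"
          by (rule summable_norm[OF s])
        also have "\<dots> \<le> (\<Sum>n. norm (q (n + k)) * ?R ^ (n + k))"
          using nbr_series_term_bound[OF q g_le[of t], where x = x]
          by (intro suminf_le s summable_ignore_initial_segment[OF sum_q]) simp
        also have "\<dots> = ?tail"
          unfolding coeff_norm_def by (rule suminf_minus_initial_segment[OF sum_q])
        finally show ?thesis .
      qed
      ultimately show ?thesis by (simp add: norm_triangle_le)
    qed
    have "integral {T..2 * T} (\<lambda>t. norm (nbr_series q (g t) x)) \<le>
        integral {T..2 * T} (\<lambda>t. (\<Sum>n<k. norm (q n) * norm ((nbr_sum ^^ n) (g t) x)) + ?tail)"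
      by (intro integral_le integrable_continuous_interval continuous_intros cont cont_p pw)
    also have "\<dots> = (\<Sum>n<k. norm (q n) * integral {T..2 * T} (\<lambda>t. norm ((nbr_sum ^^ n) (g t) x))) + T * ?tail"
    proof -
      have "integral {T..2 * T} (\<lambda>t. (\<Sum>n<k. norm (q n) * norm ((nbr_sum ^^ n) (g t) x)) + ?tail) =
        integral {T..2 * T} (\<lambda>t. \<Sum>n<k. norm (q n) * norm ((nbr_sum ^^ n) (g t) x)) + integral {T..2 * T} (\<lambda>t. ?tail)"
        by (intro Henstock_Kurzweil_Integration.integral_add integrable_continuous_interval continuous_intros cont)
      moreover have "integral {T..2 * T} (\<lambda>t. \<Sum>n<k. norm (q n) * norm ((nbr_sum ^^ n) (g t) x)) =
         (\<Sum>n<k. norm (q n) * integral {T..2 * T} (\<lambda>t. norm ((nbr_sum ^^ n) (g t) x)))"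
        by (subst Henstock_Kurzweil_Integration.integral_sum) (auto intro!: integrable_on_mult_right int)
      ultimately show ?thesis using T by simp
    qed
    also have "\<dots> \<le> (\<Sum>n<k. norm (q n) * (?R ^ n * M)) + T * ?tail"
      by (intro add_mono order_refl sum_mono mult_left_mono pow) auto
    also have "(\<Sum>n<k. norm (q n) * (?R ^ n * M)) = (\<Sum>n<k. norm (q n) * ?R ^ n) * M"
      by (simp add: sum_distrib_right mult.assoc)
    also have "\<dots> \<le> coeff_norm ?R q * M"
      unfolding coeff_norm_def by (intro mult_right_mono sum_le_suminf sum_q M0) auto
    finally show ?thesis by simp
  qed
  have "(\<lambda>k. coeff_norm ?R q * M + T * (coeff_norm ?R q - (\<Sum>n<k. norm (q n) * ?R ^ n))) \<longlonglongrightarrow>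
     coeff_norm ?R q * M + T * (coeff_norm ?R q - coeff_norm ?R q)"
    unfolding coeff_norm_def by (intro tendsto_intros summable_LIMSEQ[OF sum_q])
  then have "integral {T..2 * T} (\<lambda>t. norm (nbr_series q (g t) x)) \<le> coeff_norm ?R q * M + T * (coeff_norm ?R q - coeff_norm ?R q)"
    by (rule LIMSEQ_le_const) (use bound in auto)
  then show ?thesis by (simp add: nbr_series_eq)
qed

section \<open>Bilinear forms of the propagator\<close>

abbreviation l2norm :: "('a \<Rightarrow> complex) \<Rightarrow> 'a set \<Rightarrow> real" where
  "l2norm f A \<equiv> L2_set (\<lambda>x. norm (f x)) A"

text \<open>Bilinear, with no conjugate on \<open>h\<close>. The finite sets keep all sums finite;
  the estimates depend on them only through norms of \<open>h\<close> and \<open>f\<close>, so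
  limits can be taken later.\<close>

definition prop_form :: "(nat \<Rightarrow> complex) \<Rightarrow> (int ^ 'd::finite) set \<Rightarrow> (int ^ 'd) set \<Rightarrow>
    (int ^ 'd \<Rightarrow> complex) \<Rightarrow> (int ^ 'd \<Rightarrow> complex) \<Rightarrow> real \<Rightarrow> complex" where
  "prop_form q X A h f t = (\<Sum>x\<in>X. h x * nbr_series (prop_series q t) (restrict_to A f) x)"

context
  fixes q :: "nat \<Rightarrow> complex" and X A :: "(int ^ 'd::finite) set"
  assumes q: "coeff_summable (2 * real CARD('d)) q" and X: "finite X" and A: "finite A"
begin

lemma prop_form_eq: "prop_form q X A h f t = (\<Sum>x\<in>X. \<Sum>y\<in>A. h x * f y * nbr_series (prop_series q t) (lat_delta y) x)"
  unfolding prop_form_def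
  by (simp add: nbr_series_restrict_to[OF coeff_summable_prop_series[OF _ q] A] sum_distrib_left mult.assoc)

lemma continuous_on_prop_form: "continuous_on S (prop_form q X A h f)"
  unfolding prop_form_eq[abs_def]
  by (intro continuous_intros continuous_on_nbr_series_prop_series[OF q norm_lat_delta_le])

lemma prop_form_add_left: "prop_form q X A (\<lambda>x. h x + h' x) f t = prop_form q X A h f t + prop_form q X A h' f t"
  unfolding prop_form_def by (simp add: distrib_right sum.distrib)

lemma prop_form_add_right: "prop_form q X A h (\<lambda>x. f x + f' x) t = prop_form q X A h f t + prop_form q X A h f' t"
  unfolding prop_form_eq by (simp add: distrib_left distrib_right sum.distrib)

lemma norm_prop_form_le: "norm (prop_form q X A h f t) \<le> coeff_norm (2 * real CARD('d)) q * l2norm h X * l2norm f A"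
proof -
  let ?K = "coeff_norm (2 * real CARD('d)) q"
  have K0: "0 \<le> ?K" by (rule coeff_norm_nonneg[OF _ q]) simp
  have "norm (prop_form q X A h f t) \<le> (\<Sum>x\<in>X. \<bar>norm (h x)\<bar> * \<bar>norm (nbr_series (prop_series q t) (restrict_to A f) x)\<bar>)"
    unfolding prop_form_def by (rule order_trans[OF norm_sum]) (simp add: norm_mult)
  also have "\<dots> \<le> l2norm h X * L2_set (\<lambda>x. norm (nbr_series (prop_series q t) (restrict_to A f) x)) X"
    by (rule L2_set_mult_ineq)
  also have "\<dots> \<le> l2norm h X * (?K * l2norm f A)"
  proof (intro mult_left_mono)
    show "L2_set (\<lambda>x. norm (nbr_series (prop_series q t) (restrict_to A f) x)) X \<le> ?K * l2norm f A"
    proof -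
      have "(\<Sum>x\<in>X. (norm (nbr_series (prop_series q t) (restrict_to A f) x))\<^sup>2) \<le> ?K\<^sup>2 * (\<Sum>x\<in>A. (norm (f x))\<^sup>2)"
        unfolding restrict_to_def
        by (rule nbr_series_l2_bound[OF coeff_summable_prop_series[OF _ q] norm_prop_series_multiplier_le[OF q] A X]) auto
      then show ?thesis unfolding L2_set_def using K0 real_sqrt_le_mono by (fastforce simp: real_sqrt_mult)
    qed
  qed simp
  finally show ?thesis by (simp add: mult_ac)
qed

text \<open>The dispersive half of the argument, with \<open>l^1\<close> norms on both sides;
  \<open>norm_prop_form_le\<close> is the \<open>l^2\<close> half.\<close>

lemma prop_form_integral_L1_le:
  assumes T: "0 \<le> T" and M: "\<And>z :: int ^ 'd. integral {T..2 * T} (\<lambda>t. \<bar>bessel_prod z t\<bar>) \<le> M"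
  shows "integral {T..2 * T} (\<lambda>t. norm (prop_form q X A h f t)) \<le>
     coeff_norm (2 * real CARD('d)) q * M * (\<Sum>x\<in>X. norm (h x)) * (\<Sum>y\<in>A. norm (f y))"
proof -
  let ?K = "coeff_norm (2 * real CARD('d)) q"
  let ?P = "\<lambda>x y t. nbr_series (prop_series q t) (lat_delta y) x"
  have cont: "continuous_on S (?P x y)" for x y :: "int ^ 'd" and S
    by (rule continuous_on_nbr_series_prop_series[OF q norm_lat_delta_le])
  have int: "(\<lambda>t. norm (h x * f y) * norm (?P x y t)) integrable_on {T..2 * T}" for x y
    by (intro integrable_continuous_interval continuous_intros cont)
  have "integral {T..2 * T} (\<lambda>t. norm (prop_form q X A h f t)) \<le>
     integral {T..2 * T} (\<lambda>t. \<Sum>x\<in>X. \<Sum>y\<in>A. norm (h x * f y) * norm (?P x y t))"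
  proof (rule integral_le)
    show "(\<lambda>t. norm (prop_form q X A h f t)) integrable_on {T..2 * T}"
      by (intro integrable_continuous_interval continuous_intros continuous_on_prop_form)
    show "(\<lambda>t. \<Sum>x\<in>X. \<Sum>y\<in>A. norm (h x * f y) * norm (?P x y t)) integrable_on {T..2 * T}"
      by (intro integrable_continuous_interval continuous_intros cont)
    show "norm (prop_form q X A h f t) \<le> (\<Sum>x\<in>X. \<Sum>y\<in>A. norm (h x * f y) * norm (?P x y t))" for t
      unfolding prop_form_eq by (intro sum_norm_le order_trans[OF norm_sum]) (simp add: norm_mult)
  qed
  also have "\<dots> = (\<Sum>x\<in>X. \<Sum>y\<in>A. norm (h x * f y) * integral {T..2 * T} (\<lambda>t. norm (?P x y t)))"
    by (simp add: Henstock_Kurzweil_Integration.integral_sum X A int integrable_sum)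
  also have "\<dots> \<le> (\<Sum>x\<in>X. \<Sum>y\<in>A. norm (h x * f y) * (?K * M))"
    by (intro sum_mono mult_left_mono propagator_kernel_integral_bound[OF q T M]) auto
  also have "\<dots> = ?K * M * ((\<Sum>x\<in>X. norm (h x)) * (\<Sum>y\<in>A. norm (f y)))"
    unfolding sum_product by (simp add: sum_distrib_left norm_mult mult_ac)
  finally show ?thesis by (simp add: mult.assoc)
qed

end

lemma L2_set_mult_bounded:
  fixes c h :: "'a \<Rightarrow> complex"
  assumes "\<And>x. norm (c x) \<le> r" "0 \<le> r"
  shows "L2_set (\<lambda>x. norm (c x * h x)) X \<le> r * l2norm h X"
  unfolding L2_set_right_distrib[OF assms(2)] norm_mult
  by (intro L2_set_mono mult_right_mono assms) auto

context
  fixes q :: "nat \<Rightarrow> complex" and X A :: "(int ^ 'd::finite) set"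
    and \<rho> :: "int ^ 'd \<Rightarrow> real" and \<sigma> :: real and h f :: "int ^ 'd \<Rightarrow> complex"
  assumes q: "coeff_summable (2 * real CARD('d)) q" and X: "finite X" and A: "finite A"
    and \<rho>: "\<And>x. 0 \<le> \<rho> x" "\<And>x. \<rho> x \<le> 1"
    and \<rho>_sum: "\<And>F. finite F \<Longrightarrow> (\<Sum>x\<in>F. (\<rho> x)\<^sup>2 powr \<sigma>) \<le> 1" and \<sigma>: "1 \<le> \<sigma>"
begin

lemma weighted_prop_form_le:
  "norm (prop_form q X A (\<lambda>x. \<rho> x * h x) (\<lambda>x. \<rho> x * f x) t) \<le>
     coeff_norm (2 * real CARD('d)) q * l2norm h X * l2norm f A"
proof -
  have K0: "0 \<le> coeff_norm (2 * real CARD('d)) q" by (rule coeff_norm_nonneg[OF _ q]) simp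
  have "L2_set (\<lambda>x. norm (\<rho> x * g x)) Y \<le> 1 * l2norm g Y" for g :: "int ^ 'd \<Rightarrow> complex" and Y
    by (rule L2_set_mult_bounded) (use \<rho> in auto)
  then show ?thesis
    by (intro order_trans[OF norm_prop_form_le[OF q X A]] mult_mono mult_nonneg_nonneg K0 order_refl) auto
qed

text \<open>Write \<open>\<rho> = a + b\<close> with \<open>a\<close> living where
  \<open>\<rho>^2 > s\<close>, and expand into \<open>a a\<close>, \<open>a b\<close> and
  \<open>b \<rho>\<close>. Here \<open>a^2 \<le> s^(1 - \<sigma>) \<rho>^(2 \<sigma>)\<close>, so
  multiplication by \<open>a\<close> maps \<open>l^2\<close> to \<open>l^1\<close> with norm at most
  \<open>s^((1 - \<sigma>) / 2)\<close>, and the first term takes the kernel bound \<open>M\<close>.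
  The other two contain a factor \<open>b \<le> sqrt s\<close> and take the \<open>l^2\<close> bound
  over a time \<open>T\<close>.\<close>

lemma weighted_prop_form_window_bound:
  assumes T: "0 \<le> T" and M: "\<And>z :: int ^ 'd. integral {T..2 * T} (\<lambda>t. \<bar>bessel_prod z t\<bar>) \<le> M"
    and s: "0 < s"
  shows "integral {T..2 * T} (\<lambda>t. norm (prop_form q X A (\<lambda>x. \<rho> x * h x) (\<lambda>x. \<rho> x * f x) t)) \<le>
     coeff_norm (2 * real CARD('d)) q * (M * s powr (1 - \<sigma>) + 2 * T * sqrt s) *
       l2norm h X * l2norm f A"
proof -
  let ?K = "coeff_norm (2 * real CARD('d)) q"
  let ?H = "l2norm h X" and ?F = "l2norm f A"
  define a where "a x = (if s < (\<rho> x)\<^sup>2 then \<rho> x else 0)" for x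
  define b where "b x = (if s < (\<rho> x)\<^sup>2 then 0 else \<rho> x)" for x
  have \<rho>_ab: "\<rho> x = a x + b x" for x by (simp add: a_def b_def)
  have K0: "0 \<le> ?K" by (rule coeff_norm_nonneg[OF _ q]) simp
  have M0: "0 \<le> M"
  proof -
    have "0 \<le> integral {T..2 * T} (\<lambda>t. \<bar>bessel_prod (0 :: int ^ 'd) t\<bar>)"
      by (intro integral_nonneg integrable_continuous_interval continuous_intros) auto
    then show ?thesis using M[of 0] by linarith
  qed
  have a1: "norm (complex_of_real (a x)) \<le> 1" and r1: "norm (complex_of_real (\<rho> x)) \<le> 1" for x
    using \<rho>[of x] by (auto simp: a_def)
  have b1: "norm (complex_of_real (b x)) \<le> sqrt s" for x
    using \<rho>(1)[of x] s by (auto simp: b_def intro: real_le_rsqrt)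
  note L2b = L2_set_mult_bounded[OF b1, OF real_sqrt_ge_zero[OF less_imp_le[OF s]]]
  note L2a = L2_set_mult_bounded[OF a1 zero_le_one] and L2r = L2_set_mult_bounded[OF r1 zero_le_one]
  have a_sum: "L2_set a Y \<le> sqrt (s powr (1 - \<sigma>))" if "finite Y" for Y
  proof -
    have "(a x)\<^sup>2 \<le> s powr (1 - \<sigma>) * (\<rho> x)\<^sup>2 powr \<sigma>" for x
    proof (cases "s < (\<rho> x)\<^sup>2")
      case True
      then have pos: "0 < (\<rho> x)\<^sup>2" using s by linarith
      have "(a x)\<^sup>2 = (\<rho> x)\<^sup>2 powr (1 - \<sigma>) * (\<rho> x)\<^sup>2 powr \<sigma>"
        using True pos by (simp add: a_def flip: powr_add)
      also have "\<dots> \<le> s powr (1 - \<sigma>) * (\<rho> x)\<^sup>2 powr \<sigma>"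
        using True s \<sigma> by (intro mult_right_mono powr_mono2') auto
      finally show ?thesis .
    qed (simp add: a_def)
    then have "(\<Sum>x\<in>Y. (a x)\<^sup>2) \<le> s powr (1 - \<sigma>) * (\<Sum>x\<in>Y. (\<rho> x)\<^sup>2 powr \<sigma>)"
      unfolding sum_distrib_left by (intro sum_mono)
    also have "\<dots> \<le> s powr (1 - \<sigma>) * 1" by (intro mult_left_mono \<rho>_sum that) auto
    finally show ?thesis by (simp add: L2_set_def)
  qed
  have a_L1: "(\<Sum>x\<in>Y. norm (complex_of_real (a x) * g x)) \<le> sqrt (s powr (1 - \<sigma>)) * l2norm g Y"
    if "finite Y" for Y and g :: "int ^ 'd \<Rightarrow> complex"
  proof -
    have "(\<Sum>x\<in>Y. norm (complex_of_real (a x) * g x)) = (\<Sum>x\<in>Y. \<bar>a x\<bar> * \<bar>norm (g x)\<bar>)" by (simp add: norm_mult)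
    also have "\<dots> \<le> L2_set a Y * l2norm g Y" by (rule L2_set_mult_ineq)
    also have "\<dots> \<le> sqrt (s powr (1 - \<sigma>)) * l2norm g Y"
      by (intro mult_right_mono a_sum that) auto
    finally show ?thesis .
  qed
  let ?u = "prop_form q X A (\<lambda>x. a x * h x) (\<lambda>x. a x * f x)"
  have split: "prop_form q X A (\<lambda>x. \<rho> x * h x) (\<lambda>x. \<rho> x * f x) t =
     ?u t + prop_form q X A (\<lambda>x. a x * h x) (\<lambda>x. b x * f x) t + prop_form q X A (\<lambda>x. b x * h x) (\<lambda>x. \<rho> x * f x) t" for t
  proof -
    have "prop_form q X A (\<lambda>x. \<rho> x * h x) (\<lambda>x. \<rho> x * f x) t =
       prop_form q X A (\<lambda>x. a x * h x) (\<lambda>x. \<rho> x * f x) t + prop_form q X A (\<lambda>x. b x * h x) (\<lambda>x. \<rho> x * f x) t"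
      unfolding prop_form_add_left[OF q X A, symmetric] by (simp add: \<rho>_ab distrib_right)
    moreover have "prop_form q X A (\<lambda>x. a x * h x) (\<lambda>x. \<rho> x * f x) t = ?u t + prop_form q X A (\<lambda>x. a x * h x) (\<lambda>x. b x * f x) t"
      unfolding prop_form_add_right[OF q X A, symmetric] by (simp add: \<rho>_ab distrib_right)
    ultimately show ?thesis by simp
  qed
  have pw: "norm (prop_form q X A (\<lambda>x. \<rho> x * h x) (\<lambda>x. \<rho> x * f x) t) \<le> norm (?u t) + 2 * (?K * (sqrt s * ?H * ?F))" for t
  proof -
    have "norm (prop_form q X A (\<lambda>x. a x * h x) (\<lambda>x. b x * f x) t) \<le> ?K * (1 * ?H) * (sqrt s * ?F)"
      by (intro order_trans[OF norm_prop_form_le[OF q X A]] mult_mono mult_nonneg_nonneg K0 order_refl L2a L2b) (use s in auto)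
    moreover have "norm (prop_form q X A (\<lambda>x. b x * h x) (\<lambda>x. \<rho> x * f x) t) \<le> ?K * (sqrt s * ?H) * (1 * ?F)"
      by (intro order_trans[OF norm_prop_form_le[OF q X A]] mult_mono mult_nonneg_nonneg K0 order_refl L2r L2b) (use s in auto)
    ultimately show ?thesis
      unfolding split
      using norm_triangle_ineq[of "?u t + prop_form q X A (\<lambda>x. a x * h x) (\<lambda>x. b x * f x) t" "prop_form q X A (\<lambda>x. b x * h x) (\<lambda>x. \<rho> x * f x) t"]
        norm_triangle_ineq[of "?u t" "prop_form q X A (\<lambda>x. a x * h x) (\<lambda>x. b x * f x) t"]
      by (simp add: mult_ac)
  qed
  have "integral {T..2 * T} (\<lambda>t. norm (prop_form q X A (\<lambda>x. \<rho> x * h x) (\<lambda>x. \<rho> x * f x) t)) \<le>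
     integral {T..2 * T} (\<lambda>t. norm (?u t) + 2 * (?K * (sqrt s * ?H * ?F)))"
    by (intro integral_le integrable_continuous_interval continuous_intros continuous_on_prop_form[OF q X A] pw)
  also have "\<dots> = integral {T..2 * T} (\<lambda>t. norm (?u t)) + T * (2 * (?K * (sqrt s * ?H * ?F)))"
    using T by (subst Henstock_Kurzweil_Integration.integral_add)
      (auto intro!: integrable_continuous_interval continuous_intros continuous_on_prop_form[OF q X A])
  also have "integral {T..2 * T} (\<lambda>t. norm (?u t)) \<le>
      ?K * M * (\<Sum>x\<in>X. norm (complex_of_real (a x) * h x)) * (\<Sum>y\<in>A. norm (complex_of_real (a y) * f y))"
    by (rule prop_form_integral_L1_le[OF q X A T M])
  also have "\<dots> \<le> ?K * M * (sqrt (s powr (1 - \<sigma>)) * ?H) * (sqrt (s powr (1 - \<sigma>)) * ?F)"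
    by (intro mult_mono mult_nonneg_nonneg K0 M0 order_refl a_L1 X A sum_nonneg) auto
  also have "\<dots> = ?K * (M * s powr (1 - \<sigma>)) * ?H * ?F"
    by (simp add: mult_ac)
  finally show ?thesis by (simp add: algebra_simps)
qed

end

text \<open>One constant for all weights, finite sets, coefficients and dyadic times; the type
  argument fixes the dimension. In use, \<open>\<rho>^2\<close> is \<open>|V|\<close> normalised to
  \<open>\<sigma>\<close>-norm at most \<open>1\<close>.\<close>

definition dyadic_bound :: "'d::finite itself \<Rightarrow> real \<Rightarrow> real \<Rightarrow> bool" where
  "dyadic_bound _ \<sigma> C \<longleftrightarrow> (\<forall>q X (A :: (int ^ 'd) set) \<rho> h f k.
     coeff_summable (2 * real CARD('d)) q \<longrightarrow> finite X \<longrightarrow> finite A \<longrightarrow> (\<forall>x. 0 \<le> \<rho> x \<and> \<rho> x \<le> 1) \<longrightarrow>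
     (\<forall>F. finite F \<longrightarrow> (\<Sum>x\<in>F. (\<rho> x)\<^sup>2 powr \<sigma>) \<le> 1) \<longrightarrow>
     integral {0..2 ^ k} (\<lambda>t. norm (prop_form q X A (\<lambda>x. of_real (\<rho> x) * h x) (\<lambda>x. of_real (\<rho> x) * f x) t)) \<le>
       C * coeff_norm (2 * real CARD('d)) q * l2norm h X * l2norm f A)"

lemma dyadic_prop_form_bound:
  assumes d: "CARD('d::finite) \<in> {3, 4}" and \<sigma>: "1 < \<sigma>" "2 * (\<sigma> - 1) < real CARD('d) / 2 - 1"
  obtains C where "C > 0"
    "dyadic_bound TYPE('d) \<sigma> C"
proof -
  obtain C0 where C0: "C0 \<ge> 1" "\<And>(x :: int ^ 'd) T. 1 \<le> T \<Longrightarrow>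
    integral {T..2 * T} (\<lambda>t. \<bar>bessel_prod x t\<bar>) \<le> C0 * (1 + ln T) * T powr (1 - CARD('d) / 2)"
    by (rule bessel_prod_integral_bound[OF d]) blast
  have "2 < (real CARD('d) / 2 - 1) / (\<sigma> - 1)" using \<sigma> by (simp add: field_simps)
  \<comment> \<open>With threshold \<open>s = T^(-\<kappa>)\<close>, \<open>\<kappa> > 2\<close>
    makes \<open>T sqrt s\<close> decay, and the upper bound makes
    \<open>T^(1 - d/2) s^(1 - \<sigma>) = T^(-e)\<close> decay, with \<open>e\<close> as defined
    next. The hypothesis on \<open>\<sigma>\<close> says that this range of \<open>\<kappa>\<close>
    is nonempty.\<close>
  then obtain \<kappa> where \<kappa>: "2 < \<kappa>" "\<kappa> < (real CARD('d) / 2 - 1) / (\<sigma> - 1)" using dense by blast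
  define e where "e = real CARD('d) / 2 - 1 - \<kappa> * (\<sigma> - 1)"
  have e: "0 < e" using \<kappa>(2) \<sigma>(1) by (simp add: e_def field_simps)
  \<comment> \<open>Half of the decay exponent \<open>e\<close> is spent on the logarithm,
    \<open>ln T \<le> (2 / e) T^(e/2)\<close>; hence the \<open>2 / e\<close> here and the exponent
    \<open>e / 2\<close> in \<open>x1\<close>.\<close>
  define C1 where "C1 = C0 * (1 + 2 / e)"
  define x1 x2 where "x1 = 2 powr (- e / 2)" and "x2 = 2 powr (1 - \<kappa> / 2)"
  have x: "0 < x1" "x1 < 1" "0 < x2" "x2 < 1"
    using e \<kappa>(1) by (auto simp: x1_def x2_def powr_less_one)
  have C1: "0 \<le> C1" using C0(1) e by (simp add: C1_def)
  \<comment> \<open>\<open>1\<close> accounts for the times in \<open>[0, 1]\<close>, where the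
    \<open>l^2\<close> bound is used; the rest is two geometric series over the dyadic
    windows.\<close>
  define C where "C = 1 + (C1 / (1 - x1) + 2 / (1 - x2))"
  have Cpos: "C > 0" using C1 x by (auto simp: C_def intro!: add_pos_nonneg)
  have window: "C0 * (1 + ln (2 ^ j)) * (2 ^ j) powr (1 - CARD('d) / 2) * ((2 ^ j) powr (- \<kappa>)) powr (1 - \<sigma>)
      + 2 * 2 ^ j * sqrt ((2 ^ j) powr (- \<kappa>)) \<le> C1 * x1 ^ j + 2 * x2 ^ j" for j :: nat
  proof -
    define T where "T = (2::real) ^ j"
    have T: "1 \<le> T" by (simp add: T_def)
    have Tp: "T powr a = (2 powr a) ^ j" for a
      by (simp add: T_def powr_powr mult.commute flip: powr_realpow)
    have "ln T \<le> T powr (e / 2) / (e / 2)" by (rule ln_powr_bound) (use T e in auto)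
    moreover have "1 \<le> T powr (e / 2)" using T e by (simp add: ge_one_powr_ge_zero)
    ultimately have "1 + ln T \<le> (1 + 2 / e) * T powr (e / 2)" by (simp add: algebra_simps)
    then have "C0 * (1 + ln T) * T powr (1 - CARD('d) / 2) * (T powr (- \<kappa>)) powr (1 - \<sigma>)
      \<le> C0 * ((1 + 2 / e) * T powr (e / 2)) * T powr (1 - CARD('d) / 2) * (T powr (- \<kappa>)) powr (1 - \<sigma>)"
      using C0(1) by (intro mult_right_mono mult_left_mono) auto
    also have "\<dots> = C1 * (T powr (e / 2) * T powr (1 - CARD('d) / 2) * T powr (- \<kappa> * (1 - \<sigma>)))"
      by (simp add: C1_def powr_powr mult_ac)
    also have "T powr (e / 2) * T powr (1 - CARD('d) / 2) * T powr (- \<kappa> * (1 - \<sigma>)) = T powr (- e / 2)"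
      unfolding powr_add[symmetric] by (rule arg_cong[where f = "(powr) T"]) (simp add: e_def field_simps)
    finally have 1: "C0 * (1 + ln T) * T powr (1 - CARD('d) / 2) * (T powr (- \<kappa>)) powr (1 - \<sigma>) \<le> C1 * x1 ^ j"
      by (simp add: Tp x1_def)
    have "sqrt (T powr (- \<kappa>)) = T powr (- \<kappa> / 2)" using T by (simp add: powr_powr flip: powr_half_sqrt)
    then have "2 * T * sqrt (T powr (- \<kappa>)) = 2 * (T powr 1 * T powr (- \<kappa> / 2))" using T by simp
    also have "\<dots> = 2 * x2 ^ j" by (subst powr_add[symmetric]) (simp add: Tp x2_def)
    finally show ?thesis using 1 by (simp add: T_def)
  qed
  have main: "integral {0..2 ^ k} (\<lambda>t. norm (prop_form q X A (\<lambda>x. of_real (\<rho> x) * h x) (\<lambda>x. of_real (\<rho> x) * f x) t)) \<le>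
       C * coeff_norm (2 * real CARD('d)) q * l2norm h X * l2norm f A"
    if q: "coeff_summable (2 * real CARD('d)) q" and X: "finite X" and A: "finite A"
      and \<rho>: "\<And>x. 0 \<le> \<rho> x" "\<And>x. \<rho> x \<le> 1" "\<And>F. finite F \<Longrightarrow> (\<Sum>x\<in>F. (\<rho> x)\<^sup>2 powr \<sigma>) \<le> 1"
    for q and X A :: "(int ^ 'd) set" and \<rho> h f k
  proof -
    let ?K = "coeff_norm (2 * real CARD('d)) q"
    let ?H = "l2norm h X" and ?F = "l2norm f A"
    let ?u = "\<lambda>t. norm (prop_form q X A (\<lambda>x. of_real (\<rho> x) * h x) (\<lambda>x. of_real (\<rho> x) * f x) t)"
    have K0: "0 \<le> ?K" by (rule coeff_norm_nonneg[OF _ q]) simp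
    have int: "?u integrable_on {a..b}" for a b
      by (intro integrable_continuous_interval continuous_intros continuous_on_prop_form[OF q X A])
    note \<sigma>1 = less_imp_le[OF \<sigma>(1)]
    have le: "integral {0..2 ^ k} ?u \<le> (1 + (\<Sum>j<k. C1 * x1 ^ j + 2 * x2 ^ j)) * (?K * ?H * ?F)"
    proof (induction k)
      case 0
      have "integral {0..1} ?u \<le> integral {0..1::real} (\<lambda>t. ?K * ?H * ?F)"
      proof (rule integral_le[OF int])
        show "?u t \<le> ?K * ?H * ?F" for t by (rule weighted_prop_form_le[OF q X A \<rho> \<sigma>1])
      qed (intro integrable_continuous_interval continuous_intros)
      then show ?case by simp
    next
      case (Suc k)
      have "integral {2 ^ k..2 * 2 ^ k} ?u \<le> ?K * (C0 * (1 + ln (2 ^ k)) * (2 ^ k) powr (1 - CARD('d) / 2) * ((2 ^ k) powr (- \<kappa>)) powr (1 - \<sigma>)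
         + 2 * 2 ^ k * sqrt ((2 ^ k) powr (- \<kappa>))) * ?H * ?F"
        by (rule weighted_prop_form_window_bound[OF q X A \<rho> \<sigma>1]) (auto intro: C0(2))
      also have "\<dots> \<le> ?K * (C1 * x1 ^ k + 2 * x2 ^ k) * ?H * ?F"
        by (intro mult_right_mono mult_left_mono window K0) auto
      finally have "integral {2 ^ k..2 ^ Suc k} ?u \<le> (C1 * x1 ^ k + 2 * x2 ^ k) * (?K * ?H * ?F)" by (simp add: mult_ac)
      moreover have "integral {0..2 ^ Suc k} ?u = integral {0..2 ^ k} ?u + integral {2 ^ k..2 ^ Suc k} ?u"
        by (intro Henstock_Kurzweil_Integration.integral_combine[symmetric] int) auto
      ultimately show ?case using Suc by (simp add: algebra_simps)
    qed
    have geo: "(\<Sum>j<k. x ^ j) \<le> 1 / (1 - x)" if "0 < x" "x < 1" for x :: real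
    proof -
      have "(\<Sum>j<k. x ^ j) \<le> (\<Sum>j. x ^ j)" by (intro sum_le_suminf summable_geometric) (use that in auto)
      then show ?thesis using that by (simp add: suminf_geometric)
    qed
    have "(\<Sum>j<k. C1 * x1 ^ j + 2 * x2 ^ j) = C1 * (\<Sum>j<k. x1 ^ j) + 2 * (\<Sum>j<k. x2 ^ j)"
      by (simp add: sum.distrib sum_distrib_left)
    also have "\<dots> \<le> C1 * (1 / (1 - x1)) + 2 * (1 / (1 - x2))"
      using x C1 by (intro add_mono mult_left_mono geo) auto
    finally have "1 + (\<Sum>j<k. C1 * x1 ^ j + 2 * x2 ^ j) \<le> C" by (simp add: C_def)
    then have "(1 + (\<Sum>j<k. C1 * x1 ^ j + 2 * x2 ^ j)) * (?K * ?H * ?F) \<le> C * (?K * ?H * ?F)"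
      using K0 by (intro mult_right_mono mult_nonneg_nonneg) auto
    then show ?thesis using le by (simp add: mult.assoc)
  qed
  show ?thesis
  proof (rule that[OF Cpos], unfold dyadic_bound_def, intro allI impI)
    fix q and X A :: "(int ^ 'd) set" and \<rho> :: "int ^ 'd \<Rightarrow> real" and h f and k :: nat
    assume *: "coeff_summable (2 * real CARD('d)) q" "finite X" "finite A"
      and "\<forall>x. 0 \<le> \<rho> x \<and> \<rho> x \<le> 1" "\<forall>F. finite F \<longrightarrow> (\<Sum>x\<in>F. (\<rho> x)\<^sup>2 powr \<sigma>) \<le> 1"
    then show "integral {0..2 ^ k} (\<lambda>t. norm (prop_form q X A (\<lambda>x. of_real (\<rho> x) * h x) (\<lambda>x. of_real (\<rho> x) * f x) t)) \<le>
       C * coeff_norm (2 * real CARD('d)) q * l2norm h X * l2norm f A"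
      by (intro main) auto
  qed
qed

section \<open>Absence of eigenvalues\<close>

lemma finite_level_set:
  fixes f :: "'a \<Rightarrow> complex"
  assumes "\<And>F. finite F \<Longrightarrow> (\<Sum>x\<in>F. (norm (f x))\<^sup>2) \<le> S" "0 < e"
  shows "finite {x. e < norm (f x)}"
proof -
  have "card G \<le> nat \<lceil>S / e\<^sup>2\<rceil>" if G: "G \<subseteq> {x. e < norm (f x)}" "finite G" for G
  proof -
    have "real (card G) * e\<^sup>2 = (\<Sum>x\<in>G. e\<^sup>2)" by simp
    also have "\<dots> \<le> (\<Sum>x\<in>G. (norm (f x))\<^sup>2)"
      using G assms(2) by (intro sum_mono power_mono) auto
    also have "\<dots> \<le> S" by (rule assms(1)[OF G(2)])
    finally have "real (card G) \<le> S / e\<^sup>2" using assms(2) by (simp add: field_simps)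
    then show ?thesis by linarith
  qed
  then show ?thesis using finite_if_finite_subsets_card_bdd by blast
qed

lemma norm_le_1_if_sum_powr_le_1:
  fixes W :: "'a \<Rightarrow> complex"
  assumes "0 < \<sigma>" "\<And>F. finite F \<Longrightarrow> (\<Sum>x\<in>F. norm (W x) powr \<sigma>) \<le> 1"
  shows "norm (W x) \<le> 1"
proof (rule ccontr)
  assume "\<not> norm (W x) \<le> 1"
  then have "1 powr \<sigma> < norm (W x) powr \<sigma>" using assms(1) by (intro powr_less_mono2) auto
  then show False using assms(2)[of "{x}"] by simp
qed

lemma norm_le_of_sum_squares:
  assumes "\<And>F. finite F \<Longrightarrow> (\<Sum>x\<in>F. (norm (f x :: complex))\<^sup>2) \<le> S\<^sup>2" "0 \<le> S"
  shows "norm (f x) \<le> S"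
  using assms(1)[of "{x}"] assms(2) by (simp add: power2_le_iff_abs_le)

lemma nbr_series_approx_restrict_to:
  fixes f :: "int ^ 'd::finite \<Rightarrow> complex"
  assumes a: "coeff_summable (2 * real CARD('d)) a" and f: "\<And>x. norm (f x) \<le> B"
    and e: "\<And>x. x \<notin> A \<Longrightarrow> norm (f x) \<le> e" "0 \<le> e"
  shows "norm (nbr_series a f x - nbr_series a (restrict_to A f) x) \<le> coeff_norm (2 * real CARD('d)) a * e"
proof -
  have "0 \<le> B" by (rule order_trans[OF norm_ge_zero f])
  then have r: "norm (restrict_to A f x) \<le> B" for x using f by (simp add: restrict_to_def)
  have d: "norm (f x - restrict_to A f x) \<le> e" for x using e by (simp add: restrict_to_def)
  have "nbr_series a f x = nbr_series a (\<lambda>x. restrict_to A f x + (f x - restrict_to A f x)) x" by simp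
  also have "\<dots> = nbr_series a (restrict_to A f) x + nbr_series a (\<lambda>x. f x - restrict_to A f x) x" by (rule nbr_series_add[OF a r d])
  finally show ?thesis using nbr_series_bound[OF a d] by simp
qed

text \<open>Extends the \<open>l^2\<close> bound to infinite support, at a single point. Cutting
  \<open>f\<close> at a small height leaves a finite set; the rest is small in supremum norm and is
  controlled by \<open>coeff_norm\<close>.\<close>

lemma nbr_series_l2_pointwise:
  fixes f :: "int ^ 'd::finite \<Rightarrow> complex"
  assumes a: "coeff_summable (2 * real CARD('d)) a"
    and K: "\<And>s. \<bar>s\<bar> \<le> 2 * real CARD('d) \<Longrightarrow> norm (\<Sum>n. a n * of_real s ^ n) \<le> K"
    and f: "\<And>F. finite F \<Longrightarrow> (\<Sum>x\<in>F. (norm (f x))\<^sup>2) \<le> S\<^sup>2" "0 \<le> S"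
  shows "norm (nbr_series a f x) \<le> K * S"
proof (rule field_le_epsilon)
  let ?N = "coeff_norm (2 * real CARD('d)) a"
  fix e :: real assume e: "0 < e"
  have K0: "0 \<le> K" using K[of 0] norm_ge_zero order_trans by (metis abs_zero mult_nonneg_nonneg of_nat_0_le_iff zero_le_numeral)
  have N0: "0 \<le> ?N" by (rule coeff_norm_nonneg[OF _ a]) simp
  define \<eta> where "\<eta> = e / (?N + 1)"
  have \<eta>: "0 < \<eta>" using e N0 by (simp add: \<eta>_def)
  define A where "A = {x. \<eta> < norm (f x)}"
  have A: "finite A" unfolding A_def by (rule finite_level_set[OF f(1) \<eta>])
  have "norm (nbr_series a f x - nbr_series a (restrict_to A f) x) \<le> ?N * \<eta>"
    by (rule nbr_series_approx_restrict_to[OF a norm_le_of_sum_squares[OF f]]) (use \<eta> in \<open>auto simp: A_def\<close>)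
  also have "\<dots> \<le> e" using e N0 by (simp add: \<eta>_def field_simps)
  finally have 1: "norm (nbr_series a f x - nbr_series a (restrict_to A f) x) \<le> e" .
  have "(norm (nbr_series a (restrict_to A f) x))\<^sup>2 \<le> K\<^sup>2 * (\<Sum>x\<in>A. (norm (f x))\<^sup>2)"
    using nbr_series_l2_bound[OF a K A, of "{x}" f] by (simp add: restrict_to_def[abs_def])
  also have "\<dots> \<le> K\<^sup>2 * S\<^sup>2" by (intro mult_left_mono f A) auto
  also have "\<dots> = (K * S)\<^sup>2" by (simp add: power_mult_distrib)
  finally have "norm (nbr_series a (restrict_to A f) x) \<le> K * S" using K0 f(2) by (simp add: power2_le_iff_abs_le)
  then show "norm (nbr_series a f x) \<le> K * S + e"
    using 1 norm_triangle_ineq2[of "nbr_series a f x" "nbr_series a (restrict_to A f) x"] by linarith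
qed

lemma norm_prop_multiplier: "norm (\<Sum>n. prop_coeff t n * of_real s ^ n) \<le> 1"
  by (simp add: prop_coeff_multiplier)

text \<open>For a finitely supported function the kernel gives the limit. The remainder of
  \<open>\<psi>\<close> is small in \<open>l^2\<close>, and since the multiplier of the propagator
  has modulus \<open>1\<close>, its contribution is small uniformly in \<open>t\<close>.\<close>

lemma propagator_decay:
  fixes \<psi> :: "int ^ 'd::finite \<Rightarrow> complex"
  assumes "\<psi> \<in> ell 2"
  shows "((\<lambda>t. nbr_series (prop_coeff t) \<psi> x) \<longlongrightarrow> 0) at_top"
proof (rule tendstoI)
  fix e :: real assume e: "0 < e"
  have sum: "(\<lambda>x. (norm (\<psi> x))\<^sup>2) summable_on UNIV" using assms by (simp add: ell_2_iff)
  obtain A where A: "finite A" "\<And>B. finite B \<Longrightarrow> B \<inter> A = {} \<Longrightarrow> (\<Sum>x\<in>B. (norm (\<psi> x))\<^sup>2) \<le> (e / 2)\<^sup>2"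
    using summable_subset_tail[OF sum, of "(e / 2)\<^sup>2"] e by auto
  define \<phi> where "\<phi> x = \<psi> x - restrict_to A \<psi> x" for x
  have \<phi>: "(\<Sum>x\<in>F. (norm (\<phi> x))\<^sup>2) \<le> (e / 2)\<^sup>2" if "finite F" for F
  proof -
    have "(\<Sum>x\<in>F. (norm (\<phi> x))\<^sup>2) = (\<Sum>x\<in>F - A. (norm (\<psi> x))\<^sup>2)"
      using that by (intro sum.mono_neutral_cong_right) (auto simp: \<phi>_def restrict_to_def)
    also have "\<dots> \<le> (e / 2)\<^sup>2" using that by (intro A) auto
    finally show ?thesis .
  qed
  have r: "norm (restrict_to A \<psi> x) \<le> (\<Sum>y\<in>A. norm (\<psi> y))" for x
    using member_le_sum[of x A "\<lambda>y. norm (\<psi> y)"] A(1) by (auto simp: restrict_to_def sum_nonneg)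
  have e2: "0 \<le> e / 2" using e by simp
  have split: "nbr_series (prop_coeff t) \<psi> x = nbr_series (prop_coeff t) (restrict_to A \<psi>) x + nbr_series (prop_coeff t) \<phi> x" for t
  proof -
    have "\<psi> = (\<lambda>x. restrict_to A \<psi> x + \<phi> x)" by (simp add: \<phi>_def)
    then have "nbr_series (prop_coeff t) \<psi> x = nbr_series (prop_coeff t) (\<lambda>x. restrict_to A \<psi> x + \<phi> x) x" by simp
    also have "\<dots> = nbr_series (prop_coeff t) (restrict_to A \<psi>) x + nbr_series (prop_coeff t) \<phi> x"
      by (rule nbr_series_add[OF coeff_summable_prop_coeff r norm_le_of_sum_squares[OF \<phi> e2]])
    finally show ?thesis .
  qed
  have tail: "norm (nbr_series (prop_coeff t) \<phi> x) \<le> 1 * (e / 2)" for t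
    by (rule nbr_series_l2_pointwise[OF coeff_summable_prop_coeff norm_prop_multiplier \<phi> e2])
  have "((\<lambda>t. \<Sum>y\<in>A. \<psi> y * (lat_phase (x - y) * of_real (bessel_prod (x - y) t))) \<longlongrightarrow>
      (\<Sum>y\<in>A. \<psi> y * (lat_phase (x - y) * of_real 0))) at_top"
    by (intro tendsto_intros bessel_prod_tendsto_0)
  then have "((\<lambda>t. nbr_series (prop_coeff t) (restrict_to A \<psi>) x) \<longlongrightarrow> 0) at_top"
    by (simp add: nbr_series_restrict_to[OF coeff_summable_prop_coeff A(1)] nbr_series_prop_delta)
  then have "\<forall>\<^sub>F t in at_top. dist (nbr_series (prop_coeff t) (restrict_to A \<psi>) x) 0 < e / 2"
    using e by (intro tendstoD) auto
  then show "\<forall>\<^sub>F t in at_top. dist (nbr_series (prop_coeff t) \<psi> x) 0 < e"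
  proof eventually_elim
    case (elim t)
    then show ?case
      unfolding split using tail[of t] norm_triangle_ineq[of "nbr_series (prop_coeff t) (restrict_to A \<psi>) x" "nbr_series (prop_coeff t) \<phi> x"]
      by simp
  qed
qed

text \<open>The derivative of \<open>exp (- i w t / 2) exp (i t N / 2) \<psi>\<close> is
  \<open>i / 2\<close> times the same evolution of \<open>(N - w) \<psi>\<close>, which the equation
  identifies with \<open>q(N) g\<close>. Everything is pointwise in \<open>x\<close> on a finite
  time interval.\<close>

lemma duhamel:
  fixes \<psi> g :: "int ^ 'd::finite \<Rightarrow> complex"
  assumes q: "coeff_summable (2 * real CARD('d)) q" and g: "\<And>x. norm (g x) \<le> B" and \<psi>: "\<And>x. norm (\<psi> x) \<le> B'"
    and eq: "\<And>x. nbr_sum \<psi> x = nbr_series q g x + w * \<psi> x" and T: "0 \<le> T"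
  shows "((\<lambda>t. exp (- (\<i> * w / 2 * of_real t)) * nbr_series (prop_series q t) g x) has_integral
    2 / \<i> * (exp (- (\<i> * w / 2 * of_real T)) * nbr_series (prop_coeff T) \<psi> x - \<psi> x)) {0..T}"
proof -
  let ?E = "\<lambda>t. exp (- (\<i> * w / 2 * of_real t))"
  have nb: "nbr_series (prop_coeff t) (nbr_sum \<psi>) x = nbr_series (prop_series q t) g x + w * nbr_series (prop_coeff t) \<psi> x" for t
  proof -
    have b2: "norm (w * \<psi> x) \<le> norm w * B'" for x unfolding norm_mult by (intro mult_left_mono \<psi>) auto
    have "nbr_series (prop_coeff t) (nbr_sum \<psi>) x = nbr_series (prop_coeff t) (\<lambda>x. nbr_series q g x + w * \<psi> x) x"
      by (simp add: eq[abs_def])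
    also have "\<dots> = nbr_series (prop_coeff t) (nbr_series q g) x + nbr_series (prop_coeff t) (\<lambda>x. w * \<psi> x) x"
      by (rule nbr_series_add[OF coeff_summable_prop_coeff nbr_series_bound[OF q g] b2])
    also have "nbr_series (prop_coeff t) (\<lambda>x. w * \<psi> x) x = w * nbr_series (prop_coeff t) \<psi> x"
      by (rule nbr_series_scale[OF coeff_summable_prop_coeff \<psi>])
    finally show ?thesis by (simp add: nbr_series_prop_series(2)[OF q g])
  qed
  have E: "(?E has_vector_derivative - (\<i> * w / 2) * ?E t) (at t within {0..T})" for t
  proof (rule has_vector_derivative_real_field)
    show "((\<lambda>z. exp (- (\<i> * w / 2 * z))) has_field_derivative - (\<i> * w / 2) * exp (- (\<i> * w / 2 * of_real t))) (at (of_real t))"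
      by (auto intro!: derivative_eq_intros)
  qed
  have "((\<lambda>t. ?E t * nbr_series (prop_coeff t) \<psi> x) has_vector_derivative
      \<i> / 2 * (?E t * nbr_series (prop_series q t) g x)) (at t within {0..T})" for t
  proof -
    have "((\<lambda>t. ?E t * nbr_series (prop_coeff t) \<psi> x) has_vector_derivative
      (?E t * (\<i> / 2 * nbr_series (prop_coeff t) (nbr_sum \<psi>) x) + (- (\<i> * w / 2) * ?E t) * nbr_series (prop_coeff t) \<psi> x)) (at t within {0..T})"
      by (rule has_vector_derivative_mult[OF E nbr_series_prop_DERIV[OF \<psi>]])
    moreover have "?E t * (\<i> / 2 * nbr_series (prop_coeff t) (nbr_sum \<psi>) x) + (- (\<i> * w / 2) * ?E t) * nbr_series (prop_coeff t) \<psi> x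
      = \<i> / 2 * (?E t * nbr_series (prop_series q t) g x)"
      unfolding nb by (simp add: algebra_simps)
    ultimately show ?thesis by (simp only:)
  qed
  then have "((\<lambda>t. \<i> / 2 * (?E t * nbr_series (prop_series q t) g x)) has_integral
      ?E T * nbr_series (prop_coeff T) \<psi> x - ?E 0 * nbr_series (prop_coeff 0) \<psi> x) {0..T}"
    by (rule fundamental_theorem_of_calculus[OF T])
  then have "((\<lambda>t. 2 / \<i> * (\<i> / 2 * (?E t * nbr_series (prop_series q t) g x))) has_integral
      2 / \<i> * (?E T * nbr_series (prop_coeff T) \<psi> x - ?E 0 * nbr_series (prop_coeff 0) \<psi> x)) {0..T}"
    by (rule has_integral_mult_right)
  then show ?thesis by (simp add: nbr_series_prop_0)
qed

text \<open>For \<open>Im w \<le> 0\<close> the factor \<open>exp (- i w t / 2)\<close> is bounded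
  by \<open>1\<close> for \<open>t \<ge> 0\<close>, so the evolved term in Duhamel's formula tends
  to \<open>0\<close> pointwise. Real \<open>w\<close>, hence also values in the spectrum of
  \<open>N\<close>, are covered without a limiting argument in \<open>w\<close>.\<close>

lemma no_solution_lower_half_plane:
  assumes d: "CARD('d::finite) \<in> {3, 4}"
  fixes \<psi> W :: "int ^ 'd \<Rightarrow> complex" and C e :: real
  assumes C: "C > 0" "dyadic_bound TYPE('d) \<sigma> C"
    and \<sigma>: "0 < \<sigma>" and W: "\<And>F. finite F \<Longrightarrow> (\<Sum>x\<in>F. norm (W x) powr \<sigma>) \<le> 1"
    and \<psi>: "\<psi> \<in> ell 2" and q: "coeff_summable (2 * real CARD('d)) q"
    and eq: "\<And>x. nbr_sum \<psi> x = nbr_series q (\<lambda>x. of_real e * (W x * \<psi> x)) x + w * \<psi> x"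
    and w: "Im w \<le> 0" and e: "0 \<le> e" "e * C * coeff_norm (2 * real CARD('d)) q < 2"
  shows "\<psi> = (\<lambda>x. 0)"
proof -
  let ?R = "2 * real CARD('d)" and ?K = "coeff_norm (2 * real CARD('d)) q"
  have K0: "0 \<le> ?K" by (rule coeff_norm_nonneg[OF _ q]) simp
  have W1: "norm (W x) \<le> 1" for x by (rule norm_le_1_if_sum_powr_le_1[OF \<sigma> W])
  have sum\<psi>: "(\<lambda>x. (norm (\<psi> x))\<^sup>2) summable_on UNIV" using \<psi> by (simp add: ell_2_iff)
  define S where "S = sqrt (\<Sum>\<^sub>\<infinity>x. (norm (\<psi> x))\<^sup>2)"
  have S0: "0 \<le> S" unfolding S_def by (simp add: infsum_nonneg)
  have S: "(\<Sum>x\<in>F. (norm (\<psi> x))\<^sup>2) \<le> S\<^sup>2" if "finite F" for F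
  proof -
    have "(\<Sum>x\<in>F. (norm (\<psi> x))\<^sup>2) \<le> (\<Sum>\<^sub>\<infinity>x. (norm (\<psi> x))\<^sup>2)"
      by (rule finite_sum_le_infsum[OF sum\<psi> that]) auto
    also have "\<dots> = S\<^sup>2" unfolding S_def by (simp add: infsum_nonneg)
    finally show ?thesis .
  qed
  have \<psi>S: "norm (\<psi> x) \<le> S" for x by (rule norm_le_of_sum_squares[OF S S0])
  define \<rho> where "\<rho> x = sqrt (norm (W x))" for x
  have \<rho>: "0 \<le> \<rho> x" "\<rho> x \<le> 1" "(\<rho> x)\<^sup>2 = norm (W x)" for x using W1[of x] by (auto simp: \<rho>_def)
  \<comment> \<open>A polar decomposition of the potential: \<open>\<rho> f = W \<psi>\<close> and
    \<open>\<rho> h \<psi> = |h|^2\<close>, with \<open>|f| = |h| = \<rho> |\<psi>|\<close>. Pairing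
    Duhamel's formula with \<open>\<rho> h\<close> then gives the squared norm of \<open>h\<close>
    on one side and a form in \<open>h\<close> and \<open>f\<close> on the other.\<close>
  define h where "h x = \<rho> x * cnj (\<psi> x)" for x
  define f where "f x = (if \<rho> x = 0 then 0 else W x / \<rho> x) * \<psi> x" for x
  have norm_h: "norm (h x) = \<rho> x * norm (\<psi> x)" for x using \<rho>(1)[of x] by (simp add: h_def norm_mult)
  have norm_f: "norm (f x) = \<rho> x * norm (\<psi> x)" for x
  proof (cases "\<rho> x = 0")
    case False
    then show ?thesis using \<rho>(1)[of x] \<rho>(3)[of x]
      by (simp add: f_def norm_mult norm_divide power2_eq_square flip: \<rho>(3))
  qed (simp add: f_def)
  have \<rho>f: "of_real (\<rho> x) * f x = W x * \<psi> x" for x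
  proof (cases "\<rho> x = 0")
    case True
    then have "W x = 0" using \<rho>(3)[of x] by simp
    then show ?thesis using True by simp
  qed (simp add: f_def)
  define g where "g x = of_real e * (W x * \<psi> x)" for x
  define G where "G x = W x * \<psi> x" for x
  have G_le: "norm (G x) \<le> norm (\<psi> x)" for x
    using mult_right_mono[OF W1[of x] norm_ge_zero[of "\<psi> x"]] by (simp add: G_def norm_mult)
  have GS: "norm (G x) \<le> S" for x using G_le[of x] \<psi>S[of x] by linarith
  have g_eq: "g = (\<lambda>x. of_real e * G x)" by (simp add: g_def G_def fun_eq_iff)
  have gB: "norm (g x) \<le> e * S" for x
    unfolding g_eq norm_mult using e(1) GS[of x] by (simp add: mult_left_mono)
  have nbr_series_g: "nbr_series (prop_series q t) g x = of_real e * nbr_series (prop_series q t) G x" for t x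
    unfolding g_eq by (rule nbr_series_scale[OF coeff_summable_prop_series[OF _ q] GS]) simp
  let ?E = "\<lambda>t. exp (- (\<i> * w / 2 * of_real t))"
  have E1: "norm (?E t) \<le> 1" if "0 \<le> t" for t
    using that w by (simp add: norm_exp mult_nonpos_nonneg)
  have rep: "((\<lambda>t. ?E t * nbr_series (prop_series q t) g x) has_integral
      2 / \<i> * (?E T * nbr_series (prop_coeff T) \<psi> x - \<psi> x)) {0..T}" if "0 \<le> T" for T x
    by (rule duhamel[OF q gB \<psi>S _ that]) (simp add: eq g_def)
  have decay: "(\<lambda>k. ?E (2 ^ k) * nbr_series (prop_coeff (2 ^ k)) \<psi> x) \<longlonglongrightarrow> 0" for x
  proof (rule Lim_null_comparison)
    have "norm (?E (2 ^ k)) * norm (nbr_series (prop_coeff (2 ^ k)) \<psi> x) \<le> 1 * norm (nbr_series (prop_coeff (2 ^ k)) \<psi> x)" for k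
      by (intro mult_right_mono E1) auto
    then show "\<forall>\<^sub>F k in sequentially. norm (?E (2 ^ k) * nbr_series (prop_coeff (2 ^ k)) \<psi> x) \<le> norm (nbr_series (prop_coeff (2 ^ k)) \<psi> x)"
      unfolding norm_mult mult_1 by (intro always_eventually allI)
    have "filterlim (\<lambda>k. (2::real) ^ k) at_top sequentially" by real_asymp
    then show "(\<lambda>k. norm (nbr_series (prop_coeff (2 ^ k)) \<psi> x)) \<longlonglongrightarrow> 0"
      by (intro tendsto_norm_zero filterlim_compose[OF propagator_decay[OF \<psi>]])
  qed
  have E_bound: "(\<Sum>x\<in>X. (norm (h x))\<^sup>2) \<le> e / 2 * (C * ?K) * l2norm h X * D"
    if X: "finite X" and D: "\<And>A. finite A \<Longrightarrow> l2norm f A \<le> D" for X D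
  proof -
    let ?H = "l2norm h X"
    let ?U = "\<lambda>t. \<Sum>x\<in>X. of_real (\<rho> x) * h x * nbr_series (prop_series q t) G x"
    have contU: "continuous_on Y ?U" for Y
      by (intro continuous_intros continuous_on_nbr_series_prop_series[OF q GS])
    \<comment> \<open>The bound for finite \<open>A\<close> is carried over to
      \<open>G = W \<psi>\<close>, whose support may be infinite. Truncation at height
      \<open>\<eta>\<close> changes the integrand by at most a multiple of
      \<open>exp (T d) * \<eta>\<close>; this is harmless because \<open>T = 2^k\<close> is fixed
      before \<open>\<eta>\<close> is chosen. \<open>Z\<close> collects the factors.\<close>
    have U_le: "integral {0..2 ^ k} (\<lambda>t. norm (?U t)) \<le> C * ?K * ?H * D" for k
    proof (rule field_le_epsilon)
      fix \<delta> :: real assume \<delta>: "0 < \<delta>"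
      let ?T = "(2::real) ^ k"
      define Z where "Z = ?T * ((\<Sum>x\<in>X. norm (of_real (\<rho> x) * h x)) * (?K * exp (?T * real CARD('d))))"
      have Z0: "0 \<le> Z" unfolding Z_def by (intro mult_nonneg_nonneg sum_nonneg K0) auto
      define \<eta> where "\<eta> = \<delta> / (Z + 1)"
      have \<eta>: "0 < \<eta>" using \<delta> Z0 by (simp add: \<eta>_def)
      define A where "A = {x. \<eta> < norm (\<psi> x)}"
      have A: "finite A" unfolding A_def by (rule finite_level_set[OF S \<eta>])
      let ?F = "prop_form q X A (\<lambda>x. of_real (\<rho> x) * h x) (\<lambda>x. of_real (\<rho> x) * f x)"
      have out: "norm (G x) \<le> \<eta>" if "x \<notin> A" for x using G_le[of x] that by (simp add: A_def)
      have pw: "norm (?U t) \<le> norm (?F t) + (\<Sum>x\<in>X. norm (of_real (\<rho> x) * h x)) * (?K * exp (?T * real CARD('d)) * \<eta>)"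
        if t: "t \<in> {0..?T}" for t
      proof -
        have "norm (nbr_series (prop_series q t) G x - nbr_series (prop_series q t) (restrict_to A G) x) \<le> ?K * exp (?T * real CARD('d)) * \<eta>" for x
        proof -
          have r: "norm (G x - restrict_to A G x) \<le> \<eta>" for x using out \<eta> by (auto simp: restrict_to_def)
          have r2: "norm (restrict_to A G x) \<le> S" for x using GS[of x] S0 by (simp add: restrict_to_def)
          have "nbr_series (prop_series q t) G x = nbr_series (prop_series q t) (\<lambda>x. restrict_to A G x + (G x - restrict_to A G x)) x" by simp
          also have "\<dots> = nbr_series (prop_series q t) (restrict_to A G) x + nbr_series (prop_series q t) (\<lambda>x. G x - restrict_to A G x) x"
            by (rule nbr_series_add[OF coeff_summable_prop_series[OF _ q] r2 r]) simp
          finally have "norm (nbr_series (prop_series q t) G x - nbr_series (prop_series q t) (restrict_to A G) x) = norm (nbr_series (prop_series q t) (\<lambda>x. G x - restrict_to A G x) x)"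
            by simp
          also have "\<dots> = norm (nbr_series q (nbr_series (prop_coeff t) (\<lambda>x. G x - restrict_to A G x)) x)"
            by (simp only: nbr_series_prop_series(1)[OF q r])
          also have "\<dots> \<le> ?K * (coeff_norm ?R (prop_coeff t) * \<eta>)"
            by (rule nbr_series_bound[OF q nbr_series_bound[OF coeff_summable_prop_coeff r]])
          also have "\<dots> \<le> ?K * (exp (?T * real CARD('d)) * \<eta>)"
            unfolding coeff_norm_prop_coeff using t \<eta> by (intro mult_left_mono mult_right_mono K0) auto
          finally show ?thesis by (simp add: mult.assoc)
        qed
        then have "norm (?U t - ?F t) \<le> (\<Sum>x\<in>X. norm (of_real (\<rho> x) * h x) * (?K * exp (?T * real CARD('d)) * \<eta>))"
          unfolding prop_form_def \<rho>f G_def[symmetric] sum_subtractf[symmetric] right_diff_distrib[symmetric]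
          by (intro sum_norm_le) (simp add: norm_mult mult_left_mono)
        then show ?thesis
          using norm_triangle_ineq2[of "?U t" "?F t"] by (simp add: sum_distrib_right)
      qed
      have intF: "(\<lambda>t. norm (?F t)) integrable_on {0..?T}"
        by (intro integrable_continuous_interval continuous_intros continuous_on_prop_form[OF q X A])
      have "integral {0..?T} (\<lambda>t. norm (?U t)) \<le>
          integral {0..?T} (\<lambda>t. norm (?F t) + (\<Sum>x\<in>X. norm (of_real (\<rho> x) * h x)) * (?K * exp (?T * real CARD('d)) * \<eta>))"
        by (intro integral_le integrable_continuous_interval continuous_intros contU continuous_on_prop_form[OF q X A] pw)
      also have "\<dots> = integral {0..?T} (\<lambda>t. norm (?F t)) + Z * \<eta>"
        by (subst Henstock_Kurzweil_Integration.integral_add[OF intF]) (auto simp: Z_def mult_ac)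
      also have "integral {0..?T} (\<lambda>t. norm (?F t)) \<le> C * ?K * ?H * l2norm f A"
        by (rule C(2)[unfolded dyadic_bound_def, rule_format, OF q X A]) (use W \<rho>(1,2) in \<open>simp_all add: \<rho>(3)\<close>)
      also have "\<dots> \<le> C * ?K * ?H * D"
        using C(1) K0 by (intro mult_left_mono D A mult_nonneg_nonneg) auto
      also have "Z * \<eta> \<le> \<delta>" using Z0 \<delta> by (simp add: \<eta>_def field_simps)
      finally show "integral {0..?T} (\<lambda>t. norm (?U t)) \<le> C * ?K * ?H * D + \<delta>" by simp
    qed
    \<comment> \<open>In the paired formula the term with \<open>\<psi>\<close> gives the sum of
      \<open>|h|^2\<close>, and the factor \<open>2 / i\<close> is the origin of
      \<open>e / 2\<close>.\<close>
    have id: "(\<Sum>x\<in>X. (norm (h x))\<^sup>2) \<le> norm (\<Sum>x\<in>X. of_real (\<rho> x) * h x * (?E (2 ^ k) * nbr_series (prop_coeff (2 ^ k)) \<psi> x))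
        + e / 2 * (C * ?K * ?H * D)" for k
    proof -
      let ?T = "(2::real) ^ k"
      have "((\<lambda>t. \<Sum>x\<in>X. of_real (\<rho> x) * h x * (?E t * nbr_series (prop_series q t) g x)) has_integral
         (\<Sum>x\<in>X. of_real (\<rho> x) * h x * (2 / \<i> * (?E ?T * nbr_series (prop_coeff ?T) \<psi> x - \<psi> x)))) {0..?T}"
        by (intro has_integral_sum X has_integral_mult_right rep) auto
      moreover have "(\<Sum>x\<in>X. of_real (\<rho> x) * h x * (?E t * nbr_series (prop_series q t) g x)) = of_real e * (?E t * ?U t)" for t
        unfolding nbr_series_g sum_distrib_left by (intro sum.cong) (auto simp: mult_ac)
      ultimately have I: "((\<lambda>t. of_real e * (?E t * ?U t)) has_integral
         (\<Sum>x\<in>X. of_real (\<rho> x) * h x * (2 / \<i> * (?E ?T * nbr_series (prop_coeff ?T) \<psi> x - \<psi> x)))) {0..?T}" by simp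
      have int_le: "norm (integral {0..?T} (\<lambda>t. of_real e * (?E t * ?U t))) \<le> integral {0..?T} (\<lambda>t. e * norm (?U t))"
      proof (rule integral_norm_bound_integral)
        show "(\<lambda>t. of_real e * (?E t * ?U t)) integrable_on {0..?T}" using I by blast
        show "(\<lambda>t. e * norm (?U t)) integrable_on {0..?T}"
          by (intro integrable_continuous_interval continuous_intros contU)
        fix t assume "t \<in> {0..?T}"
        then have "norm (?E t) * norm (?U t) \<le> 1 * norm (?U t)" by (intro mult_right_mono E1) auto
        then show "norm (of_real e * (?E t * ?U t)) \<le> e * norm (?U t)"
          using e(1) by (simp only: norm_mult norm_of_real abs_of_nonneg mult_left_mono mult_1)
      qed
      also have "\<dots> = e * integral {0..?T} (\<lambda>t. norm (?U t))" by simp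
      also have "\<dots> \<le> e * (C * ?K * ?H * D)" by (intro mult_left_mono U_le e)
      finally have n: "norm (\<Sum>x\<in>X. of_real (\<rho> x) * h x * (2 / \<i> * (?E ?T * nbr_series (prop_coeff ?T) \<psi> x - \<psi> x))) \<le> e * (C * ?K * ?H * D)"
        using integral_unique[OF I] by simp
      define P where "P = (\<Sum>x\<in>X. of_real (\<rho> x) * h x * (?E ?T * nbr_series (prop_coeff ?T) \<psi> x))"
      have hp: "of_real (\<rho> x) * h x * \<psi> x = of_real ((norm (h x))\<^sup>2)" for x
        unfolding norm_h by (simp add: h_def power_mult_distrib power2_eq_square complex_norm_square[unfolded power2_eq_square of_real_mult] mult_ac)
      have "(\<Sum>x\<in>X. of_real (\<rho> x) * h x * (2 / \<i> * (?E ?T * nbr_series (prop_coeff ?T) \<psi> x - \<psi> x)))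
        = 2 / \<i> * (P - (\<Sum>x\<in>X. of_real (\<rho> x) * h x * \<psi> x))"
        unfolding P_def sum_subtractf[symmetric] sum_distrib_left by (intro sum.cong refl) (simp add: algebra_simps)
      also have "\<dots> = 2 / \<i> * (P - of_real (\<Sum>x\<in>X. (norm (h x))\<^sup>2))" by (simp only: hp of_real_sum)
      finally have "2 * norm (P - of_real (\<Sum>x\<in>X. (norm (h x))\<^sup>2)) \<le> e * (C * ?K * ?H * D)"
        using n by (simp add: norm_mult norm_divide)
      moreover have "(\<Sum>x\<in>X. (norm (h x))\<^sup>2) = norm (complex_of_real (\<Sum>x\<in>X. (norm (h x))\<^sup>2))"
        unfolding norm_of_real by (simp add: sum_nonneg)
      moreover have "norm (complex_of_real (\<Sum>x\<in>X. (norm (h x))\<^sup>2)) \<le> norm P + norm (P - of_real (\<Sum>x\<in>X. (norm (h x))\<^sup>2))"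
        using norm_triangle_sub[of "complex_of_real (\<Sum>x\<in>X. (norm (h x))\<^sup>2)" P] by (simp add: norm_minus_commute)
      ultimately show ?thesis unfolding P_def by linarith
    qed
    have "(\<lambda>k. norm (\<Sum>x\<in>X. of_real (\<rho> x) * h x * (?E (2 ^ k) * nbr_series (prop_coeff (2 ^ k)) \<psi> x)) + e / 2 * (C * ?K * ?H * D))
       \<longlonglongrightarrow> norm (\<Sum>x\<in>X. of_real (\<rho> x) * h x * 0) + e / 2 * (C * ?K * ?H * D)"
      by (intro tendsto_intros decay)
    then have "(\<Sum>x\<in>X. (norm (h x))\<^sup>2) \<le> norm (\<Sum>x\<in>X. of_real (\<rho> x) * h x * 0) + e / 2 * (C * ?K * ?H * D)"
      by (rule LIMSEQ_le_const) (use id in auto)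
    then show ?thesis by (simp add: mult_ac)
  qed
  have hf: "norm (f x) = norm (h x)" for x by (simp add: norm_h norm_f)
  have hS: "l2norm h F \<le> S" if "finite F" for F
  proof -
    have "l2norm h F \<le> l2norm \<psi> F"
      using \<rho> by (intro L2_set_mono) (auto simp: norm_h mult_left_le_one_le)
    also have "\<dots> \<le> S" unfolding L2_set_def using S[OF that] S0 by (rule real_le_lsqrt[rotated]) 
    finally show ?thesis .
  qed
  \<comment> \<open>\<open>D\<close> is finite because \<open>|h| \<le> |\<psi>|\<close>; this lets
    \<open>D \<le> r D\<close> with \<open>r < 1\<close> force \<open>D = 0\<close>.\<close>
  define D where "D = (SUP F\<in>{F. finite F}. l2norm h F)"
  have bdd: "bdd_above ((\<lambda>F. l2norm h F) ` {F. finite F})"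
    using hS by (intro bdd_aboveI2) auto
  have D_ge: "l2norm h F \<le> D" if "finite F" for F
    unfolding D_def using that by (intro cSUP_upper bdd) auto
  let ?r = "e / 2 * (C * ?K)"
  have r: "0 \<le> ?r" "?r < 1" using e C(1) K0 by (auto simp: mult.assoc)
  have D0: "0 \<le> D" using D_ge[of "{}"] by simp
  have "l2norm h F \<le> ?r * D" if F: "finite F" for F
  proof (cases "l2norm h F = 0")
    case True
    then show ?thesis using r D0 by simp
  next
    case False
    then have pos: "0 < l2norm h F" using L2_set_nonneg[of "\<lambda>x. norm (h x)" F] by linarith
    have "(l2norm h F)\<^sup>2 = (\<Sum>x\<in>F. (norm (h x))\<^sup>2)"
      unfolding L2_set_def by (simp add: sum_nonneg)
    also have "\<dots> \<le> ?r * l2norm h F * D"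
      by (rule E_bound[OF F]) (simp add: hf D_ge)
    finally have "l2norm h F * l2norm h F \<le> (?r * D) * l2norm h F"
      by (simp add: power2_eq_square mult_ac)
    then show ?thesis using pos by (simp only: mult_le_cancel_right_pos)
  qed
  then have "D \<le> ?r * D" unfolding D_def by (intro cSUP_least) auto
  then have "D * (1 - ?r) \<le> 0" by (simp add: algebra_simps)
  then have "D = 0" using r D0 by (smt (verit, best) mult_pos_pos)
  then have "norm (h x) = 0" for x using D_ge[of "{x}"] by (simp add: L2_set_def)
  then have "of_real (\<rho> x) * f x = 0" for x using hf[of x] by simp
  then have g0: "g x = 0" for x by (simp add: g_def \<rho>f)
  \<comment> \<open>\<open>D = 0\<close> only yields \<open>W \<psi> = 0\<close>. Then the source
    vanishes, Duhamel's formula makes \<open>\<psi> x\<close> equal to the evolved term at every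
    time \<open>2^k\<close>, and that term tends to \<open>0\<close>.\<close>
  have "\<psi> x = 0" for x
  proof -
    have "nbr_series (prop_series q t) g x = 0" for t
      using nbr_series_bound[OF coeff_summable_prop_series[OF _ q], of g 0 t x] g0 by simp
    then have z: "((\<lambda>t. ?E t * nbr_series (prop_series q t) g x) has_integral 0) {0..2 ^ k}" for k :: nat
      by simp
    have "2 / \<i> * (?E (2 ^ k) * nbr_series (prop_coeff (2 ^ k)) \<psi> x - \<psi> x) = 0" for k
      using has_integral_unique[OF rep[of "2 ^ k" x, OF zero_le_power[OF zero_le_numeral]] z[of k]]
      by (simp only: of_real_power of_real_numeral)
    then have "(\<lambda>k. \<psi> x) \<longlonglongrightarrow> 0" using decay[of x] by simp
    then show ?thesis by (simp add: LIMSEQ_const_iff)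
  qed
  then show ?thesis by (simp add: fun_eq_iff)
qed

section \<open>Both half planes and the original eigenvalue problem\<close>

lemma nbr_series_cnj:
  fixes f :: "int ^ 'd::finite \<Rightarrow> complex"
  assumes "coeff_summable (2 * real CARD('d)) a" "\<And>x. norm (f x) \<le> B"
  shows "cnj (nbr_series a f x) = nbr_series (\<lambda>n. cnj (a n)) (\<lambda>x. cnj (f x)) x"
proof -
  have "(\<lambda>n. cnj (a n * (nbr_sum ^^ n) f x)) sums cnj (nbr_series a f x)"
    unfolding sums_cnj by (rule nbr_series_sums[OF assms])
  then show ?thesis by (simp add: nbr_series_def nbr_pow_cnj sums_iff)
qed

text \<open>Removes the sign condition on \<open>Im w\<close>. Conjugation replaces
  \<open>w\<close>, \<open>W\<close> and the coefficients by their conjugates, since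
  \<open>N\<close> is real, and changes neither \<open>coeff_norm\<close> nor the
  \<open>\<sigma>\<close>-sum of \<open>W\<close>.\<close>

lemma no_solution_shifted:
  assumes d: "CARD('d::finite) \<in> {3, 4}" and \<sigma>: "1 < \<sigma>" "2 * (\<sigma> - 1) < real CARD('d) / 2 - 1"
  obtains C where "C > 0"
    "\<And>(\<psi> :: int ^ 'd \<Rightarrow> complex) W q e w. (\<And>F. finite F \<Longrightarrow> (\<Sum>x\<in>F. norm (W x) powr \<sigma>) \<le> 1) \<Longrightarrow>
      \<psi> \<in> ell 2 \<Longrightarrow> coeff_summable (2 * real CARD('d)) q \<Longrightarrow>
      (\<And>x. nbr_sum \<psi> x = nbr_series q (\<lambda>x. of_real e * (W x * \<psi> x)) x + w * \<psi> x) \<Longrightarrow>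
      0 \<le> e \<Longrightarrow> e * C * coeff_norm (2 * real CARD('d)) q < 2 \<Longrightarrow> \<psi> = (\<lambda>x. 0)"
proof -
  obtain C where C: "C > 0"
    "dyadic_bound TYPE('d) \<sigma> C"
    by (rule dyadic_prop_form_bound[OF d \<sigma>]) blast
  have \<sigma>0: "0 < \<sigma>" using \<sigma> by simp
  show ?thesis
  proof (rule that[OF C(1)])
    fix \<psi> W :: "int ^ 'd \<Rightarrow> complex" and q e w
    assume W: "\<And>F. finite F \<Longrightarrow> (\<Sum>x\<in>F. norm (W x) powr \<sigma>) \<le> 1" and \<psi>: "\<psi> \<in> ell 2"
      and q: "coeff_summable (2 * real CARD('d)) q"
      and eq: "\<And>x. nbr_sum \<psi> x = nbr_series q (\<lambda>x. of_real e * (W x * \<psi> x)) x + w * \<psi> x"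
      and e: "0 \<le> e" "e * C * coeff_norm (2 * real CARD('d)) q < 2"
    show "\<psi> = (\<lambda>x. 0)"
    proof (cases "Im w \<le> 0")
      case True
      show ?thesis by (rule no_solution_lower_half_plane[OF d C \<sigma>0 W \<psi> q eq True e])
    next
      case False
      have cnj_\<psi>: "(\<lambda>x. cnj (\<psi> x)) \<in> ell 2" using \<psi> by (simp add: ell_def)
      have cnj_q: "coeff_summable (2 * real CARD('d)) (\<lambda>n. cnj (q n))" using q by (simp add: coeff_summable_def)
      have cnj_W: "(\<Sum>x\<in>F. norm (cnj (W x)) powr \<sigma>) \<le> 1" if "finite F" for F using W[OF that] by simp
      have sum\<psi>: "(\<lambda>x. (norm (\<psi> x))\<^sup>2) summable_on UNIV" using \<psi> by (simp add: ell_2_iff)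
      define S where "S = (\<Sum>\<^sub>\<infinity>x. (norm (\<psi> x))\<^sup>2)"
      have W1: "norm (W x) \<le> 1" for x by (rule norm_le_1_if_sum_powr_le_1[OF \<sigma>0 W])
      have bd: "norm (of_real e * (W x * \<psi> x)) \<le> e * sqrt S" for x
      proof -
        have "(norm (\<psi> x))\<^sup>2 \<le> S" unfolding S_def using finite_sum_le_infsum[OF sum\<psi>, of "{x}"] by simp
        then have "norm (\<psi> x) \<le> sqrt S" by (rule real_le_rsqrt)
        moreover have "norm (W x) * norm (\<psi> x) \<le> 1 * norm (\<psi> x)" by (intro mult_right_mono W1) auto
        ultimately show ?thesis using e(1) by (simp add: norm_mult mult_left_mono)
      qed
      have eqc: "nbr_sum (\<lambda>x. cnj (\<psi> x)) x = nbr_series (\<lambda>n. cnj (q n)) (\<lambda>x. of_real e * (cnj (W x) * cnj (\<psi> x))) x + cnj w * cnj (\<psi> x)" for x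
      proof -
        have "nbr_sum (\<lambda>x. cnj (\<psi> x)) x = cnj (nbr_sum \<psi> x)" by (simp add: nbr_sum_def)
        then show ?thesis by (simp add: eq nbr_series_cnj[OF q bd])
      qed
      have "(\<lambda>x. cnj (\<psi> x)) = (\<lambda>x. 0)"
        by (rule no_solution_lower_half_plane[OF d C \<sigma>0 cnj_W cnj_\<psi> cnj_q eqc])
          (use False e in \<open>simp_all add: coeff_norm_def\<close>)
      then show ?thesis by (simp add: fun_eq_iff)
    qed
  qed
qed

text \<open>Normalisation: with \<open>V = \<epsilon> W\<close> the smallness of the potential sits
  in the single factor \<open>\<epsilon>\<close>, and the estimates for weights of
  \<open>\<sigma>\<close>-sum at most \<open>1\<close> apply to \<open>W\<close>.\<close>

lemma ell_norm_le_imp_sum_le: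
  assumes \<sigma>: "0 < \<sigma>" and V: "V \<in> ell \<sigma>" "ell_norm \<sigma> V \<le> \<epsilon>" and \<epsilon>: "0 < \<epsilon>" and F: "finite F"
  shows "(\<Sum>x\<in>F. norm (V x / of_real \<epsilon>) powr \<sigma>) \<le> 1"
proof -
  let ?I = "\<Sum>\<^sub>\<infinity>x. norm (V x) powr \<sigma>"
  have I0: "0 \<le> ?I" by (simp add: infsum_nonneg)
  have "(\<Sum>x\<in>F. norm (V x) powr \<sigma>) \<le> ?I"
    using V(1) F by (intro finite_sum_le_infsum) (auto simp: ell_def)
  also have "?I = (?I powr (1 / \<sigma>)) powr \<sigma>" using \<sigma> I0 by (simp add: powr_powr)
  also have "\<dots> \<le> \<epsilon> powr \<sigma>"
    using V(2) \<sigma> by (intro powr_mono2) (auto simp: ell_norm_def)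
  finally have "(\<Sum>x\<in>F. norm (V x) powr \<sigma>) / \<epsilon> powr \<sigma> \<le> 1" using \<epsilon> by simp
  then show ?thesis using \<epsilon> by (simp add: norm_divide powr_divide sum_divide_distrib)
qed

theorem corollary6:
  fixes \<delta> :: real
  assumes "CARD('d::finite) \<in> {3, 4}"
    and "0 < \<delta>" and "\<delta> < 1 / 2"
  shows "\<exists>\<epsilon>>0. \<forall>V :: int ^ 'd \<Rightarrow> complex.
           V \<in> ell (sigma_exponent CARD('d) \<delta>) \<and>
           ell_norm (sigma_exponent CARD('d) \<delta>) V \<le> \<epsilon> \<longrightarrow>
           (\<forall>\<mu> :: complex. \<forall>\<psi> \<in> ell 2.
              (\<forall>x. sqrt_one_minus_laplacian \<psi> x + V x * \<psi> x = \<mu> * \<psi> x) \<longrightarrow>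
              \<psi> = (\<lambda>x. 0))"
proof -
  let ?\<sigma> = "sigma_exponent CARD('d) \<delta>" and ?R = "2 * real CARD('d)"
  \<comment> \<open>The second condition reads \<open>1/3 < 1/2\<close> for \<open>d = 3\<close> and
    \<open>1 - 2 \<delta> < 1\<close> for \<open>d = 4\<close>, which is where
    \<open>\<delta> > 0\<close> enters; \<open>\<delta> < 1/2\<close> gives
    \<open>\<sigma> > 1\<close>.\<close>
  have \<sigma>: "1 < ?\<sigma>" "2 * (?\<sigma> - 1) < real CARD('d) / 2 - 1"
    using assms by (auto simp: sigma_exponent_def)
  obtain C where C: "C > 0"
    "\<And>(\<psi> :: int ^ 'd \<Rightarrow> complex) W q e w. (\<And>F. finite F \<Longrightarrow> (\<Sum>x\<in>F. norm (W x) powr ?\<sigma>) \<le> 1) \<Longrightarrow>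
      \<psi> \<in> ell 2 \<Longrightarrow> coeff_summable ?R q \<Longrightarrow>
      (\<And>x. nbr_sum \<psi> x = nbr_series q (\<lambda>x. of_real e * (W x * \<psi> x)) x + w * \<psi> x) \<Longrightarrow>
      0 \<le> e \<Longrightarrow> e * C * coeff_norm ?R q < 2 \<Longrightarrow> \<psi> = (\<lambda>x. 0)"
    by (rule no_solution_shifted[OF assms(1) \<sigma>]) blast
  define a where "a = sqrt_coeff ?R"
  have a: "coeff_summable ?R a" unfolding a_def by (rule coeff_summable_sqrt_coeff) simp
  define a0 where "a0 = coeff_norm ?R a"
  have a0: "0 \<le> a0" unfolding a0_def by (rule coeff_norm_nonneg[OF _ a]) simp
  \<comment> \<open>\<open>1\<close> gives \<open>|V| \<le> 1\<close>. The other term is fitted to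
    \<open>coeff_norm q \<le> a0 + |\<mu>| \<le> 2 a0 + 1\<close>, so that one
    \<open>\<epsilon>\<close> serves for all \<open>\<mu>\<close> with
    \<open>|\<mu>| \<le> a0 + 1\<close>.\<close>
  define \<epsilon> where "\<epsilon> = min 1 (1 / (C * (2 * a0 + 1)))"
  have Ca: "0 < C * (2 * a0 + 1)" using C(1) a0 by (intro mult_pos_pos) auto
  then have \<epsilon>: "0 < \<epsilon>" "\<epsilon> \<le> 1" "\<epsilon> * C * (2 * a0 + 1) \<le> 1"
    by (auto simp: \<epsilon>_def min_def field_simps)
  have "\<psi> = (\<lambda>x. 0)"
    if V: "V \<in> ell ?\<sigma>" "ell_norm ?\<sigma> V \<le> \<epsilon>" and \<psi>: "\<psi> \<in> ell 2"
      and eq: "\<And>x. sqrt_one_minus_laplacian \<psi> x + V x * \<psi> x = \<mu> * \<psi> x"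
    for V \<psi> :: "int ^ 'd \<Rightarrow> complex" and \<mu>
  proof -
    have \<sigma>0: "0 < ?\<sigma>" using \<sigma> by simp
    define W where "W x = V x / of_real \<epsilon>" for x
    have W: "(\<Sum>x\<in>F. norm (W x) powr ?\<sigma>) \<le> 1" if "finite F" for F
      unfolding W_def by (rule ell_norm_le_imp_sum_le[OF \<sigma>0 V \<epsilon>(1) that])
    have VW: "V x = of_real \<epsilon> * W x" for x using \<epsilon>(1) by (simp add: W_def)
    have W1: "norm (W x) \<le> 1" for x by (rule norm_le_1_if_sum_powr_le_1[OF \<sigma>0 W])
    have V1: "norm (V x) \<le> 1" for x
      using mult_mono[OF \<epsilon>(2) W1[of x]] \<epsilon>(1) by (simp add: VW norm_mult)
    have A: "nbr_series a \<psi> x = \<mu> * \<psi> x - V x * \<psi> x" for x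
      using eq[of x] by (simp add: sqrt_one_minus_laplacian_eq_nbr_series[OF \<psi>] a_def algebra_simps)
    have sum\<psi>: "(\<lambda>x. (norm (\<psi> x))\<^sup>2) summable_on UNIV" using \<psi> by (simp add: ell_2_iff)
    have "norm (\<psi> x) \<le> sqrt (\<Sum>\<^sub>\<infinity>x. (norm (\<psi> x))\<^sup>2)" for x
      using finite_sum_le_infsum[OF sum\<psi>, of "{x}"] by (intro real_le_rsqrt) simp
    then have bdd: "bdd_above (range (\<lambda>x. norm (\<psi> x)))" by (intro bdd_aboveI2) auto
    define B where "B = (SUP x. norm (\<psi> x))"
    have B: "norm (\<psi> x) \<le> B" for x unfolding B_def by (intro cSUP_upper bdd) auto
    have B0: "0 \<le> B" by (rule order_trans[OF norm_ge_zero B])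
    have VB: "norm (V x * \<psi> x) \<le> B" for x
      using mult_mono[OF V1 B zero_le_one norm_ge_zero, of x x] by (simp add: norm_mult)
    have \<mu>B: "norm \<mu> * norm (\<psi> x) \<le> (a0 + 1) * B" for x
    proof -
      have "\<mu> * \<psi> x = nbr_series a \<psi> x + V x * \<psi> x" using A[of x] by simp
      then have "norm \<mu> * norm (\<psi> x) \<le> norm (nbr_series a \<psi> x) + norm (V x * \<psi> x)"
        by (metis norm_mult norm_triangle_ineq)
      also have "\<dots> \<le> a0 * B + B" unfolding a0_def by (intro add_mono nbr_series_bound[OF a B] VB)
      finally show ?thesis by (simp add: algebra_simps)
    qed
    show ?thesis
    \<comment> \<open>\<open>coeff_norm q\<close> grows with \<open>|\<mu>|\<close>, but
      \<open>\<epsilon>\<close> must not depend on \<open>\<mu>\<close>. For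
      \<open>|\<mu>| > a0 + 1\<close> the equation itself gives
      \<open>|\<mu>| B \<le> (a0 + 1) B\<close> for the supremum \<open>B\<close> of
      \<open>|\<psi>|\<close>, so \<open>B = 0\<close>.\<close>
    proof (cases "norm \<mu> \<le> a0 + 1")
      case False
      then have m0: "0 < norm \<mu>" using a0 by linarith
      have "norm (\<psi> x) \<le> (a0 + 1) * B / norm \<mu>" for x using \<mu>B[of x] m0 by (simp add: field_simps)
      then have "B \<le> (a0 + 1) * B / norm \<mu>" unfolding B_def by (intro cSUP_least) auto
      then have "B * (norm \<mu> - (a0 + 1)) \<le> 0" using m0 by (simp add: field_simps)
      then have "B \<le> 0" using False by (simp add: mult_le_0_iff)
      then have "norm (\<psi> x) \<le> 0" for x using B[of x] by linarith
      then show ?thesis by (simp add: fun_eq_iff)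
    next
      case True
      define q where "q n = a n + (if n = 0 then \<mu> else 0)" for n
      have q_sums: "(\<lambda>n. norm (a n) * ?R ^ n + (if n = 0 then norm \<mu> else 0)) sums (a0 + norm \<mu>)"
        unfolding a0_def coeff_norm_def using a
        by (intro sums_add sums_single summable_sums) (simp add: coeff_summable_def)
      have q_le: "norm (q n) * ?R ^ n \<le> norm (a n) * ?R ^ n + (if n = 0 then norm \<mu> else 0)" for n
        by (simp add: q_def norm_triangle_ineq)
      have q: "coeff_summable ?R q" unfolding coeff_summable_def
        by (rule summable_comparison_test'[OF sums_summable[OF q_sums]]) (use q_le in simp)
      have "coeff_norm ?R q \<le> a0 + norm \<mu>"
        unfolding coeff_norm_def using q
        by (intro suminf_le[OF q_le _ sums_summable[OF q_sums], unfolded sums_unique[OF q_sums, symmetric]]) (simp add: coeff_summable_def)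
      then have Kq: "coeff_norm ?R q \<le> 2 * a0 + 1" using True by linarith
      have nbr_series_q: "nbr_series q f x = nbr_series a f x + \<mu> * f x" if "\<And>x. norm (f x) \<le> D" for f :: "int ^ 'd \<Rightarrow> complex" and D x
      proof -
        have "(\<lambda>n. a n * (nbr_sum ^^ n) f x + (if n = 0 then \<mu> * f x else 0)) sums (nbr_series a f x + \<mu> * f x)"
          by (intro sums_add nbr_series_sums[OF a that] sums_single)
        moreover have "a n * (nbr_sum ^^ n) f x + (if n = 0 then \<mu> * f x else 0) = q n * (nbr_sum ^^ n) f x" for n
          by (simp add: q_def distrib_right)
        ultimately show ?thesis by (simp add: nbr_series_def sums_iff)
      qed
      have "nbr_sum \<psi> x = nbr_series q (\<lambda>x. of_real \<epsilon> * (W x * \<psi> x)) x + (1 + of_real ?R - \<mu>\<^sup>2) * \<psi> x" for x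
      proof -
        have AA: "nbr_series a (nbr_series a \<psi>) x = (1 + of_real ?R) * \<psi> x - nbr_sum \<psi> x"
        proof -
          have "nbr_series a (nbr_series a \<psi>) x = (\<Sum>k. coeff_conv a a k * (nbr_sum ^^ k) \<psi> x)"
            using nbr_series_nbr_series[OF a a B, where x = x] by (simp add: nbr_series_def)
          also have "\<dots> = (\<Sum>k\<in>{0, 1}. coeff_conv a a k * (nbr_sum ^^ k) \<psi> x)"
            by (rule suminf_finite) (auto simp: a_def sqrt_coeff_conv)
          finally show ?thesis by (simp add: a_def sqrt_coeff_conv)
        qed
        have \<mu>\<psi>: "norm (\<mu> * \<psi> x) \<le> norm \<mu> * B" for x unfolding norm_mult by (intro mult_left_mono B) auto
        have mV: "norm (- 1 * (V x * \<psi> x)) \<le> B" for x using VB[of x] by simp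
        \<comment> \<open>With \<open>A\<close> for \<open>sqrt (1 - \<Delta>)\<close>, substituting
          \<open>A \<psi> = \<mu> \<psi> - V \<psi>\<close> twice gives
          \<open>A^2 \<psi> = \<mu>^2 \<psi> - (A + \<mu>) (V \<psi>)\<close>; comparison with
          \<open>A^2 = 1 + 2 d - N\<close> isolates \<open>N \<psi>\<close>.\<close>
        have "nbr_series a (nbr_series a \<psi>) x = nbr_series a (\<lambda>x. \<mu> * \<psi> x + - 1 * (V x * \<psi> x)) x"
          by (simp add: A[abs_def])
        also have "\<dots> = nbr_series a (\<lambda>x. \<mu> * \<psi> x) x + nbr_series a (\<lambda>x. - 1 * (V x * \<psi> x)) x"
          by (rule nbr_series_add[OF a \<mu>\<psi> mV])
        also have "\<dots> = \<mu> * nbr_series a \<psi> x + - 1 * nbr_series a (\<lambda>x. V x * \<psi> x) x"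
          by (simp only: nbr_series_scale[OF a B] nbr_series_scale[OF a VB])
        also have "\<dots> = \<mu>\<^sup>2 * \<psi> x - nbr_series q (\<lambda>x. V x * \<psi> x) x"
          unfolding nbr_series_q[OF VB] A by (simp add: algebra_simps power2_eq_square)
        finally have "nbr_sum \<psi> x = nbr_series q (\<lambda>x. V x * \<psi> x) x + (1 + of_real ?R - \<mu>\<^sup>2) * \<psi> x"
          unfolding AA by (simp add: algebra_simps)
        then show ?thesis by (simp add: VW mult.assoc)
      qed
      moreover have "\<epsilon> * C * coeff_norm ?R q < 2"
      proof -
        have "\<epsilon> * C * coeff_norm ?R q \<le> \<epsilon> * C * (2 * a0 + 1)"
          using \<epsilon>(1) C(1) by (intro mult_left_mono Kq) auto
        then show ?thesis using \<epsilon>(3) by linarith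
      qed
      ultimately show ?thesis by (intro C(2)[OF W \<psi> q]) (use \<epsilon>(1) in auto)
    qed
  qed
  then show ?thesis using \<epsilon>(1) by (intro exI[of _ \<epsilon>]) blast
qed

end
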